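(* Let $\mathcal{Q}$ be a class of finite graphs such that $$\lim_{n\to\infty}\frac{\log_2|\mathcal{Q}_n|}{\binom{n}{2}}=\max_{\Gamma\in\widehat{\mathcal{Q}}}\operatorname{Ent}(\Gamma).$$ For each $n$, let $G_n$ be a uniformly random unlabeled element of $\mathcal{Q}_n$. Then for every $\delta>0$, $\lim_{n\to\infty}\Pr(G_n\in A_\delta(\mathcal{Q}))=1$. The same conclusion holds if each $G_n$ is instead a uniformly random labeled graph with vertex set $[n]$ belonging to $\mathcal{Q}$.
   Context: $\mathcal{Q}_n$ is the set of unlabeled graphs on $n$ vertices in $\mathcal{Q}$. A graphon is a measurable symmetric function $W:[0,1]^2\to[0,1]$; graph limits are limits of convergent graph sequences (Lovász–Szegedy); every graphon represents a graph limit and every graph limit is represented by a graphon. Each finite graph is identified with an element of the (completed) space of graphs and graph limits, on which $\delta_\square$ denotes the standard cut metric. The entropy of a graph limit is $\int_0^1\int_0^1 h(W(x,y))\,dx\,dy$ for any representing graphon $W$, where $h(x)=-x\log_2x-(1-x)\log_2(1-x)$. $\widehat{\mathcal{Q}}$ is the set of graph limits of sequences in $\mathcal{Q}$ with number of vertices tending to infinity, and $\widehat{\mathcal{Q}}^{\max}$ is the set of its elements of maximal entropy. For $\delta>0$, $A_\delta(\mathcal{Q})$ is the set of elements $\Gamma$ of that space with $\delta_\square(\Gamma,\widehat{\mathcal{Q}}^{\max})<\delta$. *)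

theory Defs
  imports "HOL-Probability.Probability"
begin

section \<open>Finite simple graphs and graph classes\<close>

text \<open>A pair \<open>(n, E)\<close> is the labeled simple graph with vertex set \<open>{1..n}\<close> and edge set \<open>E\<close>,
  edges being two-element sets of vertices.\<close>

type_synonym graph = "nat \<times> nat set set"

definition is_graph :: "graph \<Rightarrow> bool" where
  "is_graph G \<longleftrightarrow> snd G \<subseteq> {e. e \<subseteq> {1..fst G} \<and> card e = 2}"

definition isomorphic :: "graph \<Rightarrow> graph \<Rightarrow> bool" where
  "isomorphic G H \<longleftrightarrow>
     (\<exists>f. bij_betw f {1..fst G} {1..fst H} \<and> snd H = (\<lambda>e. f ` e) ` snd G)"

definition iso_rel :: "(graph \<times> graph) set" where
  "iso_rel = {(G, H). is_graph G \<and> is_graph H \<and> isomorphic G H}"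

definition graph_class :: "graph set \<Rightarrow> bool" where
  "graph_class Q \<longleftrightarrow> (\<forall>G\<in>Q. is_graph G) \<and> (\<forall>G\<in>Q. \<forall>H. (G, H) \<in> iso_rel \<longrightarrow> H \<in> Q)"

definition labeled :: "graph set \<Rightarrow> nat \<Rightarrow> graph set" where
  "labeled Q n = {G \<in> Q. fst G = n}"

text \<open>An unlabeled graph is an isomorphism class of labeled graphs.\<close>

definition unlabeled :: "graph set \<Rightarrow> nat \<Rightarrow> graph set set" where
  "unlabeled Q n = labeled Q n // iso_rel"

section \<open>Graphons and the cut metric\<close>

definition unit_measure :: "real measure" where
  "unit_measure = restrict_space lborel {0..1}"

text \<open>Only the values on \<open>[0,1]\<^sup>2\<close> matter.  Measurability is Borel measurability; a Lebesgue
  measurable graphon agrees almost everywhere with a Borel measurable one.\<close>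

definition graphons :: "(real \<Rightarrow> real \<Rightarrow> real) set" where
  "graphons = {W. (\<lambda>(x, y). W x y) \<in> borel_measurable (unit_measure \<Otimes>\<^sub>M unit_measure) \<and>
     (\<forall>x\<in>{0..1}. \<forall>y\<in>{0..1}. W x y = W y x \<and> W x y \<in> {0..1})}"

definition cut_norm :: "(real \<Rightarrow> real \<Rightarrow> real) \<Rightarrow> real" where
  "cut_norm U = (SUP (S, T) \<in> sets unit_measure \<times> sets unit_measure.
     \<bar>LINT p : S \<times> T | unit_measure \<Otimes>\<^sub>M unit_measure. U (fst p) (snd p)\<bar>)"

definition measure_preserving_bij :: "(real \<Rightarrow> real) set" where
  "measure_preserving_bij = {f. bij_betw f {0..1} {0..1} \<and>
     f \<in> unit_measure \<rightarrow>\<^sub>M unit_measure \<and>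
     the_inv_into {0..1} f \<in> unit_measure \<rightarrow>\<^sub>M unit_measure \<and>
     distr unit_measure unit_measure f = unit_measure}"

definition cut_dist :: "(real \<Rightarrow> real \<Rightarrow> real) \<Rightarrow> (real \<Rightarrow> real \<Rightarrow> real) \<Rightarrow> real" where
  "cut_dist U W = (INF f \<in> measure_preserving_bij. cut_norm (\<lambda>x y. U x y - W (f x) (f y)))"

section \<open>Graph limits\<close>

text \<open>A graph limit is a class of graphons at mutual cut distance \<open>0\<close>, so that the cut distance
  is a metric; equivalently, a class of graphons with the same homomorphism densities.  The
  graphons representing a graph limit are its elements.\<close>

definition weak_iso :: "((real \<Rightarrow> real \<Rightarrow> real) \<times> (real \<Rightarrow> real \<Rightarrow> real)) set" where
  "weak_iso = {(U, W). U \<in> graphons \<and> W \<in> graphons \<and> cut_dist U W = 0}"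

type_synonym limit = "(real \<Rightarrow> real \<Rightarrow> real) set"

definition graph_limits :: "limit set" where
  "graph_limits = graphons // weak_iso"

text \<open>The functionals of graphons below are invariant under \<open>weak_iso\<close>, so their values on a
  graph limit do not depend on the representing graphon chosen here.\<close>

definition rep :: "limit \<Rightarrow> (real \<Rightarrow> real \<Rightarrow> real)" where
  "rep \<Gamma> = (SOME W. W \<in> \<Gamma>)"

definition delta_cut :: "limit \<Rightarrow> limit \<Rightarrow> real" where
  "delta_cut \<Gamma> \<Gamma>' = cut_dist (rep \<Gamma>) (rep \<Gamma>')"

text \<open>The distance to the empty set is \<open>\<infinity>\<close>.\<close>

definition delta_cut_set :: "limit \<Rightarrow> limit set \<Rightarrow> ereal" where
  "delta_cut_set \<Gamma> S = (INF \<Gamma>'\<in>S. ereal (delta_cut \<Gamma> \<Gamma>'))"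

text \<open>Vertex \<open>i\<close> of a graph on \<open>n\<close> vertices corresponds to the interval \<open>((i-1)/n, i/n]\<close>; the
  point \<open>0\<close> corresponds to no vertex.\<close>

definition graph_graphon :: "graph \<Rightarrow> real \<Rightarrow> real \<Rightarrow> real" where
  "graph_graphon G x y =
     (if {nat \<lceil>real (fst G) * x\<rceil>, nat \<lceil>real (fst G) * y\<rceil>} \<in> snd G then 1 else 0)"

definition graph_point :: "graph \<Rightarrow> limit" where
  "graph_point G = weak_iso `` {graph_graphon G}"

definition unlabeled_point :: "graph set \<Rightarrow> limit" where
  "unlabeled_point C = graph_point (SOME G. G \<in> C)"

section \<open>Convergence of graph sequences\<close>

definition hom_density :: "graph \<Rightarrow> graph \<Rightarrow> real" where
  "hom_density F G =
     real (card {f \<in> {1..fst F} \<rightarrow>\<^sub>E {1..fst G}. \<forall>e\<in>snd F. f ` e \<in> snd G})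
       / real (fst G) ^ fst F"

text \<open>An edge \<open>e\<close> contributes the factor \<open>W (x i) (x j)\<close> with \<open>e = {i, j}\<close>; by symmetry of \<open>W\<close>
  we may take \<open>i < j\<close>.\<close>

definition graphon_density :: "graph \<Rightarrow> (real \<Rightarrow> real \<Rightarrow> real) \<Rightarrow> real" where
  "graphon_density F W =
     (LINT x | Pi\<^sub>M {1..fst F} (\<lambda>_. unit_measure). (\<Prod>e\<in>snd F. W (x (Min e)) (x (Max e))))"

definition converges_to :: "(nat \<Rightarrow> graph) \<Rightarrow> limit \<Rightarrow> bool" where
  "converges_to G \<Gamma> \<longleftrightarrow>
     (\<forall>F. is_graph F \<longrightarrow> (\<lambda>k. hom_density F (G k)) \<longlonglongrightarrow> graphon_density F (rep \<Gamma>))"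

definition class_limits :: "graph set \<Rightarrow> limit set" where
  "class_limits Q = {\<Gamma> \<in> graph_limits. \<exists>G. (\<forall>k. G k \<in> Q) \<and>
     filterlim (\<lambda>k. fst (G k)) at_top sequentially \<and> converges_to G \<Gamma>}"

section \<open>Entropy\<close>

text \<open>Since \<open>log 2 0 = 0\<close>, this gives the usual value \<open>0\<close> at \<open>0\<close> and \<open>1\<close>.\<close>

definition binary_entropy :: "real \<Rightarrow> real" where
  "binary_entropy x = - x * log 2 x - (1 - x) * log 2 (1 - x)"

definition Ent :: "limit \<Rightarrow> real" where
  "Ent \<Gamma> = (LINT x | unit_measure. LINT y | unit_measure. binary_entropy (rep \<Gamma> x y))"

definition max_Ent :: "graph set \<Rightarrow> real" where
  "max_Ent Q = (GREATEST m. m \<in> Ent ` class_limits Q)"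

definition max_class_limits :: "graph set \<Rightarrow> limit set" where
  "max_class_limits Q = {\<Gamma> \<in> class_limits Q. \<forall>\<Gamma>'\<in>class_limits Q. Ent \<Gamma>' \<le> Ent \<Gamma>}"

definition near_max :: "graph set \<Rightarrow> real \<Rightarrow> limit set" where
  "near_max Q \<delta> = {\<Gamma> \<in> graph_limits. delta_cut_set \<Gamma> (max_class_limits Q) < ereal \<delta>}"

end

theory Submission
  imports Defs "HOL-Real_Asymp.Real_Asymp"
begin

text \<open>Graphs in \<open>Q\<close> that stay away from the maximal limits, if their probability were bounded below for
  infinitely many \<open>n\<close>, would number at least \<open>2\<close> to the power \<open>(max_Ent Q - o(1)) n\<^sup>2 / 2\<close>.  By weak
  regularity each of them is cut-close to the step graphon of its block averages for a partition
  into boundedly many blocks.  There are only \<open>2\<close> to the power \<open>o(n\<^sup>2)\<close> possible partitions and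
  block averages, and at most \<open>2\<close> to the power \<open>n\<^sup>2 Ent / 2\<close> graphs share given ones, so by the
  pigeonhole principle some of these graphs are cut-close to graphons of entropy at least
  \<open>max_Ent Q - o(1)\<close>.  By compactness and upper semicontinuity of the entropy a subsequence
  converges to a limit of entropy at least \<open>max_Ent Q\<close>; by the counting lemma this limit belongs to
  \<open>class_limits Q\<close>, so it is maximal, a contradiction.

  Compactness is total boundedness (regularity, sorting the blocks, rounding) plus completeness.  The
  limits needed for completeness and semicontinuity come from iterated midpoints of a sequence of
  graphons, which converge almost everywhere when chosen with nearly minimal \<open>L\<^sup>2\<close> norm.\<close>

subsection \<open>The cut metric\<close>

text \<open>One estimate serves both models: graphs in \<open>labeled Q n\<close> that stay away
  from the maximum are eventually fewer than \<open>c * card (unlabeled Q n)\<close>.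
  Representatives inject the bad isomorphism classes into such a set of labeled graphs, and there
  are at most as many unlabeled as labeled graphs. The shape of the proof comes from the entropy
  being only upper semicontinuous for the cut metric: a quasirandom sequence of 0/1 graphons has
  entropy 0 but may converge to the constant 1/2, of entropy 1. So a single graph carries no
  entropy; it has to be read off from the number of graphs that share block averages, and
  semicontinuity is applied to the averages instead of the graphs. Midpoints fit because all that
  must survive a limit is convex: cut-norm balls, lower bounds on the entropy, the set of graphons.
  The number of blocks depends on the accuracy. Hence the accuracy is fixed first, and only then a
  graph so large that the number of partitions and block averages is negligible.\<close>

lemma space_unit_measure [simp]: "space unit_measure = {0..1}"
  by (simp add: unit_measure_def space_restrict_space)

lemma prob_space_unit_measure: "prob_space unit_measure"
  by standard (simp add: unit_measure_def emeasure_restrict_space space_restrict_space)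

interpretation unit_measure: prob_space unit_measure
  by (rule prob_space_unit_measure)

abbreviation unit_square :: "(real \<times> real) measure" where
  "unit_square \<equiv> unit_measure \<Otimes>\<^sub>M unit_measure"

interpretation unit_square: pair_prob_space unit_measure unit_measure ..

lemma space_unit_square [simp]: "space unit_square = {0..1} \<times> {0..1}"
  by (simp add: space_pair_measure)

lemma measurable_unit_measure_real [measurable]: "(\<lambda>x. x) \<in> borel_measurable unit_measure"
  by (simp add: unit_measure_def measurable_restrict_space1)

section \<open>Bounded kernels, the L1 norm and the cut norm\<close>

definition bounded_kernel :: "(real \<Rightarrow> real \<Rightarrow> real) \<Rightarrow> bool" where
  "bounded_kernel D \<longleftrightarrow> (\<lambda>(x, y). D x y) \<in> borel_measurable unit_square \<and>
     (\<exists>B. \<forall>x\<in>{0..1}. \<forall>y\<in>{0..1}. \<bar>D x y\<bar> \<le> B)"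

lemma kernel_measurable: "bounded_kernel D \<Longrightarrow> (\<lambda>p. D (fst p) (snd p)) \<in> borel_measurable unit_square"
  by (simp add: bounded_kernel_def case_prod_unfold)

lemma kernelI:
  assumes "(\<lambda>p. D (fst p) (snd p)) \<in> borel_measurable unit_square"
    and "\<And>x y. x \<in> {0..1} \<Longrightarrow> y \<in> {0..1} \<Longrightarrow> \<bar>D x y\<bar> \<le> B"
  shows "bounded_kernel D"
  using assms unfolding bounded_kernel_def case_prod_unfold by blast

lemma graphon_kernel: "W \<in> graphons \<Longrightarrow> bounded_kernel W"
  unfolding graphons_def bounded_kernel_def by (auto intro!: exI[of _ 1])

lemma graphonI:
  assumes "(\<lambda>p. W (fst p) (snd p)) \<in> borel_measurable unit_square"
    and "\<And>x y. x \<in> {0..1} \<Longrightarrow> y \<in> {0..1} \<Longrightarrow> W x y = W y x"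
    and "\<And>x y. x \<in> {0..1} \<Longrightarrow> y \<in> {0..1} \<Longrightarrow> W x y \<in> {0..1}"
  shows "W \<in> graphons"
  using assms by (auto simp: graphons_def case_prod_unfold)

lemma graphon_bounds: "W \<in> graphons \<Longrightarrow> x \<in> {0..1} \<Longrightarrow> y \<in> {0..1} \<Longrightarrow> 0 \<le> W x y \<and> W x y \<le> 1"
  by (auto simp: graphons_def)

lemma graphon_sym: "W \<in> graphons \<Longrightarrow> x \<in> {0..1} \<Longrightarrow> y \<in> {0..1} \<Longrightarrow> W x y = W y x"
  by (auto simp: graphons_def)

lemma kernel_add:
  assumes "bounded_kernel D" "bounded_kernel E" shows "bounded_kernel (\<lambda>x y. D x y + E x y)"
proof -
  obtain B C where B: "\<forall>x\<in>{0..1}. \<forall>y\<in>{0..1}. \<bar>D x y\<bar> \<le> B" "\<forall>x\<in>{0..1}. \<forall>y\<in>{0..1}. \<bar>E x y\<bar> \<le> C"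
    using assms unfolding bounded_kernel_def by blast
  show ?thesis
  proof (rule kernelI[where B = "B + C"])
    show "(\<lambda>p. D (fst p) (snd p) + E (fst p) (snd p)) \<in> borel_measurable unit_square"
      by (intro borel_measurable_add kernel_measurable assms)
  qed (use B in \<open>auto intro!: order_trans[OF abs_triangle_ineq] add_mono\<close>)
qed

lemma kernel_cmult:
  assumes "bounded_kernel D" shows "bounded_kernel (\<lambda>x y. c * D x y)"
proof -
  obtain B where B: "\<forall>x\<in>{0..1}. \<forall>y\<in>{0..1}. \<bar>D x y\<bar> \<le> B"
    using assms unfolding bounded_kernel_def by blast
  show ?thesis
  proof (rule kernelI[where B = "\<bar>c\<bar> * B"])
    show "(\<lambda>p. c * D (fst p) (snd p)) \<in> borel_measurable unit_square"
      by (intro borel_measurable_const borel_measurable_times kernel_measurable assms)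
  qed (use B in \<open>auto intro!: mult_left_mono simp: abs_mult\<close>)
qed

lemma kernel_diff: "bounded_kernel D \<Longrightarrow> bounded_kernel E \<Longrightarrow> bounded_kernel (\<lambda>x y. D x y - E x y)"
  using kernel_add[of D "\<lambda>x y. (-1) * E x y"] kernel_cmult[of E "-1"] by simp

lemma kernel_integrable:
  assumes "bounded_kernel D" shows "integrable unit_square (\<lambda>p. D (fst p) (snd p))"
proof -
  obtain B where B: "\<forall>x\<in>{0..1}. \<forall>y\<in>{0..1}. \<bar>D x y\<bar> \<le> B"
    using assms unfolding bounded_kernel_def by blast
  show ?thesis
    by (rule unit_square.P.integrable_const_bound[where B = B])
       (use B in \<open>auto intro!: AE_I2 kernel_measurable assms\<close>)
qed

lemma kernel_set_integrable:
  assumes "bounded_kernel D" "A \<in> sets unit_square"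
  shows "set_integrable unit_square A (\<lambda>p. D (fst p) (snd p))"
  using integrable_mult_indicator[OF assms(2) kernel_integrable[OF assms(1)]]
  by (simp add: set_integrable_def)

definition L1norm :: "(real \<Rightarrow> real \<Rightarrow> real) \<Rightarrow> real" where
  "L1norm D = (LINT p | unit_square. \<bar>D (fst p) (snd p)\<bar>)"

lemma rectangle_le_L1norm:
  assumes "bounded_kernel D" "A \<in> sets unit_square"
  shows "\<bar>LINT p : A | unit_square. D (fst p) (snd p)\<bar> \<le> L1norm D"
proof -
  have "\<bar>LINT p : A | unit_square. D (fst p) (snd p)\<bar>
      \<le> (LINT p | unit_square. \<bar>indicator A p *\<^sub>R D (fst p) (snd p)\<bar>)"
    unfolding set_lebesgue_integral_def by (rule integral_abs_bound)
  also have "\<dots> \<le> L1norm D"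
    unfolding L1norm_def
    by (rule integral_mono)
       (use kernel_set_integrable[OF assms] kernel_integrable[OF assms(1)] in
         \<open>auto simp: set_integrable_def abs_mult indicator_def dest: integrable_abs\<close>)
  finally show ?thesis .
qed

text \<open>A supremum of reals is meaningful only for a bounded set of values;
  \<open>L1norm D\<close> bounds the integrals over all rectangles.\<close>

lemma cut_norm_upper:
  assumes "bounded_kernel D" "S \<in> sets unit_measure" "T \<in> sets unit_measure"
  shows "\<bar>LINT p : S \<times> T | unit_square. D (fst p) (snd p)\<bar> \<le> cut_norm D"
  unfolding cut_norm_def
proof (rule cSUP_upper2[where x = "(S, T)"])
  show "bdd_above ((\<lambda>(S, T). \<bar>LINT p:S \<times> T|unit_square. D (fst p) (snd p)\<bar>) `
      (sets unit_measure \<times> sets unit_measure))"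
    by (rule bdd_aboveI[where M = "L1norm D"]) (auto intro!: rectangle_le_L1norm assms pair_measureI)
qed (use assms in auto)

lemma cut_norm_least:
  assumes "\<And>S T. S \<in> sets unit_measure \<Longrightarrow> T \<in> sets unit_measure \<Longrightarrow>
     \<bar>LINT p : S \<times> T | unit_square. D (fst p) (snd p)\<bar> \<le> c"
  shows "cut_norm D \<le> c"
  unfolding cut_norm_def by (rule cSUP_least) (use assms in auto)

lemma cut_norm_nonneg: "bounded_kernel D \<Longrightarrow> 0 \<le> cut_norm D"
  by (rule order_trans[OF abs_ge_zero cut_norm_upper[of D "{}" "{}"]]) auto

lemma cut_norm_le_L1norm: "bounded_kernel D \<Longrightarrow> cut_norm D \<le> L1norm D"
  by (intro cut_norm_least rectangle_le_L1norm pair_measureI)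

lemma cut_norm_cong:
  assumes "\<And>x y. x \<in> {0..1} \<Longrightarrow> y \<in> {0..1} \<Longrightarrow> D x y = E x y"
  shows "cut_norm D = cut_norm E"
proof -
  have "(LINT p : A | unit_square. D (fst p) (snd p)) = (LINT p : A | unit_square. E (fst p) (snd p))" for A
    unfolding set_lebesgue_integral_def by (rule Bochner_Integration.integral_cong) (auto simp: assms)
  then show ?thesis unfolding cut_norm_def by simp
qed

lemma cut_norm_triangle:
  assumes "bounded_kernel D" "bounded_kernel E"
  shows "cut_norm (\<lambda>x y. D x y + E x y) \<le> cut_norm D + cut_norm E"
proof (rule cut_norm_least)
  fix S T assume ST: "S \<in> sets unit_measure" "T \<in> sets unit_measure"
  have A: "S \<times> T \<in> sets unit_square" using ST by (rule pair_measureI)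
  have "(LINT p : S \<times> T | unit_square. D (fst p) (snd p) + E (fst p) (snd p))
     = (LINT p : S \<times> T | unit_square. D (fst p) (snd p)) + (LINT p : S \<times> T | unit_square. E (fst p) (snd p))"
    by (rule set_integral_add) (auto intro: kernel_set_integrable assms A)
  then show "\<bar>LINT p : S \<times> T | unit_square. D (fst p) (snd p) + E (fst p) (snd p)\<bar> \<le> cut_norm D + cut_norm E"
    using cut_norm_upper[OF assms(1) ST] cut_norm_upper[OF assms(2) ST] by linarith
qed

lemma cut_norm_cmult: "cut_norm (\<lambda>x y. c * D x y) = \<bar>c\<bar> * cut_norm D" if "bounded_kernel D" "c \<noteq> 0"
proof (rule antisym)
  have *: "cut_norm (\<lambda>x y. c * D x y) \<le> \<bar>c\<bar> * cut_norm D" if "bounded_kernel D" for c D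
    by (rule cut_norm_least) (auto simp: abs_mult intro!: mult_left_mono cut_norm_upper that)
  show "cut_norm (\<lambda>x y. c * D x y) \<le> \<bar>c\<bar> * cut_norm D" using * that by blast
  show "\<bar>c\<bar> * cut_norm D \<le> cut_norm (\<lambda>x y. c * D x y)"
    using *[OF kernel_cmult[of D c], of "inverse c"] that
    by (simp add: field_simps flip: mult.assoc)
qed

lemma cut_norm_minus: "bounded_kernel D \<Longrightarrow> cut_norm (\<lambda>x y. - D x y) = cut_norm D"
  using cut_norm_cmult[of D "-1"] by simp

lemma cut_norm_diff_commute:
  "bounded_kernel D \<Longrightarrow> bounded_kernel E \<Longrightarrow> cut_norm (\<lambda>x y. D x y - E x y) = cut_norm (\<lambda>x y. E x y - D x y)"
  using cut_norm_minus[OF kernel_diff, of D E] by simp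

lemma cut_norm_diff_triangle:
  assumes "bounded_kernel D" "bounded_kernel E" "bounded_kernel F"
  shows "cut_norm (\<lambda>x y. D x y - F x y) \<le> cut_norm (\<lambda>x y. D x y - E x y) + cut_norm (\<lambda>x y. E x y - F x y)"
  using cut_norm_triangle[OF kernel_diff[OF assms(1,2)] kernel_diff[OF assms(2,3)]] by simp

section \<open>Measure-preserving bijections of the unit interval\<close>

lemma mpb_measurable: "f \<in> measure_preserving_bij \<Longrightarrow> f \<in> unit_measure \<rightarrow>\<^sub>M unit_measure"
  by (simp add: measure_preserving_bij_def)

lemma mpb_in: "f \<in> measure_preserving_bij \<Longrightarrow> x \<in> {0..1} \<Longrightarrow> f x \<in> {0..1}"
  using measurable_space[OF mpb_measurable] by simp

lemma mpb_id: "(\<lambda>x. x) \<in> measure_preserving_bij"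
proof -
  have "the_inv_into {0..1} (\<lambda>x. x) \<in> unit_measure \<rightarrow>\<^sub>M unit_measure
        \<longleftrightarrow> (\<lambda>x. x) \<in> unit_measure \<rightarrow>\<^sub>M unit_measure"
    by (rule measurable_cong) (auto intro: the_inv_into_f_eq)
  then show ?thesis
    by (auto simp: measure_preserving_bij_def bij_betw_def distr_id2)
qed

lemma mpb_comp:
  assumes f: "f \<in> measure_preserving_bij" and g: "g \<in> measure_preserving_bij"
  shows "(\<lambda>x. f (g x)) \<in> measure_preserving_bij"
proof -
  have bf: "bij_betw f {0..1} {0..1}" and bg: "bij_betw g {0..1} {0..1}"
    using f g by (auto simp: measure_preserving_bij_def)
  have b: "bij_betw (f \<circ> g) {0..1} {0..1}" using bij_betw_trans[OF bg bf] .
  have inv: "the_inv_into {0..1} (\<lambda>x. f (g x)) x = the_inv_into {0..1} g (the_inv_into {0..1} f x)"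
    if "x \<in> {0..1}" for x
    using the_inv_into_comp[of f g "{0..1}" x] bf bg that
    by (auto simp: bij_betw_def o_def)
  have "the_inv_into {0..1} (\<lambda>x. f (g x)) \<in> unit_measure \<rightarrow>\<^sub>M unit_measure \<longleftrightarrow>
     (\<lambda>x. the_inv_into {0..1} g (the_inv_into {0..1} f x)) \<in> unit_measure \<rightarrow>\<^sub>M unit_measure"
    by (rule measurable_cong) (use inv in auto)
  moreover have "(\<lambda>x. the_inv_into {0..1} g (the_inv_into {0..1} f x)) \<in> unit_measure \<rightarrow>\<^sub>M unit_measure"
    by (rule measurable_compose[of _ _ unit_measure]) (use f g in \<open>auto simp: measure_preserving_bij_def\<close>)
  moreover have "distr unit_measure unit_measure (\<lambda>x. f (g x)) = unit_measure"
    using distr_distr[of f unit_measure unit_measure g unit_measure] f g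
    by (simp add: measure_preserving_bij_def o_def)
  ultimately show ?thesis
    using b measurable_compose[OF mpb_measurable[OF g] mpb_measurable[OF f]]
    by (simp add: measure_preserving_bij_def o_def)
qed

lemma mpb_inv:
  assumes f: "f \<in> measure_preserving_bij"
  obtains g where "g \<in> measure_preserving_bij"
    "\<And>x. x \<in> {0..1} \<Longrightarrow> f (g x) = x" "\<And>x. x \<in> {0..1} \<Longrightarrow> g (f x) = x"
proof
  let ?g = "the_inv_into {0..1} f"
  have bf: "bij_betw f {0..1} {0..1}" and gm: "?g \<in> unit_measure \<rightarrow>\<^sub>M unit_measure"
    and d: "distr unit_measure unit_measure f = unit_measure"
    using f by (auto simp: measure_preserving_bij_def)
  show fg: "\<And>x. x \<in> {0..1} \<Longrightarrow> f (?g x) = x" 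
    using bf by (auto simp: bij_betw_def intro: f_the_inv_into_f)
  show gf: "\<And>x. x \<in> {0..1} \<Longrightarrow> ?g (f x) = x"
    using bf by (auto simp: bij_betw_def intro: the_inv_into_f_f)
  have bg: "bij_betw ?g {0..1} {0..1}" using bf by (rule bij_betw_the_inv_into)
  have "the_inv_into {0..1} ?g x = f x" if "x \<in> {0..1}" for x
    by (rule the_inv_into_f_eq[OF bij_betw_imp_inj_on[OF bg] gf[OF that] mpb_in[OF f that]])
  then have "the_inv_into {0..1} ?g \<in> unit_measure \<rightarrow>\<^sub>M unit_measure \<longleftrightarrow> f \<in> unit_measure \<rightarrow>\<^sub>M unit_measure"
    by (intro measurable_cong) auto
  \<comment> \<open>\<open>f\<close> preserves the measure, so the image measure under
    \<open>?g\<close> is the image measure under \<open>?g\<close> after \<open>f\<close>, which is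
    the identity.\<close>
  moreover have "distr unit_measure unit_measure ?g = distr (distr unit_measure unit_measure f) unit_measure ?g"
    by (simp add: d)
  moreover have "\<dots> = distr unit_measure unit_measure (\<lambda>x. x)"
    by (subst distr_distr[OF gm mpb_measurable[OF f]]) (rule distr_cong, auto simp: gf)
  ultimately show "?g \<in> measure_preserving_bij"
    using bg gm mpb_measurable[OF f] by (simp add: measure_preserving_bij_def distr_id2)
qed

lemma distr_mpb_square:
  assumes f: "f \<in> measure_preserving_bij"
  shows "distr unit_square unit_square (\<lambda>p. (f (fst p), f (snd p))) = unit_square"
proof -
  have "distr unit_measure unit_measure f \<Otimes>\<^sub>M distr unit_measure unit_measure f
     = distr unit_square unit_square (\<lambda>(x, y). (f x, f y))"
    by (rule pair_measure_distr)
       (use f unit_measure.sigma_finite_measure_axioms in \<open>auto simp: measure_preserving_bij_def\<close>)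
  then show ?thesis using f by (simp add: measure_preserving_bij_def case_prod_unfold)
qed

lemma measurable_mpb_square:
  assumes f: "f \<in> measure_preserving_bij"
  shows "(\<lambda>p. (f (fst p), f (snd p))) \<in> unit_square \<rightarrow>\<^sub>M unit_square"
proof -
  note [measurable] = mpb_measurable[OF f]
  show ?thesis by measurable
qed

lemma kernel_comp:
  assumes f: "f \<in> measure_preserving_bij" and D: "bounded_kernel D"
  shows "bounded_kernel (\<lambda>x y. D (f x) (f y))"
proof -
  obtain B where B: "\<forall>x\<in>{0..1}. \<forall>y\<in>{0..1}. \<bar>D x y\<bar> \<le> B"
    using D unfolding bounded_kernel_def by blast
  show ?thesis
    by (rule kernelI[where B = B])
       (use measurable_compose[OF measurable_mpb_square[OF f] kernel_measurable[OF D]] B mpb_in[OF f] in auto)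
qed

lemma graphon_comp:
  assumes f: "f \<in> measure_preserving_bij" and W: "W \<in> graphons"
  shows "(\<lambda>x y. W (f x) (f y)) \<in> graphons"
proof (rule graphonI)
  show "(\<lambda>p. W (f (fst p)) (f (snd p))) \<in> borel_measurable unit_square"
    using kernel_measurable[OF kernel_comp[OF f graphon_kernel[OF W]]] .
qed (use graphon_bounds[OF W mpb_in[OF f] mpb_in[OF f]] graphon_sym[OF W mpb_in[OF f] mpb_in[OF f]] in auto)

lemma integral_comp_mpb:
  fixes h :: "real \<times> real \<Rightarrow> real"
  assumes f: "f \<in> measure_preserving_bij" and "h \<in> borel_measurable unit_square"
  shows "(LINT p | unit_square. h (f (fst p), f (snd p))) = (LINT p | unit_square. h p)"
  using integral_distr[OF measurable_mpb_square[OF f] assms(2)] by (simp add: distr_mpb_square[OF f])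

text \<open>Substituting \<open>f\<close> in both variables turns the integral over
  \<open>S \<times> T\<close> into one over \<open>S' \<times> T'\<close>, again a rectangle.
  Equality follows below by applying this to the inverse of \<open>f\<close>.\<close>

lemma cut_norm_comp_le:
  assumes f: "f \<in> measure_preserving_bij" and D: "bounded_kernel D"
  shows "cut_norm D \<le> cut_norm (\<lambda>x y. D (f x) (f y))"
proof (rule cut_norm_least)
  fix S T assume ST: "S \<in> sets unit_measure" "T \<in> sets unit_measure"
  define S' T' where "S' = f -` S \<inter> {0..1}" and "T' = f -` T \<inter> {0..1}"
  have ST': "S' \<in> sets unit_measure" "T' \<in> sets unit_measure"
    using measurable_sets[OF mpb_measurable[OF f]] ST by (auto simp: S'_def T'_def)
  have "(LINT p : S \<times> T | unit_square. D (fst p) (snd p))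
     = (LINT p | unit_square. indicator (S \<times> T) (f (fst p), f (snd p)) * D (f (fst p)) (f (snd p)))"
    unfolding set_lebesgue_integral_def
    using integral_comp_mpb[OF f, of "\<lambda>p. indicator (S \<times> T) p * D (fst p) (snd p)"]
      kernel_measurable[OF D] pair_measureI[OF ST] by simp
  also have "\<dots> = (LINT p : S' \<times> T' | unit_square. D (f (fst p)) (f (snd p)))"
    unfolding set_lebesgue_integral_def
    by (rule Bochner_Integration.integral_cong) (auto simp: S'_def T'_def indicator_def)
  finally show "\<bar>LINT p : S \<times> T | unit_square. D (fst p) (snd p)\<bar> \<le> cut_norm (\<lambda>x y. D (f x) (f y))"
    using cut_norm_upper[OF kernel_comp[OF f D] ST'] by simp
qed

lemma cut_norm_comp:
  assumes f: "f \<in> measure_preserving_bij" and D: "bounded_kernel D"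
  shows "cut_norm (\<lambda>x y. D (f x) (f y)) = cut_norm D"
proof (rule antisym)
  obtain g where g: "g \<in> measure_preserving_bij" "\<And>x. x \<in> {0..1} \<Longrightarrow> f (g x) = x"
    using mpb_inv[OF f] by metis
  have "cut_norm (\<lambda>x y. D (f x) (f y)) \<le> cut_norm (\<lambda>x y. D (f (g x)) (f (g y)))"
    using cut_norm_comp_le[OF g(1) kernel_comp[OF f D]] .
  also have "\<dots> = cut_norm D" by (rule cut_norm_cong) (simp add: g)
  finally show "cut_norm (\<lambda>x y. D (f x) (f y)) \<le> cut_norm D" .
qed (rule cut_norm_comp_le[OF f D])

lemma kernel_cut_arg:
  "U \<in> graphons \<Longrightarrow> W \<in> graphons \<Longrightarrow> f \<in> measure_preserving_bij \<Longrightarrow> bounded_kernel (\<lambda>x y. U x y - W (f x) (f y))"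
  using kernel_diff[OF graphon_kernel[of U] graphon_kernel[OF graphon_comp[of f W]]] by blast

section \<open>The cut distance as a pseudometric\<close>

lemma cut_dist_upper:
  assumes "U \<in> graphons" "W \<in> graphons" "f \<in> measure_preserving_bij"
  shows "cut_dist U W \<le> cut_norm (\<lambda>x y. U x y - W (f x) (f y))"
  unfolding cut_dist_def
  using assms(3) cut_norm_nonneg[OF kernel_cut_arg[OF assms(1,2)]]
  by (intro cINF_lower bdd_belowI[where m = 0]) auto

lemma cut_dist_nonneg:
  assumes "U \<in> graphons" "W \<in> graphons" shows "0 \<le> cut_dist U W"
  unfolding cut_dist_def
  using mpb_id cut_norm_nonneg[OF kernel_cut_arg[OF assms]] by (intro cINF_greatest) auto

lemma cut_dist_lessD:
  assumes "U \<in> graphons" "W \<in> graphons" "cut_dist U W < e"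
  shows "\<exists>f\<in>measure_preserving_bij. cut_norm (\<lambda>x y. U x y - W (f x) (f y)) < e"
proof -
  have "measure_preserving_bij \<noteq> {}" using mpb_id by auto
  moreover have "bdd_below ((\<lambda>f. cut_norm (\<lambda>x y. U x y - W (f x) (f y))) ` measure_preserving_bij)"
    using cut_norm_nonneg[OF kernel_cut_arg[OF assms(1,2)]] by (intro bdd_belowI[where m = 0]) auto
  ultimately show ?thesis
    using assms(3) unfolding cut_dist_def by (simp add: cINF_less_iff)
qed

lemma cut_dist_le_cut_norm:
  "U \<in> graphons \<Longrightarrow> W \<in> graphons \<Longrightarrow> cut_dist U W \<le> cut_norm (\<lambda>x y. U x y - W x y)"
  using cut_dist_upper[OF _ _ mpb_id] .

lemma cut_norm_zero: "cut_norm (\<lambda>x y. 0) = 0"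
proof (rule antisym)
  show "0 \<le> cut_norm (\<lambda>x y. 0)" by (rule cut_norm_nonneg) (auto simp: bounded_kernel_def)
qed (auto intro!: cut_norm_least)

lemma cut_dist_self: "U \<in> graphons \<Longrightarrow> cut_dist U U = 0"
  using cut_dist_le_cut_norm[of U U] cut_dist_nonneg[of U U] by (simp add: cut_norm_zero)

text \<open>The infimum over bijections need not be attained, hence the slack \<open>e\<close>; the
  inverse of a nearly optimal bijection serves in the other direction.\<close>

lemma cut_dist_commute_le:
  assumes "U \<in> graphons" "W \<in> graphons" shows "cut_dist W U \<le> cut_dist U W"
proof (rule field_le_epsilon)
  fix e :: real assume "0 < e"
  then obtain f where f: "f \<in> measure_preserving_bij"
    "cut_norm (\<lambda>x y. U x y - W (f x) (f y)) < cut_dist U W + e"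
    using cut_dist_lessD[OF assms, of "cut_dist U W + e"] by (auto simp del: atLeastAtMost_iff)
  obtain g where g: "g \<in> measure_preserving_bij" "\<And>x. x \<in> {0..1} \<Longrightarrow> f (g x) = x"
    using mpb_inv[OF f(1)] by metis
  have "cut_dist W U \<le> cut_norm (\<lambda>x y. W x y - U (g x) (g y))"
    by (rule cut_dist_upper) (use assms g in auto)
  also have "\<dots> = cut_norm (\<lambda>x y. U (g x) (g y) - W x y)"
    by (rule cut_norm_diff_commute[OF graphon_kernel[OF assms(2)]
          graphon_kernel[OF graphon_comp[OF g(1) assms(1)]]])
  also have "\<dots> = cut_norm (\<lambda>x y. U (g x) (g y) - W (f (g x)) (f (g y)))"
    by (rule cut_norm_cong) (simp add: g)
  also have "\<dots> = cut_norm (\<lambda>x y. U x y - W (f x) (f y))"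
    by (rule cut_norm_comp[OF g(1) kernel_cut_arg[OF assms f(1)]])
  finally show "cut_dist W U \<le> cut_dist U W + e" using f by simp
qed

lemma cut_dist_commute:
  "U \<in> graphons \<Longrightarrow> W \<in> graphons \<Longrightarrow> cut_dist U W = cut_dist W U"
  using cut_dist_commute_le by (meson antisym)

lemma cut_dist_triangle:
  assumes "U \<in> graphons" "V \<in> graphons" "W \<in> graphons"
  shows "cut_dist U W \<le> cut_dist U V + cut_dist V W"
proof (rule field_le_epsilon)
  fix e :: real assume e: "0 < e"
  obtain f where f: "f \<in> measure_preserving_bij"
    "cut_norm (\<lambda>x y. U x y - V (f x) (f y)) < cut_dist U V + e / 2"
    using cut_dist_lessD[OF assms(1,2), of "cut_dist U V + e / 2"] e by (auto simp del: atLeastAtMost_iff)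
  obtain g where g: "g \<in> measure_preserving_bij"
    "cut_norm (\<lambda>x y. V x y - W (g x) (g y)) < cut_dist V W + e / 2"
    using cut_dist_lessD[OF assms(2,3), of "cut_dist V W + e / 2"] e by (auto simp del: atLeastAtMost_iff)
  have "cut_dist U W \<le> cut_norm (\<lambda>x y. U x y - W (g (f x)) (g (f y)))"
    using cut_dist_upper[OF assms(1,3) mpb_comp[OF g(1) f(1)]] .
  also have "\<dots> \<le> cut_norm (\<lambda>x y. U x y - V (f x) (f y))
      + cut_norm (\<lambda>x y. V (f x) (f y) - W (g (f x)) (g (f y)))"
    by (rule cut_norm_diff_triangle[OF graphon_kernel[OF assms(1)]
          graphon_kernel[OF graphon_comp[OF f(1) assms(2)]]
          graphon_kernel[OF graphon_comp[OF mpb_comp[OF g(1) f(1)] assms(3)]]])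
  also have "cut_norm (\<lambda>x y. V (f x) (f y) - W (g (f x)) (g (f y))) = cut_norm (\<lambda>x y. V x y - W (g x) (g y))"
    by (rule cut_norm_comp[OF f(1) kernel_cut_arg[OF assms(2,3) g(1)]])
  finally show "cut_dist U W \<le> cut_dist U V + cut_dist V W + e" using f g by linarith
qed

section \<open>The metric space of graph limits\<close>

lemma equiv_weak_iso: "equiv graphons weak_iso"
proof (rule equivI)
  show "weak_iso \<subseteq> graphons \<times> graphons" by (auto simp: weak_iso_def)
  show "refl_on graphons weak_iso" by (auto simp: refl_on_def weak_iso_def cut_dist_self)
  show "sym weak_iso" by (auto simp: sym_def weak_iso_def cut_dist_commute)
  show "trans weak_iso"
  proof (rule transI)
    fix U V W assume "(U, V) \<in> weak_iso" "(V, W) \<in> weak_iso"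
    then show "(U, W) \<in> weak_iso"
      using cut_dist_triangle[of U V W] cut_dist_nonneg[of U W] by (auto simp: weak_iso_def)
  qed
qed

lemma rep_in: "\<Gamma> \<in> graph_limits \<Longrightarrow> rep \<Gamma> \<in> \<Gamma>"
  unfolding rep_def graph_limits_def using in_quotient_imp_non_empty[OF equiv_weak_iso]
  by (metis ex_in_conv someI_ex)

lemma rep_graphon: "\<Gamma> \<in> graph_limits \<Longrightarrow> rep \<Gamma> \<in> graphons"
  using rep_in in_quotient_imp_subset[OF equiv_weak_iso] by (auto simp: graph_limits_def)

definition limit_of :: "(real \<Rightarrow> real \<Rightarrow> real) \<Rightarrow> limit" where
  "limit_of W = weak_iso `` {W}"

lemma limit_of_in: "W \<in> graphons \<Longrightarrow> limit_of W \<in> graph_limits"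
  by (simp add: limit_of_def graph_limits_def quotientI)

lemma cut_dist_rep_limit_of: "W \<in> graphons \<Longrightarrow> cut_dist W (rep (limit_of W)) = 0"
  using rep_in[OF limit_of_in[of W]] by (auto simp: limit_of_def weak_iso_def)

lemma delta_cut_zero:
  assumes "\<Gamma> \<in> graph_limits" "\<Gamma>' \<in> graph_limits"
  shows "delta_cut \<Gamma> \<Gamma>' = 0 \<longleftrightarrow> \<Gamma> = \<Gamma>'"
proof
  assume "delta_cut \<Gamma> \<Gamma>' = 0"
  then have "(rep \<Gamma>, rep \<Gamma>') \<in> weak_iso"
    using assms by (auto simp: delta_cut_def weak_iso_def rep_graphon)
  then show "\<Gamma> = \<Gamma>'"
    using quotient_eqI[OF equiv_weak_iso assms[unfolded graph_limits_def] rep_in[OF assms(1)] rep_in[OF assms(2)]]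
    by simp
qed (use assms in \<open>auto simp: delta_cut_def cut_dist_self rep_graphon\<close>)

text \<open>Allows the arbitrary representative picked by \<open>rep\<close> to be traded for the
  graphon at hand.\<close>

lemma cut_dist_rep_limit_of_right:
  assumes "U \<in> graphons" "W \<in> graphons"
  shows "cut_dist U (rep (limit_of W)) = cut_dist U W"
proof -
  have r: "rep (limit_of W) \<in> graphons" using rep_graphon[OF limit_of_in[OF assms(2)]] .
  show ?thesis
    using cut_dist_triangle[OF assms(1) assms(2) r] cut_dist_triangle[OF assms(1) r assms(2)]
      cut_dist_rep_limit_of[OF assms(2)] cut_dist_commute[OF assms(2) r] by simp
qed

text \<open>\<open>Metric_space\<close> demands nonnegativity and symmetry for all arguments. Off
  \<open>graph_limits\<close> nothing is known about \<open>delta_cut\<close>, so the value 0 is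
  used there.\<close>

definition limit_dist :: "limit \<Rightarrow> limit \<Rightarrow> real" where
  "limit_dist \<Gamma> \<Gamma>' = (if \<Gamma> \<in> graph_limits \<and> \<Gamma>' \<in> graph_limits then delta_cut \<Gamma> \<Gamma>' else 0)"

interpretation graph_limits: Metric_space graph_limits limit_dist
proof
  fix x y z
  show "0 \<le> limit_dist x y"
    by (simp add: limit_dist_def delta_cut_def cut_dist_nonneg rep_graphon)
  show "limit_dist x y = limit_dist y x"
    using cut_dist_commute[of "rep x" "rep y"] by (simp add: limit_dist_def delta_cut_def rep_graphon)
  show "limit_dist x y = 0 \<longleftrightarrow> x = y" if "x \<in> graph_limits" "y \<in> graph_limits"
    using that by (simp add: limit_dist_def delta_cut_zero)
  show "limit_dist x z \<le> limit_dist x y + limit_dist y z"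
    if "x \<in> graph_limits" "y \<in> graph_limits" "z \<in> graph_limits"
    using that by (simp add: limit_dist_def delta_cut_def cut_dist_triangle rep_graphon)
qed

subsection \<open>Midpoint hulls\<close>

text \<open>Dyadic convex combinations are enough: the parallelogram law speaks of midpoints, and
  rule induction transfers every property that is closed under midpoints.\<close>

inductive_set midpoint_hull :: "(real \<Rightarrow> real \<Rightarrow> real) set \<Rightarrow> (real \<Rightarrow> real \<Rightarrow> real) set"
  for A where
  base: "u \<in> A \<Longrightarrow> u \<in> midpoint_hull A"
| midpoint: "u \<in> midpoint_hull A \<Longrightarrow> v \<in> midpoint_hull A \<Longrightarrow>
    (\<lambda>x y. (u x y + v x y) / 2) \<in> midpoint_hull A"

lemma midpoint_hull_mono: "u \<in> midpoint_hull A \<Longrightarrow> A \<subseteq> B \<Longrightarrow> u \<in> midpoint_hull B"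
  by (induction rule: midpoint_hull.induct) (auto intro: midpoint_hull.intros)

lemma graphon_midpoint:
  assumes "U \<in> graphons" "W \<in> graphons"
  shows "(\<lambda>x y. (U x y + W x y) / 2) \<in> graphons"
proof (rule graphonI)
  show "(\<lambda>p. (U (fst p) (snd p) + W (fst p) (snd p)) / 2) \<in> borel_measurable unit_square"
    by (intro borel_measurable_divide borel_measurable_add kernel_measurable graphon_kernel assms
        borel_measurable_const)
next
  fix x y :: real assume xy: "x \<in> {0..1}" "y \<in> {0..1}"
  show "(U x y + W x y) / 2 = (U y x + W y x) / 2"
    using graphon_sym[OF assms(1) xy] graphon_sym[OF assms(2) xy] by simp
  show "(U x y + W x y) / 2 \<in> {0..1}"
    using graphon_bounds[OF assms(1) xy] graphon_bounds[OF assms(2) xy] by simp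
qed

lemma midpoint_hull_graphon:
  assumes "u \<in> midpoint_hull A" "A \<subseteq> graphons" shows "u \<in> graphons"
  using assms(1)
proof induction
  case (base u) then show ?case using assms(2) by blast
next
  case (midpoint u v) show ?case by (rule graphon_midpoint) fact+
qed

text \<open>Closed cut-norm balls are convex.\<close>

lemma midpoint_hull_cut_norm:
  assumes "u \<in> midpoint_hull A" "A \<subseteq> graphons" "X \<in> graphons"
    and "\<And>v. v \<in> A \<Longrightarrow> cut_norm (\<lambda>x y. X x y - v x y) \<le> e"
  shows "cut_norm (\<lambda>x y. X x y - u x y) \<le> e"
  using assms(1)
proof induction
  case (base u) then show ?case using assms(4) by blast
next
  case (midpoint u v)
  have k: "bounded_kernel (\<lambda>x y. X x y - u x y)" "bounded_kernel (\<lambda>x y. X x y - v x y)"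
    using midpoint(1,2) assms(2,3) by (simp_all add: kernel_diff graphon_kernel midpoint_hull_graphon)
  have "cut_norm (\<lambda>x y. X x y - (u x y + v x y) / 2)
    = cut_norm (\<lambda>x y. (1/2) * (X x y - u x y) + (1/2) * (X x y - v x y))"
    by (rule cut_norm_cong) (simp add: field_simps)
  also have "\<dots> \<le> cut_norm (\<lambda>x y. (1/2) * (X x y - u x y)) + cut_norm (\<lambda>x y. (1/2) * (X x y - v x y))"
    by (rule cut_norm_triangle[OF kernel_cmult[OF k(1)] kernel_cmult[OF k(2)]])
  also have "\<dots> = (cut_norm (\<lambda>x y. X x y - u x y) + cut_norm (\<lambda>x y. X x y - v x y)) / 2"
    using cut_norm_cmult[OF k(1), of "1/2"] cut_norm_cmult[OF k(2), of "1/2"] by simp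
  also have "\<dots> \<le> e" using midpoint.IH by simp
  finally show ?case .
qed

text \<open>A sequence of elements of the hulls of the tails that nearly minimises the \<open>L\<^sup>2\<close> norm is
  Cauchy by the parallelogram law; this replaces weak compactness.\<close>

lemma midpoint_hull_AE_convergent:
  fixes V :: "nat \<Rightarrow> real \<Rightarrow> real \<Rightarrow> real"
  assumes V: "\<And>j. V j \<in> graphons"
  obtains W w where "W \<in> graphons" "\<And>j. w j \<in> midpoint_hull (V ` {j..})"
    "AE p in unit_square. (\<lambda>j. w j (fst p) (snd p)) \<longlonglongrightarrow> W (fst p) (snd p)"
proof -
  define H where "H j = midpoint_hull (V ` {j..})" for j
  define E where "E u = (LINT p | unit_square. (u (fst p) (snd p))\<^sup>2)" for u :: "real \<Rightarrow> real \<Rightarrow> real"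
  define m where "m j = Inf (E ` H j)" for j
  have Hg: "u \<in> graphons" if "u \<in> H j" for u j
    using midpoint_hull_graphon[OF that[unfolded H_def]] V by blast
  have Hmono: "H j \<subseteq> H i" if "i \<le> j" for i j
    using midpoint_hull_mono[of _ "V ` {j..}" "V ` {i..}"] that unfolding H_def by fastforce
  have Hne: "V j \<in> H j" for j unfolding H_def by (rule midpoint_hull.base) simp
  have sq_int: "integrable unit_square (\<lambda>p. (u (fst p) (snd p) + c * v (fst p) (snd p))\<^sup>2)"
    if "u \<in> graphons" "v \<in> graphons" for u v c
  proof (rule unit_square.P.integrable_const_bound[where B = "(1 + \<bar>c\<bar>)\<^sup>2"])
    show "(\<lambda>p. (u (fst p) (snd p) + c * v (fst p) (snd p))\<^sup>2) \<in> borel_measurable unit_square"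
      by (intro borel_measurable_power borel_measurable_add borel_measurable_times
          kernel_measurable graphon_kernel that borel_measurable_const)
    show "AE p in unit_square. norm ((u (fst p) (snd p) + c * v (fst p) (snd p))\<^sup>2) \<le> (1 + \<bar>c\<bar>)\<^sup>2"
    proof (rule AE_I2)
      fix p assume "p \<in> space unit_square"
      then have p: "fst p \<in> {0..1}" "snd p \<in> {0..1}" by auto
      have "\<bar>u (fst p) (snd p) + c * v (fst p) (snd p)\<bar> \<le> \<bar>u (fst p) (snd p)\<bar> + \<bar>c\<bar> * \<bar>v (fst p) (snd p)\<bar>"
        using abs_triangle_ineq[of "u (fst p) (snd p)" "c * v (fst p) (snd p)"] by (simp add: abs_mult)
      also have "\<dots> \<le> 1 + \<bar>c\<bar> * 1"
        using graphon_bounds[OF that(1) p] graphon_bounds[OF that(2) p]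
        by (intro add_mono mult_left_mono) auto
      finally show "norm ((u (fst p) (snd p) + c * v (fst p) (snd p))\<^sup>2) \<le> (1 + \<bar>c\<bar>)\<^sup>2"
        by (simp add: abs_le_square_iff[symmetric])
    qed
  qed
  have E0: "0 \<le> E u" for u unfolding E_def by (rule integral_nonneg_AE) simp
  have E1: "E u \<le> 1" if "u \<in> graphons" for u
  proof -
    have "E u \<le> (LINT p | unit_square. 1)" unfolding E_def
    proof (rule integral_mono)
      show "integrable unit_square (\<lambda>p. (u (fst p) (snd p))\<^sup>2)" using sq_int[OF that that, of 0] by simp
      show "(u (fst p) (snd p))\<^sup>2 \<le> 1" if "p \<in> space unit_square" for p
        using graphon_bounds[OF \<open>u \<in> graphons\<close>, of "fst p" "snd p"] that by (auto intro!: power_le_one)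
    qed simp
    then show ?thesis using unit_square.P.prob_space by simp
  qed
  have bdd: "bdd_below (E ` H j)" for j by (rule bdd_belowI[where m = 0]) (auto intro: E0)
  have m_le: "m j \<le> E u" if "u \<in> H j" for u j
    unfolding m_def using that bdd by (intro cInf_lower) auto
  have m_mono: "incseq m"
    unfolding m_def by (intro incseq_SucI cInf_superset_mono image_mono Hmono bdd) (use Hne in auto)
  have m1: "m j \<le> 1" for j using m_le[OF Hne] E1[OF V] by (rule order_trans)
  obtain L where L: "m \<longlonglongrightarrow> L" "\<And>j. m j \<le> L"
    using incseq_convergent[OF m_mono, of 1] m1 by blast
  \<comment> \<open>Makes the squared L2 distance of consecutive terms at most
    \<open>8 * \<epsilon> k = (1/4)^k\<close>, hence their L1 distance at most
    \<open>(1/2)^k\<close>, which is summable.\<close>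
  define \<epsilon> :: "nat \<Rightarrow> real" where "\<epsilon> k = (1/4)^k / 8" for k
  have eps: "\<epsilon> k > 0" for k by (simp add: \<epsilon>_def)
  \<comment> \<open>The infima \<open>m j\<close> increase to \<open>L\<close>. A tail with
    \<open>m j\<close> close to \<open>L\<close> bounds the norms of midpoints from below, while a
    near-minimiser in that tail has norm hardly above \<open>L\<close>.\<close>
  have "\<exists>j\<ge>k. \<exists>u\<in>H j. E u < L + \<epsilon> k \<and> L - \<epsilon> k < m j" for k
  proof -
    have "\<forall>\<^sub>F j in sequentially. L - \<epsilon> k < m j"
      by (rule order_tendstoD[OF L(1)]) (use eps in simp)
    then obtain j where j: "j \<ge> k" "L - \<epsilon> k < m j"
      using eventually_ge_at_top[of k] by (metis (mono_tags) eventually_sequentially nle_le)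
    have "Inf (E ` H j) < L + \<epsilon> k" using L(2)[of j] eps[of k] by (simp add: m_def)
    then obtain u where "u \<in> H j" "E u < L + \<epsilon> k"
      using cInf_lessD[of "E ` H j"] Hne by blast
    then show ?thesis using j by blast
  qed
  then obtain J u where J: "\<And>k. J k \<ge> k" and uH: "\<And>k. u k \<in> H (J k)"
    and uE: "\<And>k. E (u k) < L + \<epsilon> k" and mJ: "\<And>k. L - \<epsilon> k < m (J k)"
    by metis
  have ug: "u k \<in> graphons" for k using Hg[OF uH] .
  have diff: "(LINT p | unit_square. (u k (fst p) (snd p) - u (Suc k) (fst p) (snd p))\<^sup>2) \<le> 8 * \<epsilon> k" for k
  proof -
    let ?a = "\<lambda>p. u k (fst p) (snd p)" and ?b = "\<lambda>p. u (Suc k) (fst p) (snd p)"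
    \<comment> \<open>Both terms lie in the hull of the earlier of the two tails; so does their
      midpoint, which gives it norm at least \<open>m n\<close>.\<close>
    define n where "n = min (J k) (J (Suc k))"
    have eS: "\<epsilon> (Suc k) \<le> \<epsilon> k" by (simp add: \<epsilon>_def)
    have "u k \<in> H n" "u (Suc k) \<in> H n"
      using uH[of k] uH[of "Suc k"] Hmono[of n "J k"] Hmono[of n "J (Suc k)"] by (auto simp: n_def)
    then have "(\<lambda>x y. (u k x y + u (Suc k) x y) / 2) \<in> H n"
      unfolding H_def by (rule midpoint_hull.midpoint)
    then have "m n \<le> E (\<lambda>x y. (u k x y + u (Suc k) x y) / 2)" by (rule m_le)
    also have "\<dots> = (LINT p | unit_square. (?a p + 1 * ?b p)\<^sup>2) / 4"
      unfolding E_def by (simp add: power_divide)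
    finally have 1: "L - \<epsilon> k < (LINT p | unit_square. (?a p + 1 * ?b p)\<^sup>2) / 4"
      using mJ[of k] mJ[of "Suc k"] eS by (auto simp: n_def min_def split: if_splits)
    have "(LINT p | unit_square. (?a p + 1 * ?b p)\<^sup>2) + (LINT p | unit_square. (?a p + (-1) * ?b p)\<^sup>2)
        = (LINT p | unit_square. (?a p + 1 * ?b p)\<^sup>2 + (?a p + (-1) * ?b p)\<^sup>2)"
      by (intro Bochner_Integration.integral_add[symmetric] sq_int ug)
    also have "\<dots> = (LINT p | unit_square. 2 * (?a p + 0 * ?b p)\<^sup>2 + 2 * (?b p + 0 * ?a p)\<^sup>2)"
      by (rule Bochner_Integration.integral_cong) (auto simp: power2_eq_square algebra_simps)
    also have "\<dots> = 2 * E (u k) + 2 * E (u (Suc k))"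
      unfolding E_def
      by (subst Bochner_Integration.integral_add)
         (use sq_int[OF ug[of k] ug[of "Suc k"], of 0] sq_int[OF ug[of "Suc k"] ug[of k], of 0] in auto)
    finally have "(LINT p | unit_square. (?a p - ?b p)\<^sup>2)
        = 2 * E (u k) + 2 * E (u (Suc k)) - (LINT p | unit_square. (?a p + 1 * ?b p)\<^sup>2)"
      by simp
    then show ?thesis using 1 uE[of k] uE[of "Suc k"] eS by linarith
  qed
  let ?d = "\<lambda>k p. u k (fst p) (snd p) - u (Suc k) (fst p) (snd p)"
  have dm: "(\<lambda>p. ?d k p) \<in> borel_measurable unit_square" for k
    by (intro borel_measurable_diff kernel_measurable graphon_kernel ug)
  have dint: "integrable unit_square (\<lambda>p. \<bar>?d k p\<bar>)" for k
    using kernel_integrable[OF kernel_diff[OF graphon_kernel[OF ug] graphon_kernel[OF ug]], of k "Suc k"]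
    by (rule integrable_abs)
  \<comment> \<open>Jensen's inequality on a probability space: the square of the mean is at most
    the mean of the square.\<close>
  have l1: "(LINT p | unit_square. \<bar>?d k p\<bar>) \<le> (1/2)^k" for k
  proof (rule power2_le_imp_le)
    have "(LINT p | unit_square. \<bar>?d k p\<bar>)\<^sup>2 \<le> (LINT p | unit_square. \<bar>?d k p\<bar>\<^sup>2)"
      using unit_square.P.jensens_inequality[OF dint[of k], where I = UNIV and q = "\<lambda>x. x\<^sup>2"]
        sq_int[OF ug[of k] ug[of "Suc k"], of "-1"] by (simp add: convex_power2)
    also have "\<dots> \<le> ((1/2)^k)\<^sup>2" using diff[of k] 
      by (simp add: \<epsilon>_def power_mult[symmetric] power_even_eq power_one_over)
         (simp add: power_mult power2_eq_square flip: power_mult_distrib)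
    finally show "(LINT p | unit_square. \<bar>?d k p\<bar>)\<^sup>2 \<le> ((1/2)^k)\<^sup>2" .
  qed simp
  have "(\<integral>\<^sup>+p. (\<Sum>k. ennreal \<bar>?d k p\<bar>) \<partial>unit_square) = (\<Sum>k. \<integral>\<^sup>+p. ennreal \<bar>?d k p\<bar> \<partial>unit_square)"
    by (rule nn_integral_suminf) (use dm in measurable)
  also have "\<dots> \<le> (\<Sum>k. ennreal ((1/2)^k))"
    by (intro suminf_le summableI) (use dint l1 in \<open>auto simp: nn_integral_eq_integral intro!: ennreal_leI\<close>)
  also have "\<dots> = ennreal 2"
    by (subst suminf_ennreal2) (auto simp: suminf_geometric)
  finally have "(\<integral>\<^sup>+p. (\<Sum>k. ennreal \<bar>?d k p\<bar>) \<partial>unit_square) \<noteq> \<infinity>"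
    by (metis ennreal_less_top infinity_ennreal_def leD)
  then have "AE p in unit_square. (\<Sum>k. ennreal \<bar>?d k p\<bar>) \<noteq> \<infinity>"
    by (intro nn_integral_PInf_AE) (use dm in measurable)
  then have conv: "AE p in unit_square. convergent (\<lambda>k. u k (fst p) (snd p))"
  proof (rule AE_mp[OF _ AE_I2], intro impI)
    fix p assume "(\<Sum>k. ennreal \<bar>?d k p\<bar>) \<noteq> \<infinity>"
    then have "summable (\<lambda>k. \<bar>?d k p\<bar>)" by (intro summable_suminf_not_top) auto
    then have "summable (\<lambda>k. ?d k p)" by (rule summable_rabs_cancel)
    then have "convergent (\<lambda>n. \<Sum>k<n. ?d k p)" by (simp add: summable_iff_convergent)
    moreover have "(\<Sum>k<n. ?d k p) = u 0 (fst p) (snd p) - u n (fst p) (snd p)" for n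
      by (rule sum_lessThan_telescope')
    ultimately have "convergent (\<lambda>n. u 0 (fst p) (snd p) - u n (fst p) (snd p))" by simp
    from convergent_diff[OF convergent_const this, of "u 0 (fst p) (snd p)"]
    show "convergent (\<lambda>k. u k (fst p) (snd p))" by simp
  qed
  \<comment> \<open>On the null set of divergence the default 0 keeps \<open>W\<close> a
    graphon.\<close>
  define W where "W x y = (if convergent (\<lambda>k. u k x y) then lim (\<lambda>k. u k x y) else 0)" for x y
  have um [measurable]: "(\<lambda>p. u k (fst p) (snd p)) \<in> borel_measurable unit_square" for k
    by (intro kernel_measurable graphon_kernel ug)
  have Wg: "W \<in> graphons"
  proof (rule graphonI)
    show "(\<lambda>p. W (fst p) (snd p)) \<in> borel_measurable unit_square"
      unfolding W_def Cauchy_convergent_iff[symmetric] by measurable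
  next
    fix x y :: real assume xy: "x \<in> {0..1}" "y \<in> {0..1}"
    show "W x y = W y x" using graphon_sym[OF ug xy] by (simp add: W_def)
    show "W x y \<in> {0..1}"
    proof (cases "convergent (\<lambda>k. u k x y)")
      case True
      then have "(\<lambda>k. u k x y) \<longlonglongrightarrow> W x y" by (simp add: W_def convergent_LIMSEQ_iff)
      then show ?thesis
        using LIMSEQ_le_const[of _ "W x y" 0] LIMSEQ_le_const2[of _ "W x y" 1] graphon_bounds[OF ug xy] by auto
    qed (simp add: W_def)
  qed
  have "AE p in unit_square. (\<lambda>k. u k (fst p) (snd p)) \<longlonglongrightarrow> W (fst p) (snd p)"
    using conv by (rule AE_mp[OF _ AE_I2]) (simp add: W_def convergent_LIMSEQ_iff)
  moreover have "u k \<in> midpoint_hull (V ` {k..})" for k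
    using uH Hmono[OF J] unfolding H_def by blast
  ultimately show ?thesis using that[OF Wg] by blast
qed

lemma L1norm_tendsto_0:
  assumes "\<And>j. w j \<in> graphons" "W \<in> graphons"
    and "AE p in unit_square. (\<lambda>j. w j (fst p) (snd p)) \<longlonglongrightarrow> W (fst p) (snd p)"
  shows "(\<lambda>j. L1norm (\<lambda>x y. w j x y - W x y)) \<longlonglongrightarrow> 0"
proof -
  note [measurable] = kernel_measurable[OF graphon_kernel[OF assms(1)]]
    kernel_measurable[OF graphon_kernel[OF assms(2)]]
  have "(\<lambda>j. LINT p | unit_square. \<bar>w j (fst p) (snd p) - W (fst p) (snd p)\<bar>) \<longlonglongrightarrow> (LINT p | unit_square. 0)"
  proof (rule integral_dominated_convergence[where w = "\<lambda>_. 1"])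
    show "AE p in unit_square. (\<lambda>j. \<bar>w j (fst p) (snd p) - W (fst p) (snd p)\<bar>) \<longlonglongrightarrow> 0"
      using assms(3) by (rule AE_mp[OF _ AE_I2]) (auto simp: tendsto_rabs_zero_iff LIM_zero_iff)
    show "AE p in unit_square. norm \<bar>w j (fst p) (snd p) - W (fst p) (snd p)\<bar> \<le> 1" for j
    proof (rule AE_I2)
      fix p assume "p \<in> space unit_square"
      then show "norm \<bar>w j (fst p) (snd p) - W (fst p) (snd p)\<bar> \<le> 1"
        using graphon_bounds[OF assms(1)[of j], of "fst p" "snd p"]
          graphon_bounds[OF assms(2), of "fst p" "snd p"] by (auto simp: abs_if)
    qed
  qed (auto intro: unit_square.P.integrable_const)
  then show ?thesis by (simp add: L1norm_def)
qed

text \<open>By domination, almost everywhere convergence of graphons is L1 convergence, and the L1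
  norm controls the cut norm.\<close>

lemma cut_norm_le_midpoint_limit:
  assumes "\<And>j. w j \<in> graphons" "W \<in> graphons" "X \<in> graphons"
    and "AE p in unit_square. (\<lambda>j. w j (fst p) (snd p)) \<longlonglongrightarrow> W (fst p) (snd p)"
    and "\<forall>\<^sub>F j in sequentially. cut_norm (\<lambda>x y. X x y - w j x y) \<le> e"
  shows "cut_norm (\<lambda>x y. X x y - W x y) \<le> e"
proof -
  have "(\<lambda>j. e + L1norm (\<lambda>x y. w j x y - W x y)) \<longlonglongrightarrow> e + 0"
    by (intro tendsto_add tendsto_const L1norm_tendsto_0 assms)
  moreover have "\<forall>\<^sub>F j in sequentially. cut_norm (\<lambda>x y. X x y - W x y) \<le> e + L1norm (\<lambda>x y. w j x y - W x y)"
    using assms(5)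
  proof eventually_elim
    case (elim j)
    have "cut_norm (\<lambda>x y. X x y - W x y)
      \<le> cut_norm (\<lambda>x y. X x y - w j x y) + cut_norm (\<lambda>x y. w j x y - W x y)"
      by (rule cut_norm_diff_triangle) (simp_all add: graphon_kernel assms)
    also have "cut_norm (\<lambda>x y. w j x y - W x y) \<le> L1norm (\<lambda>x y. w j x y - W x y)"
      by (rule cut_norm_le_L1norm[OF kernel_diff]) (simp_all add: graphon_kernel assms)
    finally show ?case using elim by simp
  qed
  ultimately show ?thesis
    using tendsto_lowerbound[of "\<lambda>j. e + L1norm (\<lambda>x y. w j x y - W x y)" e sequentially] by simp
qed

text \<open>As densities, \<open>U\<close> and \<open>W\<close> give every rectangle the same mass.
  Rectangles are stable under intersection and generate the product sigma-algebra, so the two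
  measures coincide. This identifies a limit of midpoints with a cut limit.\<close>

lemma cut_norm_zero_AE:
  assumes "U \<in> graphons" "W \<in> graphons" "cut_norm (\<lambda>x y. U x y - W x y) \<le> 0"
  shows "AE p in unit_square. U (fst p) (snd p) = W (fst p) (snd p)"
proof -
  have k: "bounded_kernel U" "bounded_kernel W" using assms graphon_kernel by auto
  define u where "u = (\<lambda>(V :: real \<Rightarrow> real \<Rightarrow> real) p. ennreal (V (fst p) (snd p)))"
  have um: "u V \<in> borel_measurable unit_square" if "V \<in> graphons" for V
    unfolding u_def using kernel_measurable[OF graphon_kernel[OF that]] by measurable
  have em: "emeasure (density unit_square (u V)) (S \<times> T) = ennreal (LINT p : S \<times> T | unit_square. V (fst p) (snd p))"
    if "V \<in> graphons" "S \<in> sets unit_measure" "T \<in> sets unit_measure" for V S T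
  proof -
    have A: "S \<times> T \<in> sets unit_square" using that by (intro pair_measureI)
    then have "emeasure (density unit_square (u V)) (S \<times> T) = (\<integral>\<^sup>+p. u V p * indicator (S \<times> T) p \<partial>unit_square)"
      by (intro emeasure_density um that)
    also have "\<dots> = (\<integral>\<^sup>+p. ennreal (indicator (S \<times> T) p *\<^sub>R V (fst p) (snd p)) \<partial>unit_square)"
      by (rule nn_integral_cong) (auto simp: u_def indicator_def)
    also have "\<dots> = ennreal (LINT p : S \<times> T | unit_square. V (fst p) (snd p))"
      unfolding set_lebesgue_integral_def
    proof (rule nn_integral_eq_integral)
      show "integrable unit_square (\<lambda>p. indicator (S \<times> T) p *\<^sub>R V (fst p) (snd p))"
        using kernel_set_integrable[OF graphon_kernel[OF that(1)] A] by (simp add: set_integrable_def)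
      show "AE p in unit_square. 0 \<le> indicator (S \<times> T) p *\<^sub>R V (fst p) (snd p)"
        using graphon_bounds[OF that(1)] by (intro AE_I2) (auto simp: indicator_def)
    qed
    finally show ?thesis .
  qed
  have rect: "(LINT p : S \<times> T | unit_square. U (fst p) (snd p)) = (LINT p : S \<times> T | unit_square. W (fst p) (snd p))"
    if ST: "S \<in> sets unit_measure" "T \<in> sets unit_measure" for S T
  proof -
    have A: "S \<times> T \<in> sets unit_square" using that by (intro pair_measureI)
    have "\<bar>LINT p : S \<times> T | unit_square. U (fst p) (snd p) - W (fst p) (snd p)\<bar> \<le> 0"
      using cut_norm_upper[OF kernel_diff[OF k] ST] assms(3) by simp
    then show ?thesis
      by (subst (asm) set_integral_diff) (auto intro: kernel_set_integrable k A)
  qed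
  have "density unit_square (u U) = density unit_square (u W)"
  proof (rule measure_eqI_generator_eq[where \<Omega> = "{0..1} \<times> {0..1}" and A = "\<lambda>_. {0..1} \<times> {0..1}"
        and E = "{S \<times> T | S T. S \<in> sets unit_measure \<and> T \<in> sets unit_measure}"])
    show "Int_stable {S \<times> T | S T. S \<in> sets unit_measure \<and> T \<in> sets unit_measure}"
      by (rule Int_stable_pair_measure_generator)
    show "emeasure (density unit_square (u U)) X = emeasure (density unit_square (u W)) X"
      if "X \<in> {S \<times> T | S T. S \<in> sets unit_measure \<and> T \<in> sets unit_measure}" for X
      using that em assms(1,2) rect by auto
    show "{S \<times> T | S T. S \<in> sets unit_measure \<and> T \<in> sets unit_measure} \<subseteq> Pow ({0..1} \<times> {0..1})"
      using pair_measure_closed[of unit_measure unit_measure] by simp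
    have top: "{0..1} \<in> sets unit_measure" using sets.top[of unit_measure] by simp
    show "range (\<lambda>_. {0..1} \<times> {0..1}) \<subseteq> {S \<times> T | S T. S \<in> sets unit_measure \<and> T \<in> sets unit_measure}"
      using top by blast
    show "emeasure (density unit_square (u U)) ({0..1} \<times> {0..1}) \<noteq> \<infinity>"
      using em[OF assms(1) top top] by simp
  qed (auto simp: sets_pair_measure)
  then have "AE p in unit_square. u U p = u W p"
    using unit_square.P.density_unique_iff[OF um[OF assms(1)] um[OF assms(2)]] by simp
  then show ?thesis
  proof (rule AE_mp[OF _ AE_I2], intro impI)
    fix p assume "p \<in> space unit_square" "u U p = u W p"
    then show "U (fst p) (snd p) = W (fst p) (snd p)"
      using graphon_bounds[OF assms(1)] graphon_bounds[OF assms(2)] by (auto simp: u_def)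
  qed
qed

text \<open>Composing nearly optimal bijections brings the whole sequence into one coordinate
  system, where it is Cauchy in cut norm. A limit of midpoints of tails is then as close to each
  term as the tail itself.\<close>

lemma cut_dist_complete:
  fixes V :: "nat \<Rightarrow> real \<Rightarrow> real \<Rightarrow> real"
  assumes V: "\<And>j. V j \<in> graphons" and fast: "\<And>j. cut_dist (V j) (V (Suc j)) < (1/2)^j"
  obtains W where "W \<in> graphons" "(\<lambda>j. cut_dist (V j) W) \<longlonglongrightarrow> 0"
proof -
  have "\<forall>j. \<exists>f. f \<in> measure_preserving_bij \<and> cut_norm (\<lambda>x y. V j x y - V (Suc j) (f x) (f y)) < (1/2)^j"
    using cut_dist_lessD[OF V V fast] by (simp add: Bex_def)
  from choice[OF this] obtain f where f: "\<And>j. f j \<in> measure_preserving_bij"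
    "\<And>j. cut_norm (\<lambda>x y. V j x y - V (Suc j) (f j x) (f j y)) < (1/2)^j"
    by blast
  define F where "F = rec_nat (\<lambda>x. x) (\<lambda>j g x. f j (g x))"
  have F_Suc: "F (Suc j) x = f j (F j x)" for j x by (simp add: F_def)
  have Fm: "F j \<in> measure_preserving_bij" for j
  proof (induction j)
    case 0 show ?case using mpb_id by (simp add: F_def)
  next
    case (Suc j) show ?case using mpb_comp[OF f(1) Suc] by (simp add: F_def)
  qed
  define V' where "V' j = (\<lambda>x y. V j (F j x) (F j y))" for j
  have V': "V' j \<in> graphons" for j unfolding V'_def by (rule graphon_comp[OF Fm V])
  have step: "cut_norm (\<lambda>x y. V' j x y - V' (Suc j) x y) \<le> (1/2)^j" for j
    using cut_norm_comp[OF Fm kernel_cut_arg[OF V V f(1)], of j j "Suc j" j] f(2)[of j]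
    by (simp add: V'_def F_Suc)
  \<comment> \<open>The subtracted term carries the geometric sum through the induction and is
    dropped afterwards.\<close>
  have far: "cut_norm (\<lambda>x y. V' j x y - V' (j + i) x y) \<le> 2 * (1/2)^j - 2 * (1/2)^(j + i)" for i j
  proof (induction i)
    case 0 then show ?case by (simp add: cut_norm_zero)
  next
    case (Suc i)
    have "cut_norm (\<lambda>x y. V' j x y - V' (j + Suc i) x y)
       \<le> cut_norm (\<lambda>x y. V' j x y - V' (j + i) x y) + cut_norm (\<lambda>x y. V' (j + i) x y - V' (j + Suc i) x y)"
      by (rule cut_norm_diff_triangle) (simp_all add: graphon_kernel V')
    then show ?case using Suc step[of "j + i"] by simp
  qed
  obtain W w where W: "W \<in> graphons" "\<And>j. w j \<in> midpoint_hull (V' ` {j..})"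
    "AE p in unit_square. (\<lambda>j. w j (fst p) (snd p)) \<longlonglongrightarrow> W (fst p) (snd p)"
    using midpoint_hull_AE_convergent[of V', OF V'] by blast
  have w: "w j \<in> graphons" for j
    using midpoint_hull_graphon[OF W(2)] V' by blast
  have "cut_norm (\<lambda>x y. V' j x y - W x y) \<le> 2 * (1/2)^j" for j
  proof (rule cut_norm_le_midpoint_limit[OF w W(1) V' W(3)])
    show "\<forall>\<^sub>F i in sequentially. cut_norm (\<lambda>x y. V' j x y - w i x y) \<le> 2 * (1/2)^j"
      using eventually_ge_at_top[of j]
    proof eventually_elim
      case (elim i)
      show ?case
      proof (rule midpoint_hull_cut_norm[OF W(2) _ V'])
        fix v assume "v \<in> V' ` {i..}"
        then obtain m where m: "v = V' m" "j \<le> m" using elim by auto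
        then obtain l where l: "v = V' (j + l)" using le_Suc_ex by blast
        show "cut_norm (\<lambda>x y. V' j x y - v x y) \<le> 2 * (1/2)^j"
          using far[of j l] unfolding l by (rule order_trans) simp
      qed (use V' in auto)
    qed
  qed
  then have "cut_norm (\<lambda>x y. W x y - V' j x y) \<le> 2 * (1/2)^j" for j
    using cut_norm_diff_commute[OF graphon_kernel[OF W(1)] graphon_kernel[OF V']] by simp
  then have "cut_dist W (V j) \<le> 2 * (1/2)^j" for j
    using cut_dist_upper[OF W(1) V[of j] Fm[of j]] by (simp add: V'_def order_trans)
  then have le: "cut_dist (V j) W \<le> 2 * (1/2)^j" for j
    using cut_dist_commute[OF V W(1)] by simp
  have "(\<lambda>j. cut_dist (V j) W) \<longlonglongrightarrow> 0"
  proof (rule tendsto_sandwich[OF _ _ tendsto_const])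
    show "\<forall>\<^sub>F j in sequentially. 0 \<le> cut_dist (V j) W" using cut_dist_nonneg[OF V W(1)] by simp
    show "\<forall>\<^sub>F j in sequentially. cut_dist (V j) W \<le> 2 * (1/2)^j" using le by simp
    show "(\<lambda>j. 2 * (1/2)^j :: real) \<longlonglongrightarrow> 0" by real_asymp
  qed
  then show ?thesis using that[OF W(1)] by blast
qed

subsection \<open>Entropy\<close>

lemma binary_entropy_nonneg:
  assumes "x \<in> {0..1}" shows "0 \<le> binary_entropy x"
proof -
  have neg: "y * log 2 y \<le> 0" if "y \<in> {0..1}" for y :: real
    using that by (cases "y = 0") (auto intro!: mult_nonneg_nonpos)
  show ?thesis using neg[of x] neg[of "1 - x"] assms by (simp add: binary_entropy_def)
qed

text \<open>Convexity including the endpoint 0: the tangent inequality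
  \<open>z - m \<le> z * (ln z - ln m)\<close> is added up for \<open>z = x\<close> and
  \<open>z = y\<close>, and the left sides cancel because \<open>m\<close> is the midpoint.\<close>

lemma xlogx_midpoint:
  fixes x y :: real
  assumes "0 \<le> x" "0 \<le> y"
  shows "(x + y) / 2 * log 2 ((x + y) / 2) \<le> (x * log 2 x + y * log 2 y) / 2"
proof (cases "x + y = 0")
  case True
  then have "x = 0" "y = 0" using assms by auto
  then show ?thesis by simp
next
  case False
  define m where "m = (x + y) / 2"
  have m: "m > 0" using False assms by (simp add: m_def)
  have gibbs: "z - m \<le> z * (ln z - ln m)" if "z \<ge> 0" for z
  proof (cases "z = 0")
    case False
    then have z: "z > 0" using that by simp
    have "ln (m / z) \<le> m / z - 1" using z m by (intro ln_le_minus_one) simp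
    then have "z * (ln m - ln z) \<le> z * (m / z - 1)"
      using z m by (intro mult_left_mono) (simp_all add: ln_div)
    then show ?thesis using z by (simp add: algebra_simps)
  qed (use m in simp)
  have "0 \<le> x * (ln x - ln m) + y * (ln y - ln m)"
    using add_mono[OF gibbs[OF assms(1)] gibbs[OF assms(2)]] by (simp add: m_def)
  then have "2 * m * ln m \<le> x * ln x + y * ln y"
    by (simp add: m_def field_simps)
  then have "2 * m * ln m / ln 2 \<le> (x * ln x + y * ln y) / ln 2"
    by (intro divide_right_mono) auto
  then have "2 * (m * log 2 m) \<le> x * log 2 x + y * log 2 y"
    by (simp add: log_def add_divide_distrib)
  then show ?thesis by (simp add: m_def)
qed

lemma binary_entropy_midpoint:
  assumes "x \<in> {0..1}" "y \<in> {0..1}"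
  shows "(binary_entropy x + binary_entropy y) / 2 \<le> binary_entropy ((x + y) / 2)"
proof -
  have eq: "1 - (x + y) / 2 = ((1 - x) + (1 - y)) / 2" by (simp add: field_simps)
  have "(1 - (x + y) / 2) * log 2 (1 - (x + y) / 2)
      \<le> ((1 - x) * log 2 (1 - x) + (1 - y) * log 2 (1 - y)) / 2"
    unfolding eq by (rule xlogx_midpoint) (use assms in auto)
  moreover have "(x + y) / 2 * log 2 ((x + y) / 2) \<le> (x * log 2 x + y * log 2 y) / 2"
    using xlogx_midpoint[of x y] assms by simp
  ultimately show ?thesis
    unfolding binary_entropy_def minus_mult_left[symmetric] by argo
qed

text \<open>\<open>x\<close> and \<open>1 - x\<close> have the same entropy, and their midpoint is
  1/2, where the entropy is 1.\<close>

lemma binary_entropy_le_1: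
  assumes "x \<in> {0..1}" shows "binary_entropy x \<le> 1"
proof -
  have "binary_entropy (1 - x) = binary_entropy x" by (simp add: binary_entropy_def algebra_simps)
  moreover have "binary_entropy (1/2) = 1" by (simp add: binary_entropy_def log_divide)
  ultimately show ?thesis
    using binary_entropy_midpoint[of x "1 - x"] assms by simp
qed

lemma continuous_on_xlogx: "continuous_on {0..} (\<lambda>x::real. x * log 2 x)"
  unfolding continuous_on_def
proof
  fix x :: real assume "x \<in> {0..}"
  show "((\<lambda>x. x * log 2 x) \<longlongrightarrow> x * log 2 x) (at x within {0..})"
  proof (cases "x = 0")
    case True
    have "((\<lambda>x::real. x * log 2 x) \<longlongrightarrow> 0) (at_right 0)" by real_asymp
    then show ?thesis using True by (simp add: at_within_Ici_at_right)
  next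
    case False
    then show ?thesis using \<open>x \<in> {0..}\<close> by (intro tendsto_intros) auto
  qed
qed

lemma continuous_on_binary_entropy: "continuous_on {0..1} binary_entropy"
proof -
  have "continuous_on {0..1} (\<lambda>x. - (x * log 2 x) - (1 - x) * log 2 (1 - x))"
    by (intro continuous_on_diff continuous_on_minus continuous_on_subset[OF continuous_on_xlogx]
        continuous_on_compose2[OF continuous_on_xlogx, of "{0..1}" "\<lambda>x. 1 - x"] continuous_intros) auto
  then show ?thesis by (rule continuous_on_eq) (simp add: binary_entropy_def)
qed

lemma binary_entropy_measurable [measurable]: "binary_entropy \<in> borel_measurable borel"
  unfolding binary_entropy_def[abs_def] by measurable

text \<open>One integral over the square, to which dominated convergence and change of variables
  apply directly; \<open>Ent_eq\<close> identifies it with the iterated integral by Fubini.\<close>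

definition graphon_entropy :: "(real \<Rightarrow> real \<Rightarrow> real) \<Rightarrow> real" where
  "graphon_entropy W = (LINT p | unit_square. binary_entropy (W (fst p) (snd p)))"

lemma entropy_measurable:
  assumes "W \<in> graphons"
  shows "(\<lambda>p. binary_entropy (W (fst p) (snd p))) \<in> borel_measurable unit_square"
proof -
  note [measurable] = kernel_measurable[OF graphon_kernel[OF assms]]
  show ?thesis by measurable
qed

lemma entropy_integrable:
  assumes "W \<in> graphons"
  shows "integrable unit_square (\<lambda>p. binary_entropy (W (fst p) (snd p)))"
  by (rule unit_square.P.integrable_const_bound[where B = 1])
     (use binary_entropy_nonneg binary_entropy_le_1 graphon_bounds[OF assms] entropy_measurable[OF assms] in
       \<open>auto intro!: AE_I2\<close>)

lemma Ent_eq: "\<Gamma> \<in> graph_limits \<Longrightarrow> Ent \<Gamma> = graphon_entropy (rep \<Gamma>)"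
  using unit_square.integral_fst'[OF entropy_integrable[OF rep_graphon]]
  by (simp add: Ent_def graphon_entropy_def)

lemma graphon_entropy_le_1: "W \<in> graphons \<Longrightarrow> graphon_entropy W \<le> 1"
  unfolding graphon_entropy_def
  by (rule unit_square.P.integral_le_const[OF entropy_integrable])
     (auto intro!: AE_I2 binary_entropy_le_1 simp: graphon_bounds)

lemma graphon_entropy_comp:
  assumes "f \<in> measure_preserving_bij" "W \<in> graphons"
  shows "graphon_entropy (\<lambda>x y. W (f x) (f y)) = graphon_entropy W"
  using integral_comp_mpb[OF assms(1) entropy_measurable[OF assms(2)]] by (simp add: graphon_entropy_def)

lemma midpoint_hull_entropy:
  assumes "u \<in> midpoint_hull A" "A \<subseteq> graphons" "\<And>v. v \<in> A \<Longrightarrow> s \<le> graphon_entropy v"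
  shows "s \<le> graphon_entropy u"
  using assms(1)
proof induction
  case (base u) then show ?case using assms(3) by blast
next
  case (midpoint u v)
  have g: "u \<in> graphons" "v \<in> graphons"
    using midpoint(1,2) midpoint_hull_graphon assms(2) by blast+
  have "(graphon_entropy u + graphon_entropy v) / 2
    = (LINT p | unit_square. (binary_entropy (u (fst p) (snd p)) + binary_entropy (v (fst p) (snd p))) / 2)"
    using entropy_integrable[OF g(1)] entropy_integrable[OF g(2)] by (simp add: graphon_entropy_def)
  also have "\<dots> \<le> graphon_entropy (\<lambda>x y. (u x y + v x y) / 2)"
    unfolding graphon_entropy_def
  proof (rule integral_mono)
    show "integrable unit_square (\<lambda>p. binary_entropy ((u (fst p) (snd p) + v (fst p) (snd p)) / 2))"
      using entropy_integrable[OF graphon_midpoint[OF g]] .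
  qed (use entropy_integrable[OF g(1)] entropy_integrable[OF g(2)] graphon_bounds[OF g(1)] graphon_bounds[OF g(2)]
    in \<open>auto intro!: binary_entropy_midpoint simp del: divide_le_eq_numeral1\<close>)
  finally show ?case using midpoint.IH by simp
qed

text \<open>Entropy is concave and \<open>L\<^sup>1\<close>-continuous, hence upper semicontinuous for the cut metric:
  pass to convex combinations that converge almost everywhere.\<close>

lemma entropy_upper_semicontinuous:
  fixes V :: "nat \<Rightarrow> real \<Rightarrow> real \<Rightarrow> real"
  assumes V: "\<And>j. V j \<in> graphons" and W: "W \<in> graphons"
    and conv: "(\<lambda>j. cut_dist (V j) W) \<longlonglongrightarrow> 0"
    and s: "s \<longlonglongrightarrow> s0" "\<And>j. s j \<le> graphon_entropy (V j)"
  shows "s0 \<le> graphon_entropy W"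
proof (rule field_le_epsilon)
  fix e :: real assume e: "0 < e"
  \<comment> \<open>Aligning \<open>V j\<close> with \<open>W\<close> by a nearly optimal bijection
    turns cut distances into cut norms and leaves the entropy unchanged.\<close>
  have "\<forall>j. \<exists>f. f \<in> measure_preserving_bij \<and>
      cut_norm (\<lambda>x y. W x y - V j (f x) (f y)) < cut_dist W (V j) + inverse (real (Suc j))"
    using cut_dist_lessD[OF W V] by (simp add: Bex_def)
  from choice[OF this] obtain f where f: "\<And>j. f j \<in> measure_preserving_bij"
    "\<And>j. cut_norm (\<lambda>x y. W x y - V j (f j x) (f j y)) < cut_dist W (V j) + inverse (real (Suc j))"
    by blast
  define V' where "V' j = (\<lambda>x y. V j (f j x) (f j y))" for j
  have V': "V' j \<in> graphons" for j unfolding V'_def by (rule graphon_comp[OF f(1) V])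
  have ent: "graphon_entropy (V' j) = graphon_entropy (V j)" for j
    unfolding V'_def by (rule graphon_entropy_comp[OF f(1) V])
  have "(\<lambda>j. cut_dist (V j) W + inverse (real (Suc j))) \<longlonglongrightarrow> 0 + 0"
    by (intro tendsto_add conv LIMSEQ_inverse_real_of_nat)
  then have lim: "(\<lambda>j. cut_dist W (V j) + inverse (real (Suc j))) \<longlonglongrightarrow> 0"
    using cut_dist_commute[OF V W] by simp
  obtain N where N: "\<And>j. j \<ge> N \<Longrightarrow> s0 - e \<le> s j"
    using order_tendstoD(1)[OF s(1), of "s0 - e"] e unfolding eventually_sequentially by force
  obtain W' w where W': "W' \<in> graphons" "\<And>j. w j \<in> midpoint_hull (V' ` {j..})"
    "AE p in unit_square. (\<lambda>j. w j (fst p) (snd p)) \<longlonglongrightarrow> W' (fst p) (snd p)"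
    using midpoint_hull_AE_convergent[of V', OF V'] by blast
  have sub: "V' ` B \<subseteq> graphons" for B using V' by blast
  have w: "w j \<in> graphons" for j
    using midpoint_hull_graphon[OF W'(2) sub] .
  \<comment> \<open>Late tails lie in any given cut-norm ball around \<open>W\<close>, and so does
    the limit of their midpoints; hence \<open>W'\<close> is \<open>W\<close> almost
    everywhere.\<close>
  have "cut_norm (\<lambda>x y. W x y - W' x y) \<le> d" if "d > 0" for d
  proof (rule cut_norm_le_midpoint_limit[OF w W'(1) W W'(3)])
    obtain M where M: "\<And>j. j \<ge> M \<Longrightarrow> cut_dist W (V j) + inverse (real (Suc j)) \<le> d"
      using order_tendstoD(2)[OF lim \<open>d > 0\<close>] unfolding eventually_sequentially by force
    show "\<forall>\<^sub>F j in sequentially. cut_norm (\<lambda>x y. W x y - w j x y) \<le> d"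
      using eventually_ge_at_top[of M]
    proof eventually_elim
      case (elim j)
      show ?case
      proof (rule midpoint_hull_cut_norm[OF W'(2) sub W])
        fix v assume "v \<in> V' ` {j..}"
        then obtain i where i: "v = V' i" "M \<le> i" using elim by auto
        show "cut_norm (\<lambda>x y. W x y - v x y) \<le> d"
          using f(2)[of i] M[OF i(2)] unfolding i(1) V'_def by linarith
      qed
    qed
  qed
  then have "cut_norm (\<lambda>x y. W x y - W' x y) \<le> 0" by (rule field_le_epsilon) simp
  then have eq: "AE p in unit_square. W (fst p) (snd p) = W' (fst p) (snd p)"
    by (rule cut_norm_zero_AE[OF W W'(1)])
  have "(\<lambda>j. graphon_entropy (w j)) \<longlonglongrightarrow> graphon_entropy W"
    unfolding graphon_entropy_def
  proof (rule integral_dominated_convergence[where w = "\<lambda>_. 1"])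
    show "AE p in unit_square. (\<lambda>j. binary_entropy (w j (fst p) (snd p))) \<longlonglongrightarrow> binary_entropy (W (fst p) (snd p))"
      using AE_space W'(3) eq
    proof eventually_elim
      case (elim p)
      then have p: "fst p \<in> {0..1}" "snd p \<in> {0..1}" by auto
      show ?case
        by (rule continuous_on_tendsto_compose[OF continuous_on_binary_entropy])
           (use elim graphon_bounds[OF W p] graphon_bounds[OF w p] in auto)
    qed
    show "AE p in unit_square. norm (binary_entropy (w j (fst p) (snd p))) \<le> 1" for j
      using binary_entropy_nonneg binary_entropy_le_1 graphon_bounds[OF w] by (intro AE_I2) auto
  qed (auto intro: entropy_measurable W w)
  then have "s0 - e \<le> graphon_entropy W"
  proof (rule tendsto_lowerbound)
    show "\<forall>\<^sub>F j in sequentially. s0 - e \<le> graphon_entropy (w j)"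
      using eventually_ge_at_top[of N]
    proof eventually_elim
      case (elim j)
      show ?case
      proof (rule midpoint_hull_entropy[OF W'(2) sub])
        fix v assume "v \<in> V' ` {j..}"
        then obtain i where i: "v = V' i" "N \<le> i" using elim by auto
        show "s0 - e \<le> graphon_entropy v"
          using N[OF i(2)] s(2)[of i] by (simp add: i(1) ent)
      qed
    qed
  qed simp
  then show "s0 \<le> graphon_entropy W + e" by simp
qed

text \<open>Semicontinuity along constant sequences, in both directions.\<close>

lemma graphon_entropy_weak_iso:
  assumes "U \<in> graphons" "W \<in> graphons" "cut_dist U W = 0"
  shows "graphon_entropy U = graphon_entropy W"
proof (rule antisym)
  show "graphon_entropy U \<le> graphon_entropy W"
    by (rule entropy_upper_semicontinuous[where V = "\<lambda>_. U" and s = "\<lambda>_. graphon_entropy U"])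
       (use assms in auto)
  show "graphon_entropy W \<le> graphon_entropy U"
    by (rule entropy_upper_semicontinuous[where V = "\<lambda>_. W" and s = "\<lambda>_. graphon_entropy W"])
       (use assms cut_dist_commute[of U W] in auto)
qed

lemma Ent_limit_of: "W \<in> graphons \<Longrightarrow> Ent (limit_of W) = graphon_entropy W"
  using graphon_entropy_weak_iso[of W "rep (limit_of W)"] cut_dist_rep_limit_of[of W]
    Ent_eq[OF limit_of_in] rep_graphon[OF limit_of_in] by simp

subsection \<open>Step functions\<close>

text \<open>For \<open>n > 0\<close> cell \<open>i\<close> is \<open>((i-1)/n, i/n]\<close>, as in
  \<open>graph_graphon\<close>, and in the unit interval the index 0 occurs at the point 0 only.
  Indices therefore run over \<open>{..n}\<close>, and the null cell 0 has to be discarded from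
  integrals.\<close>

definition cell_index :: "nat \<Rightarrow> real \<Rightarrow> nat" where
  "cell_index n x = nat \<lceil>real n * x\<rceil>"

definition cell :: "nat \<Rightarrow> nat \<Rightarrow> real set" where
  "cell n i = {x \<in> {0..1}. cell_index n x = i}"

definition step :: "nat \<Rightarrow> (nat \<Rightarrow> nat \<Rightarrow> real) \<Rightarrow> real \<Rightarrow> real \<Rightarrow> real" where
  "step n a x y = a (cell_index n x) (cell_index n y)"

lemma cell_index_measurable [measurable]: "cell_index n \<in> unit_measure \<rightarrow>\<^sub>M count_space UNIV"
  unfolding cell_index_def by measurable

lemma cell_index_le:
  assumes "x \<in> {0..1}" shows "cell_index n x \<le> n"
proof -
  have "real n * x \<le> real n" using assms mult_left_mono[of x 1 "real n"] by simp
  then show ?thesis by (simp add: cell_index_def ceiling_le_iff)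
qed

lemma cell_index_eq_iff:
  assumes "n > 0" "i > 0"
  shows "cell_index n x = i \<longleftrightarrow> real i - 1 < real n * x \<and> real n * x \<le> real i"
proof -
  have "cell_index n x = i \<longleftrightarrow> \<lceil>real n * x\<rceil> = int i" using assms by (auto simp: cell_index_def)
  also have "\<dots> \<longleftrightarrow> real i - 1 < real n * x \<and> real n * x \<le> real i" by (simp add: ceiling_eq_iff)
  finally show ?thesis .
qed

lemma cell_eq:
  assumes "n > 0" "i \<in> {1..n}"
  shows "cell n i = {(real i - 1) / n <.. real i / n}"
proof -
  have "x \<in> {0..1}" if "real i - 1 < real n * x" "real n * x \<le> real i" for x
  proof -
    have "1 \<le> real i" "real i \<le> real n" using assms by auto
    then have "0 < real n * x" and le: "real n * x \<le> real n * 1" using that by linarith+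
    moreover have "x \<le> 1" by (rule mult_left_le_imp_le[OF le]) (use assms in simp)
    ultimately show ?thesis using assms(1) by (simp add: zero_less_mult_iff)
  qed
  then show ?thesis
    using assms unfolding cell_def by (auto simp: cell_index_eq_iff field_simps)
qed

lemma cell_iff:
  assumes "n > 0" "i \<in> {1..n}"
  shows "x \<in> cell n i \<longleftrightarrow> real i - 1 < real n * x \<and> real n * x \<le> real i"
  using assms by (auto simp: cell_eq field_simps)

lemma cell_0: "n > 0 \<Longrightarrow> cell n 0 = {0}"
  by (auto simp: cell_def cell_index_def mult_le_0_iff)

lemma cell_sets [measurable]: "cell n i \<in> sets unit_measure"
proof -
  have "cell n i = cell_index n -` {i} \<inter> space unit_measure" by (auto simp: cell_def)
  then show ?thesis using measurable_sets[OF cell_index_measurable, of "{i}"] by simp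
qed

lemma emeasure_unit_measure: "A \<in> sets unit_measure \<Longrightarrow> emeasure unit_measure A = emeasure lborel A"
  unfolding unit_measure_def by (subst emeasure_restrict_space) (auto simp: sets_restrict_space)

lemma measure_unit_measure: "A \<in> sets unit_measure \<Longrightarrow> measure unit_measure A = measure lborel A"
  by (simp add: measure_def emeasure_unit_measure)

lemma sets_unit_measure_borel: "A \<in> sets unit_measure \<longleftrightarrow> A \<in> sets borel \<and> A \<subseteq> {0..1}"
  unfolding unit_measure_def by (auto simp: sets_restrict_space_iff)

lemma measure_cell: "n > 0 \<Longrightarrow> i \<in> {1..n} \<Longrightarrow> measure unit_measure (cell n i) = 1 / n"
  by (subst measure_unit_measure[OF cell_sets]) (simp add: cell_eq divide_simps)

lemma measure_Int_cell_0: "n > 0 \<Longrightarrow> measure unit_measure (S \<inter> cell n 0) = 0"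
  by (cases "S \<inter> cell n 0 = {}")
     (auto simp: cell_0 measure_unit_measure sets_unit_measure_borel Int_insert_right)

lemma step_measurable: "(\<lambda>p. step n a (fst p) (snd p)) \<in> borel_measurable unit_square"
  unfolding step_def
  by (rule measurable_compose_countable[where f = "\<lambda>i p. a i (cell_index n (snd p))"],
      rule measurable_compose_countable[where f = "\<lambda>j p. a _ j"])
     (auto intro: measurable_compose[OF measurable_fst] measurable_compose[OF measurable_snd])

lemma step_kernel: "bounded_kernel (step n a)"
proof (rule kernelI[OF step_measurable])
  fix x y :: real assume "x \<in> {0..1}" "y \<in> {0..1}"
  then have "(cell_index n x, cell_index n y) \<in> {..n} \<times> {..n}" using cell_index_le by simp
  then show "\<bar>step n a x y\<bar> \<le> (\<Sum>q\<in>{..n} \<times> {..n}. \<bar>a (fst q) (snd q)\<bar>)"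
    unfolding step_def
    by (intro member_le_sum[of "(cell_index n x, cell_index n y)" _ "\<lambda>q. \<bar>a (fst q) (snd q)\<bar>", simplified fst_conv snd_conv]) auto
qed

lemma step_graphon:
  assumes "\<And>i j. a i j = a j i" "\<And>i j. a i j \<in> {0..1}" shows "step n a \<in> graphons"
  by (rule graphonI[OF step_measurable]) (use assms in \<open>auto simp: step_def\<close>)

lemma step_rectangle_integral:
  assumes "n > 0" "S \<in> sets unit_measure" "T \<in> sets unit_measure"
  shows "(LINT p : S \<times> T | unit_square. step n g (fst p) (snd p))
    = (\<Sum>i=1..n. \<Sum>j=1..n. g i j * (measure unit_measure (S \<inter> cell n i) * measure unit_measure (T \<inter> cell n j)))"
proof -
  let ?R = "\<lambda>i j. (S \<inter> cell n i) \<times> (T \<inter> cell n j)"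
  have R: "?R i j \<in> sets unit_square" for i j
    by (rule pair_measureI) (use assms in auto)
  have mR: "measure unit_square (?R i j) = measure unit_measure (S \<inter> cell n i) * measure unit_measure (T \<inter> cell n j)" for i j
    using unit_measure.emeasure_pair_measure_Times[of "S \<inter> cell n i" unit_measure "T \<inter> cell n j"] assms
    by (simp add: measure_def enn2real_mult)
  have "(LINT p : S \<times> T | unit_square. step n g (fst p) (snd p))
     = (LINT p | unit_square. (\<Sum>i\<le>n. (\<Sum>j\<le>n. g i j * indicator (?R i j) p)))"
    unfolding set_lebesgue_integral_def
  proof (rule Bochner_Integration.integral_cong)
    fix p assume "p \<in> space unit_square"
    then have p: "fst p \<in> {0..1}" "snd p \<in> {0..1}" by auto
    have ind: "indicator (?R i j) p = (if i = cell_index n (fst p) then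
       (if j = cell_index n (snd p) then indicator (S \<times> T) p else 0) else (0::real))" for i j
      using p by (auto simp: cell_def indicator_def mem_Times_iff)
    show "indicator (S \<times> T) p *\<^sub>R step n g (fst p) (snd p) = (\<Sum>i\<le>n. \<Sum>j\<le>n. g i j * indicator (?R i j) p)"
      unfolding ind using cell_index_le[OF p(1), of n] cell_index_le[OF p(2), of n]
      by (simp add: if_distrib[of "\<lambda>x. _ * x"] step_def cong: if_cong)
         (simp add: if_distribR sum.If_cases)
  qed simp
  also have "\<dots> = (\<Sum>i\<le>n. \<Sum>j\<le>n. g i j * measure unit_square (?R i j))"
  proof -
    have int: "integrable unit_square (\<lambda>p. g i j * indicator (?R i j) p)" for i j
      by (intro integrable_mult_right integrable_real_indicator R)
         (simp add: unit_square.P.emeasure_eq_measure)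
    have "(LINT p | unit_square. g i j * indicator (?R i j) p) = g i j * measure unit_square (?R i j)" for i j
      using R[of i j] sets.sets_into_space[OF R[of i j]]
      by (subst integral_mult_right_zero) (simp add: Int_absorb2)
    moreover have "(LINT p | unit_square. (\<Sum>i\<le>n. (\<Sum>j\<le>n. g i j * indicator (?R i j) p)))
      = (\<Sum>i\<le>n. (\<Sum>j\<le>n. LINT p | unit_square. g i j * indicator (?R i j) p))"
      by (subst Bochner_Integration.integral_sum, intro Bochner_Integration.integrable_sum int,
          intro sum.cong refl Bochner_Integration.integral_sum int)
    ultimately show ?thesis by (simp only:)
  qed
  also have "\<dots> = (\<Sum>i=1..n. \<Sum>j=1..n. g i j * measure unit_square (?R i j))"
  proof -
    have e: "{..n} = insert 0 {1..n}" by auto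
    show ?thesis unfolding e mR using measure_Int_cell_0[OF assms(1)] by simp
  qed
  finally show ?thesis unfolding mR .
qed

lemma step_integral:
  assumes "n > 0"
  shows "(LINT p | unit_square. step n g (fst p) (snd p)) = (\<Sum>i=1..n. \<Sum>j=1..n. g i j) / n\<^sup>2"
proof -
  have top: "{0..1} \<in> sets unit_measure" using sets.top[of unit_measure] by simp
  have c: "{0..1} \<inter> cell n i = cell n i" for i by (auto simp: cell_def)
  have "(LINT p | unit_square. step n g (fst p) (snd p))
     = (LINT p : {0..1} \<times> {0..1} | unit_square. step n g (fst p) (snd p))"
    unfolding set_lebesgue_integral_def by (rule Bochner_Integration.integral_cong) auto
  also have "\<dots> = (\<Sum>i=1..n. \<Sum>j=1..n. g i j * (1 / n * (1 / n)))"
    unfolding step_rectangle_integral[OF assms top top] c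
    by (intro sum.cong refl) (use measure_cell[OF assms] in simp)
  finally show ?thesis by (simp add: sum_divide_distrib power2_eq_square)
qed

lemma graphon_entropy_step:
  "n > 0 \<Longrightarrow> graphon_entropy (step n g) = (\<Sum>i=1..n. \<Sum>j=1..n. binary_entropy (g i j)) / n\<^sup>2"
  using step_integral[of n "\<lambda>i j. binary_entropy (g i j)"] by (simp add: graphon_entropy_def step_def)

text \<open>A linear form on the box of weights between 0 and \<open>r\<close> is largest at the
  vertex that selects the positive coefficients.\<close>

lemma weighted_sum_le_subset_sum:
  fixes x s :: "'a \<Rightarrow> real"
  assumes "finite I" "\<And>i. i \<in> I \<Longrightarrow> 0 \<le> s i \<and> s i \<le> r" "0 \<le> r"
  obtains A where "A \<subseteq> I" "(\<Sum>i\<in>I. s i * x i) \<le> r * (\<Sum>i\<in>A. x i)"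
proof
  let ?A = "{i \<in> I. 0 < x i}"
  show "?A \<subseteq> I" by auto
  have "(\<Sum>i\<in>I. s i * x i) \<le> (\<Sum>i\<in>I. if 0 < x i then r * x i else 0)"
    by (rule sum_mono) (use assms in \<open>auto intro: mult_right_mono mult_nonneg_nonpos\<close>)
  also have "\<dots> = r * (\<Sum>i\<in>?A. x i)"
    using assms(1) by (simp add: sum.inter_filter[symmetric] sum_distrib_left)
  finally show "(\<Sum>i\<in>I. s i * x i) \<le> r * (\<Sum>i\<in>?A. x i)" .
qed

text \<open>A measurable rectangle gives each cell a weight between 0 and 1/n on either side. The
  integral is linear in the weights of one side, so the two sides can be rounded in turn to weights
  0 and 1/n, that is, to index sets.\<close>

lemma cut_norm_step_le:
  assumes n: "n > 0"
    and c: "\<And>A B. A \<subseteq> {1..n} \<Longrightarrow> B \<subseteq> {1..n} \<Longrightarrow> \<bar>\<Sum>i\<in>A. \<Sum>j\<in>B. g i j\<bar> \<le> c"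
  shows "cut_norm (step n g) \<le> c / n\<^sup>2"
proof (rule cut_norm_least)
  fix S T assume ST: "S \<in> sets unit_measure" "T \<in> sets unit_measure"
  define s t where "s i = measure unit_measure (S \<inter> cell n i)"
    and "t i = measure unit_measure (T \<inter> cell n i)" for i
  have le: "measure unit_measure (X \<inter> cell n i) \<le> 1 / n" if "X \<in> sets unit_measure" "i \<in> {1..n}" for X i
    unfolding measure_cell[OF n that(2), symmetric]
    by (rule unit_measure.finite_measure_mono) (use that in auto)
  have s: "0 \<le> s i \<and> s i \<le> 1 / n" if "i \<in> {1..n}" for i using le[OF ST(1) that] by (simp add: s_def)
  have t: "0 \<le> t i \<and> t i \<le> 1 / n" if "i \<in> {1..n}" for i using le[OF ST(2) that] by (simp add: t_def)
  \<comment> \<open>Stated for general \<open>h\<close> because the absolute value needs both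
    \<open>g\<close> and its negative.\<close>
  have bound: "(\<Sum>i=1..n. \<Sum>j=1..n. h i j * (s i * t j)) \<le> c / n\<^sup>2"
    if h: "\<And>A B. A \<subseteq> {1..n} \<Longrightarrow> B \<subseteq> {1..n} \<Longrightarrow> (\<Sum>i\<in>A. \<Sum>j\<in>B. h i j) \<le> c" for h
  proof -
    have "(\<Sum>i=1..n. \<Sum>j=1..n. h i j * (s i * t j)) = (\<Sum>i=1..n. s i * (\<Sum>j=1..n. t j * h i j))"
      by (simp add: sum_distrib_left mult_ac)
    also obtain A where A: "A \<subseteq> {1..n}"
      "(\<Sum>i=1..n. s i * (\<Sum>j=1..n. t j * h i j)) \<le> 1 / n * (\<Sum>i\<in>A. \<Sum>j=1..n. t j * h i j)"
      using weighted_sum_le_subset_sum[of "{1..n}" s "1 / n" "\<lambda>i. \<Sum>j=1..n. t j * h i j"] s by auto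
    note A(2)
    also have "(\<Sum>i\<in>A. \<Sum>j=1..n. t j * h i j) = (\<Sum>j=1..n. t j * (\<Sum>i\<in>A. h i j))"
      by (subst sum.swap) (simp add: sum_distrib_left)
    also obtain B where B: "B \<subseteq> {1..n}"
      "(\<Sum>j=1..n. t j * (\<Sum>i\<in>A. h i j)) \<le> 1 / n * (\<Sum>j\<in>B. \<Sum>i\<in>A. h i j)"
      using weighted_sum_le_subset_sum[of "{1..n}" t "1 / n" "\<lambda>j. \<Sum>i\<in>A. h i j"] t by auto
    have "1 / n * (\<Sum>j=1..n. t j * (\<Sum>i\<in>A. h i j)) \<le> 1 / n * (1 / n * (\<Sum>j\<in>B. \<Sum>i\<in>A. h i j))"
      by (intro mult_left_mono B) simp
    also have "\<dots> \<le> 1 / n * (1 / n * c)"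
      using h[OF A(1) B(1)] by (intro mult_left_mono) (simp_all add: sum.swap[of _ B])
    finally show ?thesis by (simp add: power2_eq_square)
  qed
  have eq: "(LINT p : S \<times> T | unit_square. step n g (fst p) (snd p)) = (\<Sum>i=1..n. \<Sum>j=1..n. g i j * (s i * t j))"
    unfolding s_def t_def by (rule step_rectangle_integral[OF n ST])
  have 1: "(\<Sum>i=1..n. \<Sum>j=1..n. g i j * (s i * t j)) \<le> c / n\<^sup>2"
    by (rule bound) (use c in \<open>force simp: abs_le_iff\<close>)
  have 2: "(\<Sum>i=1..n. \<Sum>j=1..n. (- g i j) * (s i * t j)) \<le> c / n\<^sup>2"
    by (rule bound) (use c in \<open>force simp: abs_le_iff sum_negf\<close>)
  show "\<bar>LINT p : S \<times> T | unit_square. step n g (fst p) (snd p)\<bar> \<le> c / n\<^sup>2"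
    unfolding eq using 1 2 by (simp add: sum_negf abs_le_iff)
qed

subsection \<open>Permuting the steps\<close>

text \<open>A translation of each cell \<open>i\<close> onto cell \<open>\<sigma> i\<close>. The
  point 0 stays fixed when \<open>\<sigma>\<close> permutes \<open>{1..n}\<close>, since then
  \<open>\<sigma> 0 = 0\<close>.\<close>

definition permute_cells :: "nat \<Rightarrow> (nat \<Rightarrow> nat) \<Rightarrow> real \<Rightarrow> real" where
  "permute_cells n \<sigma> x = x + (real (\<sigma> (cell_index n x)) - real (cell_index n x)) / n"

lemma cell_index_permute_cells:
  assumes n: "n > 0" and \<sigma>: "\<sigma> permutes {1..n}" and x: "x \<in> {0..1}"
  shows "permute_cells n \<sigma> x \<in> {0..1}" "cell_index n (permute_cells n \<sigma> x) = \<sigma> (cell_index n x)"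
proof -
  define i where "i = cell_index n x"
  have xi: "x \<in> cell n i" using x by (simp add: i_def cell_def)
  have "permute_cells n \<sigma> x \<in> cell n (\<sigma> i)"
  proof (cases "i = 0")
    case True
    have "\<sigma> 0 = 0" using permutes_not_in[OF \<sigma>, of 0] by simp
    moreover have "x = 0" using xi True n by (simp add: cell_0)
    ultimately show ?thesis using True n by (simp add: permute_cells_def i_def cell_0)
  next
    case False
    then have i: "i \<in> {1..n}" using cell_index_le[OF x] by (simp add: i_def Suc_leI)
    then have "\<sigma> i \<in> {1..n}" using permutes_in_image[OF \<sigma>] by blast
    then show ?thesis
      using xi i n cell_iff[OF n \<open>\<sigma> i \<in> {1..n}\<close>] cell_iff[OF n i]
      by (simp add: permute_cells_def i_def[symmetric] distrib_left)
  qed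
  then show "permute_cells n \<sigma> x \<in> {0..1}" "cell_index n (permute_cells n \<sigma> x) = \<sigma> (cell_index n x)"
    by (auto simp: cell_def i_def)
qed

lemma permute_cells_inverse:
  assumes "n > 0" "\<sigma> permutes {1..n}" "x \<in> {0..1}"
  shows "permute_cells n (inv \<sigma>) (permute_cells n \<sigma> x) = x"
  using cell_index_permute_cells(2)[OF assms] assms
  by (simp add: permute_cells_def[of n "inv \<sigma>"] permutes_inverses)
     (simp add: permute_cells_def field_simps)

lemma permute_cells_measurable: 
  assumes "n > 0" "\<sigma> permutes {1..n}"
  shows "permute_cells n \<sigma> \<in> unit_measure \<rightarrow>\<^sub>M unit_measure"
proof -
  have [measurable]: "(\<lambda>x. real (\<sigma> (cell_index n x)) - real (cell_index n x)) \<in> borel_measurable unit_measure"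
    using measurable_compose[OF cell_index_measurable, of "\<lambda>i. real (\<sigma> i) - real i" borel n] by simp
  have "permute_cells n \<sigma> \<in> borel_measurable unit_measure"
    unfolding permute_cells_def by measurable
  then show ?thesis
    unfolding unit_measure_def
    by (subst measurable_restrict_space2_iff)
       (use cell_index_permute_cells(1)[OF assms] in \<open>auto simp: unit_measure_def space_restrict_space\<close>)
qed

text \<open>On each cell the map is a translation, which preserves \<open>lborel\<close>; the
  contributions of the cells are merely summed in another order.\<close>

lemma emeasure_permute_cells:
  assumes n: "n > 0" and \<sigma>: "\<sigma> permutes {1..n}" and A: "A \<in> sets unit_measure"
  shows "emeasure unit_measure (permute_cells n \<sigma> -` A \<inter> {0..1}) = emeasure unit_measure A"
proof -
  let ?f = "permute_cells n \<sigma>"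
  define B where "B = ?f -` A \<inter> {0..1}"
  have B: "B \<in> sets unit_measure"
    using measurable_sets[OF permute_cells_measurable[OF n \<sigma>] A] by (simp add: B_def)
  have split: "emeasure unit_measure X = (\<Sum>i=1..n. emeasure unit_measure (X \<inter> cell n i))"
    if X: "X \<in> sets unit_measure" for X
  proof -
    have "X = (\<Union>i\<in>{..n}. X \<inter> cell n i)"
      using X cell_index_le by (auto simp: sets_unit_measure_borel cell_def)
    then have "emeasure unit_measure X = emeasure unit_measure (\<Union>i\<in>{..n}. X \<inter> cell n i)" by simp
    also have "\<dots> = (\<Sum>i\<le>n. emeasure unit_measure (X \<inter> cell n i))"
      by (rule sum_emeasure[symmetric])
         (use X in \<open>auto simp: disjoint_family_on_def intro!: sets.Int cell_sets, auto simp: cell_def\<close>)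
    also have "{..n} = insert 0 {1..n}" by auto
    also have "(\<Sum>i\<in>\<dots>. emeasure unit_measure (X \<inter> cell n i)) = (\<Sum>i=1..n. emeasure unit_measure (X \<inter> cell n i))"
      using measure_Int_cell_0[OF n, of X] by (simp add: unit_measure.emeasure_eq_measure)
    finally show ?thesis .
  qed
  have piece: "emeasure unit_measure (B \<inter> cell n i) = emeasure unit_measure (A \<inter> cell n (\<sigma> i))"
    if i: "i \<in> {1..n}" for i
  proof -
    define d where "d = (real (\<sigma> i) - real i) / n"
    have si: "\<sigma> i \<in> {1..n}" using i permutes_in_image[OF \<sigma>] by blast
    have A': "A \<inter> cell n (\<sigma> i) \<in> sets unit_measure" using A by simp
    have fx: "?f x = d + x" if "x \<in> cell n i" for x
      using that by (simp add: permute_cells_def cell_def d_def)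
    have cd: "d + x \<in> cell n (\<sigma> i) \<longleftrightarrow> x \<in> cell n i" for x
      using n by (auto simp: cell_iff[OF n i] cell_iff[OF n si] d_def distrib_left)
    have sub: "cell n i \<subseteq> {0..1}" by (auto simp: cell_def)
    have BA: "B \<inter> cell n i = (\<lambda>x. d + x) -` (A \<inter> cell n (\<sigma> i))"
    proof (intro set_eqI iffI)
      fix x assume "x \<in> B \<inter> cell n i"
      then show "x \<in> (\<lambda>x. d + x) -` (A \<inter> cell n (\<sigma> i))" using fx cd by (auto simp: B_def)
    next
      fix x assume "x \<in> (\<lambda>x. d + x) -` (A \<inter> cell n (\<sigma> i))"
      then have "x \<in> cell n i" "d + x \<in> A" using cd by auto
      then show "x \<in> B \<inter> cell n i" using fx sub by (auto simp: B_def)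
    qed
    have trans: "emeasure lborel ((\<lambda>x. d + x) -` X) = emeasure lborel X" if "X \<in> sets borel" for X :: "real set"
    proof -
      have "emeasure lborel X = emeasure (distr lborel borel ((+) d)) X"
        by (simp add: lborel_distr_plus)
      also have "\<dots> = emeasure lborel ((+) d -` X)"
        using that by (subst emeasure_distr) auto
      finally show ?thesis by simp
    qed
    have "emeasure unit_measure (B \<inter> cell n i) = emeasure lborel (B \<inter> cell n i)"
      by (rule emeasure_unit_measure) (use B in simp)
    also have "\<dots> = emeasure lborel (A \<inter> cell n (\<sigma> i))"
      unfolding BA by (rule trans) (use A' sets_unit_measure_borel in blast)
    also have "\<dots> = emeasure unit_measure (A \<inter> cell n (\<sigma> i))"
      by (rule emeasure_unit_measure[OF A', symmetric])
    finally show ?thesis .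
  qed
  have "emeasure unit_measure B = (\<Sum>i=1..n. emeasure unit_measure (A \<inter> cell n (\<sigma> i)))"
    unfolding split[OF B] by (rule sum.cong) (use piece in auto)
  also have "\<dots> = (\<Sum>i=1..n. emeasure unit_measure (A \<inter> cell n i))"
    by (rule sum.permute[OF \<sigma>, symmetric, unfolded o_def])
  also have "\<dots> = emeasure unit_measure A" using split[OF A] by simp
  finally show ?thesis by (simp add: B_def)
qed

lemma permute_cells_mpb:
  assumes n: "n > 0" and \<sigma>: "\<sigma> permutes {1..n}"
  shows "permute_cells n \<sigma> \<in> measure_preserving_bij"
proof -
  let ?f = "permute_cells n \<sigma>" and ?g = "permute_cells n (inv \<sigma>)"
  have \<sigma>': "inv \<sigma> permutes {1..n}" using permutes_inv[OF \<sigma>] .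
  have gf: "?g (?f x) = x" if "x \<in> {0..1}" for x
    using permute_cells_inverse[OF n \<sigma> that] .
  have fg: "?f (?g x) = x" if "x \<in> {0..1}" for x
    using permute_cells_inverse[OF n \<sigma>' that] by (simp add: permutes_inv_inv[OF \<sigma>])
  have b: "bij_betw ?f {0..1} {0..1}"
    by (rule bij_betw_byWitness[where f' = ?g])
       (use gf fg cell_index_permute_cells(1)[OF n \<sigma>] cell_index_permute_cells(1)[OF n \<sigma>'] in auto)
  have "the_inv_into {0..1} ?f x = ?g x" if "x \<in> {0..1}" for x
    by (rule the_inv_into_f_eq[OF bij_betw_imp_inj_on[OF b] fg[OF that] cell_index_permute_cells(1)[OF n \<sigma>' that]])
  then have "the_inv_into {0..1} ?f \<in> unit_measure \<rightarrow>\<^sub>M unit_measure \<longleftrightarrow> ?g \<in> unit_measure \<rightarrow>\<^sub>M unit_measure"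
    by (intro measurable_cong) auto
  then have "the_inv_into {0..1} ?f \<in> unit_measure \<rightarrow>\<^sub>M unit_measure"
    using permute_cells_measurable[OF n \<sigma>'] by simp
  moreover have "distr unit_measure unit_measure ?f = unit_measure"
    by (rule measure_eqI)
       (use emeasure_permute_cells[OF n \<sigma>] permute_cells_measurable[OF n \<sigma>] in
         \<open>auto simp: emeasure_distr\<close>)
  ultimately show ?thesis
    using b permute_cells_measurable[OF n \<sigma>] by (simp add: measure_preserving_bij_def)
qed

text \<open>Renumbering the steps costs nothing, so the blocks of a partition may be arranged
  consecutively.\<close>

lemma cut_dist_permute_step:
  assumes "n > 0" "\<sigma> permutes {1..n}" "\<And>i j. a i j = a j i" "\<And>i j. a i j \<in> {0..1}"
  shows "cut_dist (step n (\<lambda>i j. a (\<sigma> i) (\<sigma> j))) (step n a) = 0"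
proof (rule antisym)
  have g: "step n (\<lambda>i j. a (\<sigma> i) (\<sigma> j)) \<in> graphons" "step n a \<in> graphons"
    using assms by (auto intro!: step_graphon)
  have "cut_dist (step n (\<lambda>i j. a (\<sigma> i) (\<sigma> j))) (step n a) \<le> cut_norm (\<lambda>x y. step n (\<lambda>i j. a (\<sigma> i) (\<sigma> j)) x y
      - step n a (permute_cells n \<sigma> x) (permute_cells n \<sigma> y))"
    by (rule cut_dist_upper[OF g permute_cells_mpb[OF assms(1,2)]])
  also have "\<dots> = cut_norm (\<lambda>x y. 0)"
    by (rule cut_norm_cong) (simp add: step_def cell_index_permute_cells(2)[OF assms(1,2)])
  finally show "cut_dist (step n (\<lambda>i j. a (\<sigma> i) (\<sigma> j))) (step n a) \<le> 0" by (simp add: cut_norm_zero)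
  show "0 \<le> cut_dist (step n (\<lambda>i j. a (\<sigma> i) (\<sigma> j))) (step n a)" using g by (rule cut_dist_nonneg)
qed

subsection \<open>Approximation by step functions\<close>

lemma measurable_unit_square_borel: "(\<lambda>p. p) \<in> unit_square \<rightarrow>\<^sub>M borel"
proof -
  have "(\<lambda>p. (fst p, snd p)) \<in> unit_square \<rightarrow>\<^sub>M borel \<Otimes>\<^sub>M borel"
    by (intro measurable_Pair measurable_compose[OF measurable_fst measurable_unit_measure_real]
        measurable_compose[OF measurable_snd measurable_unit_measure_real])
  then show ?thesis by (simp add: borel_prod)
qed

text \<open>Fubini carries null sets of the plane to the product of the restricted measures;
  measurability of \<open>N\<close> turns the iterated statement back into one about pairs.\<close>

lemma AE_unit_square_lborel:
  assumes "AE p in lborel. (p :: real \<times> real) \<notin> N" "N \<in> sets borel"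
  shows "AE p in unit_square. p \<notin> N"
proof -
  have "AE p in lborel \<Otimes>\<^sub>M lborel. (p :: real \<times> real) \<notin> N"
    using assms(1) by (subst lborel_prod)
  then have "AE x in lborel. AE y in lborel. (x :: real, y :: real) \<notin> N"
    by (rule lborel_pair.AE_pair)
  then have "AE x in unit_measure. AE y in unit_measure. (x, y) \<notin> N"
    unfolding unit_measure_def by (simp add: AE_restrict_space_iff) (auto elim!: eventually_mono)
  moreover have "{p \<in> space unit_square. (fst p, snd p) \<notin> N} \<in> sets unit_square"
  proof -
    from measurable_sets[OF measurable_unit_square_borel, of "- N"] assms(2) 
    have "(\<lambda>p. p) -` (- N) \<inter> space unit_square \<in> sets unit_square" by auto
    moreover have "(\<lambda>p. p) -` (- N) \<inter> space unit_square = {p \<in> space unit_square. (fst p, snd p) \<notin> N}"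
      by auto
    ultimately show ?thesis by simp
  qed
  ultimately show ?thesis
    using unit_square.AE_pair_iff[of "\<lambda>x y. (x, y) \<notin> N"] by simp
qed

lemma L1norm_triangle:
  assumes "bounded_kernel D" "bounded_kernel E"
  shows "L1norm (\<lambda>x y. D x y + E x y) \<le> L1norm D + L1norm E"
proof -
  have "L1norm (\<lambda>x y. D x y + E x y) \<le> (LINT p | unit_square. \<bar>D (fst p) (snd p)\<bar> + \<bar>E (fst p) (snd p)\<bar>)"
    unfolding L1norm_def
    by (rule integral_mono)
       (use kernel_integrable[OF assms(1)] kernel_integrable[OF assms(2)] in
         \<open>auto intro!: Bochner_Integration.integrable_add integrable_abs abs_triangle_ineq\<close>)
  also have "\<dots> = L1norm D + L1norm E"
    unfolding L1norm_def
    by (intro Bochner_Integration.integral_add integrable_abs kernel_integrable assms)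
  finally show ?thesis .
qed

lemma L1norm_transpose:
  assumes "bounded_kernel D" shows "L1norm (\<lambda>x y. D y x) = L1norm D"
  using unit_square.integral_product_swap[OF borel_measurable_abs[OF kernel_measurable[OF assms]]]
  by (simp add: L1norm_def case_prod_unfold)

lemma kernel_transpose:
  assumes "bounded_kernel D" shows "bounded_kernel (\<lambda>x y. D y x)"
proof -
  obtain B where B: "\<forall>x\<in>{0..1}. \<forall>y\<in>{0..1}. \<bar>D x y\<bar> \<le> B"
    using assms unfolding bounded_kernel_def by blast
  have "(\<lambda>p. D (snd p) (fst p)) \<in> borel_measurable unit_square"
    using measurable_compose[OF measurable_pair_swap' kernel_measurable[OF assms]] 
    by (simp add: case_prod_unfold)
  then show ?thesis by (rule kernelI[where B = B]) (use B in auto)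
qed

lemma L1norm_cmult: "L1norm (\<lambda>x y. c * D x y) = \<bar>c\<bar> * L1norm D"
  by (simp add: L1norm_def abs_mult)

lemma L1norm_cong:
  assumes "\<And>x y. x \<in> {0..1} \<Longrightarrow> y \<in> {0..1} \<Longrightarrow> \<bar>D x y\<bar> = \<bar>E x y\<bar>" shows "L1norm D = L1norm E"
  unfolding L1norm_def by (rule Bochner_Integration.integral_cong) (use assms in auto)

text \<open>A measurable function on the plane is an almost everywhere limit of continuous ones.
  Clamping these to [0,1] provides a dominating function and keeps the limit, whose values lie in
  [0,1] anyway.\<close>

lemma continuous_approximation:
  assumes W: "W \<in> graphons" and e: "e > 0"
  obtains g :: "real \<times> real \<Rightarrow> real" where "continuous_on UNIV g" "\<And>p. g p \<in> {0..1}"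
    "L1norm (\<lambda>x y. W x y - g (x, y)) < e"
proof -
  define Q :: "(real \<times> real) set" where "Q = {0..1} \<times> {0..1}"
  \<comment> \<open>Extension by 0, so that results about functions on the whole plane
    apply.\<close>
  define F where "F p = (if p \<in> Q then W (fst p) (snd p) else 0)" for p
  have Feq: "F = (\<lambda>p. indicator Q p *\<^sub>R W (fst p) (snd p))" by (auto simp: F_def)
  have Q: "Q \<in> sets borel" unfolding Q_def by (intro borel_closed closed_Times) auto
  \<comment> \<open>The product of the restricted sigma-algebras is the planar Borel sigma-algebra
    restricted to the square; this makes \<open>F\<close> Borel measurable.\<close>
  have sets_sub: "sets (restrict_space (borel :: (real \<times> real) measure) Q) = sets unit_square"
  proof
    show "sets (restrict_space borel Q) \<subseteq> sets unit_square"
    proof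
      fix X assume "X \<in> sets (restrict_space borel Q)"
      then obtain Y where Y: "Y \<in> sets borel" "X = Q \<inter> Y" by (auto simp: sets_restrict_space)
      from measurable_sets[OF measurable_unit_square_borel Y(1)] show "X \<in> sets unit_square"
        unfolding Y(2) Q_def by (simp add: Int_commute)
    qed
    have "(\<lambda>p. p) \<in> restrict_space borel Q \<rightarrow>\<^sub>M unit_square"
    proof -
      have f: "fst \<in> restrict_space borel Q \<rightarrow>\<^sub>M unit_measure" "snd \<in> restrict_space borel Q \<rightarrow>\<^sub>M unit_measure"
        unfolding unit_measure_def
        by (rule measurable_restrict_space2;
            force simp: Q_def space_restrict_space intro!: measurable_restrict_space1 borel_measurable_continuous_onI continuous_intros)+
      show ?thesis using measurable_Pair[OF f] by simp
    qed
    then show "sets unit_square \<subseteq> sets (restrict_space borel Q)"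
      using sets.sets_into_space[of _ unit_square]
      by (auto dest!: measurable_sets[of _ _ unit_square] simp: space_restrict_space Q_def Int_absorb2)
  qed
  have "(\<lambda>p. W (fst p) (snd p)) \<in> borel_measurable (restrict_space borel Q)"
    using kernel_measurable[OF graphon_kernel[OF W]] sets_sub by (simp cong: measurable_cong_sets)
  then have "F \<in> borel_measurable borel"
    using Q borel_measurable_restrict_space_iff[of Q borel "\<lambda>p. W (fst p) (snd p)"] Feq by simp
  then have "F \<in> borel_measurable lebesgue" by (intro measurable_completion) simp
  then have "F measurable_on UNIV" by (rule lebesgue_measurable_imp_measurable_on_real) simp
  then obtain N g where N: "negligible N" and g: "\<And>n. continuous_on UNIV (g n)"
    "\<And>p. p \<notin> N \<Longrightarrow> (\<lambda>n. g n p) \<longlonglongrightarrow> F p"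
    unfolding measurable_on_def by auto
  define c where "c n p = max 0 (min 1 (g n p))" for n p
  have c01: "c n p \<in> {0..1}" for n p by (simp add: c_def)
  have cc: "continuous_on UNIV (c n)" for n unfolding c_def by (intro continuous_intros g)
  have "AE p in lebesgue. p \<notin> N" using N by (simp add: negligible_iff_null_sets AE_not_in)
  then have "AE p in lborel. p \<notin> N" by (simp add: AE_completion_iff)
  \<comment> \<open>\<open>N\<close> need not be Borel, so it is enlarged to a Borel null
    set.\<close>
  then obtain N' where N0: "\<And>p. p \<in> space lborel - N' \<Longrightarrow> p \<notin> N" "N' \<in> null_sets lborel"
    by (rule AE_E3) blast
  have N': "N' \<in> sets borel" "N \<subseteq> N'" "AE p in lborel. p \<notin> N'"
    using N0 AE_not_in[OF N0(2)] by (auto simp: null_sets_def)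
  have "(\<lambda>n. LINT p | unit_square. \<bar>W (fst p) (snd p) - c n p\<bar>) \<longlonglongrightarrow> (LINT p | unit_square. 0)"
  proof (rule integral_dominated_convergence[where w = "\<lambda>_. 1"])
    have cm: "c n \<in> borel_measurable unit_square" for n
    proof -
      from measurable_compose[OF measurable_unit_square_borel borel_measurable_continuous_onI[OF cc]] show ?thesis .
    qed
    show "(\<lambda>p. \<bar>W (fst p) (snd p) - c n p\<bar>) \<in> borel_measurable unit_square" for n
      by (intro borel_measurable_abs borel_measurable_diff cm kernel_measurable graphon_kernel W)
    show "AE p in unit_square. (\<lambda>n. \<bar>W (fst p) (snd p) - c n p\<bar>) \<longlonglongrightarrow> 0"
      using AE_space AE_unit_square_lborel[OF N'(3,1)]
    proof eventually_elim
      case (elim p)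
      then have p: "fst p \<in> {0..1}" "snd p \<in> {0..1}" "p \<in> Q" "p \<notin> N" using N' by (auto simp: Q_def)
      have "(\<lambda>n. c n p) \<longlonglongrightarrow> max 0 (min 1 (F p))"
        unfolding c_def by (intro tendsto_intros g p)
      also have "max 0 (min 1 (F p)) = W (fst p) (snd p)"
        using graphon_bounds[OF W p(1,2)] p(3) by (simp add: F_def)
      finally have "(\<lambda>n. \<bar>W (fst p) (snd p) - c n p\<bar>) \<longlonglongrightarrow> \<bar>W (fst p) (snd p) - W (fst p) (snd p)\<bar>"
        by (intro tendsto_intros)
      then show ?case by simp
    qed
    show "AE p in unit_square. norm \<bar>W (fst p) (snd p) - c n p\<bar> \<le> 1" for n
    proof (rule AE_I2)
      fix p assume "p \<in> space unit_square"
      then show "norm \<bar>W (fst p) (snd p) - c n p\<bar> \<le> 1"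
        using graphon_bounds[OF W, of "fst p" "snd p"] c01[of n p] by (auto simp: abs_if)
    qed
  qed (auto intro: unit_square.P.integrable_const)
  then have "\<forall>\<^sub>F n in sequentially. L1norm (\<lambda>x y. W x y - c n (x, y)) < e"
    using e order_tendstoD(2)[of _ 0 sequentially e] by (simp add: L1norm_def)
  then obtain n where "L1norm (\<lambda>x y. W x y - c n (x, y)) < e"
    using eventually_happens'[OF sequentially_bot] by blast
  then show ?thesis using that[OF cc c01] by blast
qed

text \<open>By uniform continuity a sufficiently fine grid works. Taking \<open>n\<close> as a
  multiple of \<open>M\<close> aligns it with the coarse grid of
  \<open>graphons_finite_net\<close>.\<close>

lemma step_approximation:
  assumes W: "W \<in> graphons" and e: "e > 0" and M: "M > (0::nat)"
  obtains n a where "n > 0" "M dvd n" "\<And>i j. a i j = a j i" "\<And>i j. a i j \<in> {0..1}"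
    "L1norm (\<lambda>x y. W x y - step n a x y) < e"
proof -
  obtain g :: "real \<times> real \<Rightarrow> real" where g: "continuous_on UNIV g" "\<And>p. g p \<in> {0..1}"
    "L1norm (\<lambda>x y. W x y - g (x, y)) < e / 2"
    using continuous_approximation[OF W, of "e / 2"] e by auto
  have "uniformly_continuous_on ({0..1} \<times> {0..1}) g"
    by (rule compact_uniformly_continuous) (auto intro: continuous_on_subset[OF g(1)] compact_Times)
  then obtain d where d: "d > 0" "\<And>p q. p \<in> {0..1} \<times> {0..1} \<Longrightarrow> q \<in> {0..1} \<times> {0..1} \<Longrightarrow>
      dist q p < d \<Longrightarrow> dist (g q) (g p) < e / 2"
    unfolding uniformly_continuous_on_def using e by (metis half_gt_zero)
  obtain L :: nat where L: "2 / d < L" using reals_Archimedean2 by blast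
  have Lp: "L > 0" using L d(1) by (cases "L = 0") (auto simp: divide_less_0_iff)
  define n where "n = M * L"
  have n: "n > 0" "2 / d < n"
    using M Lp L by (auto simp: n_def) (metis One_nat_def Suc_leI L less_le_trans mult_le_mono1 nat_mult_1 of_nat_le_iff of_nat_mult)
  \<comment> \<open>\<open>b\<close> samples a continuous function that need not be symmetric;
    averaging with the transpose repairs this without loss, because \<open>W\<close> is
    symmetric.\<close>
  define b where "b i j = g (real i / n, real j / n)" for i j :: nat
  define a where "a i j = (b i j + b j i) / 2" for i j
  have near: "\<bar>x - real (cell_index n x) / n\<bar> \<le> 1 / n" "real (cell_index n x) / n \<in> {0..1}"
    if "x \<in> {0..1}" for x
  proof -
    have "real (cell_index n x) = real_of_int \<lceil>real n * x\<rceil>"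
      using that by (simp add: cell_index_def)
    then have le: "real n * x \<le> real (cell_index n x)" "real (cell_index n x) \<le> real n * x + 1"
      using ceiling_correct[of "real n * x"] by linarith+
    show "\<bar>x - real (cell_index n x) / n\<bar> \<le> 1 / n"
    proof -
      have "x = real n * x / n" using n(1) by simp
      then have "\<bar>x - real (cell_index n x) / n\<bar> = \<bar>real n * x - real (cell_index n x)\<bar> / n"
        by (metis abs_divide abs_of_nat diff_divide_distrib)
      also have "\<dots> \<le> 1 / n" using le by (intro divide_right_mono) auto
      finally show ?thesis .
    qed
    show "real (cell_index n x) / n \<in> {0..1}"
      using cell_index_le[OF that, of n] n(1) by simp
  qed
  have gb: "\<bar>g (x, y) - step n b x y\<bar> \<le> e / 2" if "x \<in> {0..1}" "y \<in> {0..1}" for x y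
  proof -
    let ?q = "(real (cell_index n x) / n, real (cell_index n y) / n)"
    have "dist (x, y) ?q \<le> dist x (fst ?q) + dist y (snd ?q)"
      unfolding dist_Pair_Pair by (simp add: sqrt_sum_squares_le_sum)
    also have "\<dots> \<le> 1 / n + 1 / n" using near(1)[OF that(1)] near(1)[OF that(2)] by (simp add: dist_real_def)
    also have "\<dots> < d" using n d(1) by (simp add: field_simps)
    finally have "dist (g (x, y)) (g ?q) < e / 2"
      using d(2)[of ?q "(x, y)"] near(2) that by auto
    then show ?thesis by (simp add: dist_real_def step_def b_def)
  qed
  have gk: "bounded_kernel (\<lambda>x y. g (x, y))"
  proof (rule kernelI[where B = 1])
    from measurable_compose[OF measurable_unit_square_borel borel_measurable_continuous_onI[OF g(1)]]
    show "(\<lambda>p. g (fst p, snd p)) \<in> borel_measurable unit_square" by simp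
  qed (use g(2) in \<open>auto simp: abs_le_iff intro: order_trans[of _ 0]\<close>)
  note Wk = graphon_kernel[OF W]
  have "L1norm (\<lambda>x y. g (x, y) - step n b x y) \<le> (LINT p | unit_square. e / 2)"
    unfolding L1norm_def
    by (rule integral_mono)
       (use gb kernel_integrable[OF kernel_diff[OF gk step_kernel]] in
         \<open>auto intro!: integrable_abs unit_square.P.integrable_const\<close>)
  then have "L1norm (\<lambda>x y. g (x, y) - step n b x y) \<le> e / 2" using unit_square.P.prob_space by simp
  then have b: "L1norm (\<lambda>x y. W x y - step n b x y) < e"
    using L1norm_triangle[OF kernel_diff[OF Wk gk] kernel_diff[OF gk step_kernel], of n b] g(3) by simp
  let ?D = "\<lambda>x y. W x y - step n b x y"
  have Dk: "bounded_kernel ?D" by (rule kernel_diff[OF Wk step_kernel])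
  have "L1norm (\<lambda>x y. W x y - step n a x y) = L1norm (\<lambda>x y. (1/2) * ?D x y + (1/2) * ?D y x)"
  proof (rule L1norm_cong)
    fix x y :: real assume xy: "x \<in> {0..1}" "y \<in> {0..1}"
    have "W x y - step n a x y = (1/2) * ?D x y + (1/2) * ?D y x"
      using graphon_sym[OF W xy] by (simp add: step_def a_def field_simps)
    then show "\<bar>W x y - step n a x y\<bar> = \<bar>(1/2) * ?D x y + (1/2) * ?D y x\<bar>" by (rule arg_cong)
  qed
  also have "\<dots> \<le> (1/2) * L1norm ?D + (1/2) * L1norm (\<lambda>x y. ?D y x)"
    using L1norm_triangle[OF kernel_cmult[OF Dk, of "1/2"] kernel_cmult[OF kernel_transpose[OF Dk], of "1/2"]]
      L1norm_cmult[of "1/2" ?D] L1norm_cmult[of "1/2" "\<lambda>x y. ?D y x"] by simp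
  also have "\<dots> = L1norm ?D" using L1norm_transpose[OF Dk] by simp
  finally have "L1norm (\<lambda>x y. W x y - step n a x y) < e" using b by simp
  moreover have "a i j \<in> {0..1}" for i j
    using g(2)[of "(real i / n, real j / n)"] g(2)[of "(real j / n, real i / n)"] by (auto simp: a_def b_def)
  ultimately show ?thesis using that[of n a] n(1) by (auto simp: n_def a_def)
qed

subsection \<open>Weak regularity\<close>

text \<open>The conditional expectation of \<open>U\<close> given \<open>d\<close> under the uniform
  distribution on \<open>P\<close>, as a function of the value \<open>v\<close>. An empty fibre gets
  0.\<close>

definition cell_avg :: "'a set \<Rightarrow> ('a \<Rightarrow> 'b) \<Rightarrow> ('a \<Rightarrow> real) \<Rightarrow> 'b \<Rightarrow> real" where
  "cell_avg P d U v = (\<Sum>p | p \<in> P \<and> d p = v. U p) / card {p \<in> P. d p = v}"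

text \<open>The defining property of conditional expectation: \<open>h\<close> is constant on the
  fibres of \<open>d\<close>, so \<open>U\<close> may be replaced by its averages when tested
  against \<open>h\<close>.\<close>

lemma sum_cell_avg:
  fixes h :: "'a \<Rightarrow> real"
  assumes P: "finite P" and h: "\<And>p q. p \<in> P \<Longrightarrow> q \<in> P \<Longrightarrow> d p = d q \<Longrightarrow> h p = h q"
  shows "(\<Sum>p\<in>P. cell_avg P d U (d p) * h p) = (\<Sum>p\<in>P. U p * h p)"
proof -
  have "(\<Sum>p | p \<in> P \<and> d p = v. cell_avg P d U (d p) * h p) = (\<Sum>p | p \<in> P \<and> d p = v. U p * h p)"
    if "v \<in> d ` P" for v
  proof -
    obtain q where q: "q \<in> P" "d q = v" using \<open>v \<in> d ` P\<close> by blast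
    have c: "card {p \<in> P. d p = v} > 0" using P q by (auto simp: card_gt_0_iff)
    have "(\<Sum>p | p \<in> P \<and> d p = v. cell_avg P d U (d p) * h p)
        = (\<Sum>p | p \<in> P \<and> d p = v. cell_avg P d U v * h q)"
      using q by (intro sum.cong) (auto intro: h)
    also have "\<dots> = (\<Sum>p | p \<in> P \<and> d p = v. U p) * h q"
      using c by (simp add: cell_avg_def)
    also have "\<dots> = (\<Sum>p | p \<in> P \<and> d p = v. U p * h p)"
      unfolding sum_distrib_right using q by (intro sum.cong) (auto intro: h)
    finally show ?thesis .
  qed
  then have "(\<Sum>v\<in>d ` P. \<Sum>p | p \<in> P \<and> d p = v. cell_avg P d U (d p) * h p)
     = (\<Sum>v\<in>d ` P. \<Sum>p | p \<in> P \<and> d p = v. U p * h p)"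
    by (rule sum.cong[OF refl])
  then show ?thesis by (simp only: sum.image_gen[OF P, of _ d, symmetric])
qed

lemma cell_avg_bounds:
  assumes "finite P" "\<And>p. p \<in> P \<Longrightarrow> U p \<in> {0..1}" shows "cell_avg P d U v \<in> {0..1}"
proof -
  have "(\<Sum>p | p \<in> P \<and> d p = v. U p) \<le> (\<Sum>p | p \<in> P \<and> d p = v. 1)"
    by (rule sum_mono) (use assms in auto)
  moreover have "0 \<le> (\<Sum>p | p \<in> P \<and> d p = v. U p)" by (rule sum_nonneg) (use assms in auto)
  ultimately show ?thesis by (auto simp: cell_avg_def divide_le_eq_1)
qed

text \<open>The squared norm of the conditional expectation, the potential function of regularity
  lemmas; it cannot decrease when \<open>d\<close> is refined.\<close>

definition energy :: "'a set \<Rightarrow> ('a \<Rightarrow> 'b) \<Rightarrow> ('a \<Rightarrow> real) \<Rightarrow> real" where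
  "energy P d U = (\<Sum>p\<in>P. (cell_avg P d U (d p))\<^sup>2)"

lemma energy_le_card:
  assumes "finite P" "\<And>p. p \<in> P \<Longrightarrow> U p \<in> {0..1}" shows "energy P d U \<le> card P"
proof -
  have "energy P d U \<le> (\<Sum>p\<in>P. 1)"
    unfolding energy_def
  proof (rule sum_mono)
    fix p
    show "(cell_avg P d U (d p))\<^sup>2 \<le> 1"
      using cell_avg_bounds[of P U d "d p", OF assms] by (simp add: power_le_one)
  qed
  then show ?thesis by simp
qed

text \<open>By Pythagoras, refining gains the squared distance between the two averages.
  Cauchy-Schwarz against the indicator of \<open>X\<close>, a union of fibres of \<open>d'\<close>,
  bounds that distance from below.\<close>

lemma energy_increment:
  fixes \<epsilon> :: real
  assumes P: "finite P" "P \<noteq> {}" and X: "X \<subseteq> P"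
    and ref: "\<And>p q. p \<in> P \<Longrightarrow> q \<in> P \<Longrightarrow> d' p = d' q \<Longrightarrow> d p = d q \<and> (p \<in> X \<longleftrightarrow> q \<in> X)"
    and dev: "\<bar>\<Sum>p\<in>X. U p - cell_avg P d U (d p)\<bar> > \<epsilon> * card P" and \<epsilon>: "\<epsilon> > 0"
  shows "energy P d U + \<epsilon>\<^sup>2 * card P \<le> energy P d' U"
proof -
  let ?e = "\<lambda>p. cell_avg P d' U (d' p)" and ?f = "\<lambda>p. cell_avg P d U (d p)"
  let ?x = "\<lambda>p. if p \<in> X then 1 else 0 :: real"
  have "(\<Sum>p\<in>X. U p - ?f p) = (\<Sum>p\<in>P. U p * ?x p - ?f p * ?x p)"
    by (rule sum.mono_neutral_cong_left) (use P X in auto)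
  also have "\<dots> = (\<Sum>p\<in>P. U p * ?x p) - (\<Sum>p\<in>P. ?f p * ?x p)" by (rule sum_subtractf)
  also have "(\<Sum>p\<in>P. U p * ?x p) = (\<Sum>p\<in>P. ?e p * ?x p)"
  proof (rule sum_cell_avg[OF P(1), symmetric])
    fix p q assume "p \<in> P" "q \<in> P" "d' p = d' q"
    from ref[OF this] show "?x p = ?x q" by simp
  qed
  finally have "(\<Sum>p\<in>X. U p - ?f p) = (\<Sum>p\<in>P. (?e p - ?f p) * ?x p)"
    by (simp only: sum_subtractf left_diff_distrib)
  then have "\<epsilon> * card P < \<bar>\<Sum>p\<in>P. (?e p - ?f p) * ?x p\<bar>"
    using dev by simp
  then have "(\<epsilon> * card P)\<^sup>2 < \<bar>\<Sum>p\<in>P. (?e p - ?f p) * ?x p\<bar>\<^sup>2"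
    using \<epsilon> by (intro power_strict_mono) auto
  then have "(\<epsilon> * card P)\<^sup>2 < (\<Sum>p\<in>P. (?e p - ?f p) * ?x p)\<^sup>2"
    by (simp only: power2_abs)
  also have "\<dots> \<le> (\<Sum>p\<in>P. (?e p - ?f p)\<^sup>2) * (\<Sum>p\<in>P. (?x p)\<^sup>2)"
    by (rule Cauchy_Schwarz_ineq_sum)
  also have "(\<Sum>p\<in>P. (?x p)\<^sup>2) \<le> (\<Sum>p\<in>P. 1)" by (rule sum_mono) auto
  finally have "(\<epsilon> * card P)\<^sup>2 < (\<Sum>p\<in>P. (?e p - ?f p)\<^sup>2) * card P"
    by (simp add: mult_left_mono sum_nonneg)
  then have "\<epsilon>\<^sup>2 * card P * card P < (\<Sum>p\<in>P. (?e p - ?f p)\<^sup>2) * card P"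
    by (simp add: power2_eq_square mult_ac)
  then have 1: "\<epsilon>\<^sup>2 * card P < (\<Sum>p\<in>P. (?e p - ?f p)\<^sup>2)"
    by (simp add: mult_less_cancel_right_disj)
  \<comment> \<open>Orthogonality: \<open>?f\<close> is constant on the fibres of both
    \<open>d'\<close> and \<open>d\<close>, so \<open>?e\<close> may be replaced by
    \<open>U\<close>, and then \<open>U\<close> by \<open>?f\<close>.\<close>
  have "(\<Sum>p\<in>P. ?e p * ?f p) = (\<Sum>p\<in>P. U p * ?f p)"
  proof (rule sum_cell_avg[OF P(1)])
    fix p q assume "p \<in> P" "q \<in> P" "d' p = d' q"
    from ref[OF this] show "?f p = ?f q" by simp
  qed
  also have "\<dots> = (\<Sum>p\<in>P. ?f p * ?f p)"
    by (rule sum_cell_avg[OF P(1), symmetric]) auto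
  finally have "(\<Sum>p\<in>P. (?e p - ?f p)\<^sup>2) = energy P d' U - energy P d U"
    by (simp add: energy_def power2_diff sum.distrib sum_subtractf sum_distrib_left[symmetric] mult.assoc)
       (simp add: power2_eq_square)
  then show ?thesis using 1 by simp
qed

definition pairs :: "nat \<Rightarrow> (nat \<times> nat) set" where
  "pairs n = {1..n} \<times> {1..n}"

definition block_avg :: "nat \<Rightarrow> (nat \<Rightarrow> nat) \<Rightarrow> (nat \<Rightarrow> nat \<Rightarrow> real) \<Rightarrow> nat \<Rightarrow> nat \<Rightarrow> real" where
  "block_avg n c U u v = cell_avg (pairs n) (\<lambda>p. (c (fst p), c (snd p))) (\<lambda>p. U (fst p) (snd p)) (u, v)"

lemma finite_pairs [simp]: "finite (pairs n)" and card_pairs [simp]: "card (pairs n) = n\<^sup>2"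
  by (simp_all add: pairs_def power2_eq_square)

lemma block_avg_bounds: "(\<And>i j. U i j \<in> {0..1}) \<Longrightarrow> block_avg n c U u v \<in> {0..1}"
  unfolding block_avg_def by (rule cell_avg_bounds) auto

lemma block_avg_sym:
  assumes "\<And>i j. U i j = U j i" shows "block_avg n c U u v = block_avg n c U v u"
proof -
  have e: "{p \<in> pairs n. (c (fst p), c (snd p)) = (v, u)} = prod.swap ` {p \<in> pairs n. (c (fst p), c (snd p)) = (u, v)}"
    by (auto simp: pairs_def image_iff)
  show ?thesis
    unfolding block_avg_def cell_avg_def e
    by (subst sum.reindex) (use assms in \<open>auto simp: card_image intro!: arg_cong2[of _ _ _ _ "(/)"] sum.cong\<close>)
qed

text \<open>The weak regularity of Frieze and Kannan: closeness in cut norm, tested on index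
  sets.\<close>

definition block_regular :: "nat \<Rightarrow> (nat \<Rightarrow> nat) \<Rightarrow> (nat \<Rightarrow> nat \<Rightarrow> real) \<Rightarrow> real \<Rightarrow> bool" where
  "block_regular n c U \<epsilon> \<longleftrightarrow> (\<forall>A B. A \<subseteq> {1..n} \<longrightarrow> B \<subseteq> {1..n} \<longrightarrow>
     \<bar>\<Sum>i\<in>A. \<Sum>j\<in>B. U i j - block_avg n c U (c i) (c j)\<bar> \<le> \<epsilon> * n\<^sup>2)"

text \<open>A failure of regularity yields sets \<open>A\<close>, \<open>B\<close> that split each
  block into at most four and raise the energy by at least
  \<open>\<epsilon>\<^sup>2 * n\<^sup>2\<close>. The energy never exceeds \<open>n\<^sup>2\<close>,
  so \<open>k > 1 / \<epsilon>\<^sup>2\<close> refinements are impossible and \<open>p = 4^k\<close>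
  works for all \<open>n\<close>.\<close>

lemma weak_regularity:
  fixes \<epsilon> :: real
  assumes \<epsilon>: "\<epsilon> > 0"
  obtains p :: nat where "p > 0" "\<And>n U. n > 0 \<Longrightarrow> (\<And>i j. U i j \<in> {0..1}) \<Longrightarrow>
    \<exists>c. (\<forall>i. c i < p) \<and> block_regular n c U \<epsilon>"
proof -
  obtain k :: nat where k: "1 / \<epsilon>\<^sup>2 < k" using reals_Archimedean2 by blast
  have "\<exists>c. (\<forall>i. c i < 4^k) \<and> block_regular n c U \<epsilon>"
    if n: "n > 0" and U: "\<And>i j. U i j \<in> {0..1}" for n :: nat and U :: "nat \<Rightarrow> nat \<Rightarrow> real"
  proof -
    define d where "d = (\<lambda>c :: nat \<Rightarrow> nat. \<lambda>p. (c (fst p), c (snd p)))"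
    define u where "u = (\<lambda>p. U (fst p) (snd p))"
    have "\<exists>c. (\<forall>i. c i < 4^m) \<and> (block_regular n c U \<epsilon> \<or> m * (\<epsilon>\<^sup>2 * n\<^sup>2) \<le> energy (pairs n) (d c) u)" for m :: nat
    proof (induction m)
      case 0
      show ?case by (rule exI[of _ "\<lambda>_. 0"]) (auto simp: energy_def sum_nonneg)
    next
      case (Suc m)
      then obtain c where c: "\<And>i. c i < 4^m"
        "block_regular n c U \<epsilon> \<or> m * (\<epsilon>\<^sup>2 * n\<^sup>2) \<le> energy (pairs n) (d c) u" by blast
      show ?case
      proof (cases "block_regular n c U \<epsilon>")
        case True
        moreover have "c i < 4 ^ Suc m" for i using c(1)[of i] by simp
        ultimately show ?thesis by blast
      next
        case False
        then obtain A B where AB: "A \<subseteq> {1..n}" "B \<subseteq> {1..n}"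
          "\<bar>\<Sum>i\<in>A. \<Sum>j\<in>B. U i j - block_avg n c U (c i) (c j)\<bar> > \<epsilon> * n\<^sup>2"
          unfolding block_regular_def by (auto simp: not_le)
        \<comment> \<open>The last digit in base 4 records membership in \<open>A\<close> and in
          \<open>B\<close>, the leading digits the old block.\<close>
        define c' where "c' i = 4 * c i + ((if i \<in> A then 2 else 0) + (if i \<in> B then 1 else 0))" for i
        have c'eq: "c i = c j \<and> (i \<in> A \<longleftrightarrow> j \<in> A) \<and> (i \<in> B \<longleftrightarrow> j \<in> B)" if "c' i = c' j" for i j
          using that unfolding c'_def by (auto split: if_splits; presburger)
        have "energy (pairs n) (d c) u + \<epsilon>\<^sup>2 * card (pairs n) \<le> energy (pairs n) (d c') u"
        proof (rule energy_increment[where P = "pairs n" and X = "A \<times> B" and d' = "d c'" and d = "d c" and U = u and \<epsilon> = \<epsilon>])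
          show "pairs n \<noteq> {}" using n by (auto simp: pairs_def)
          show "A \<times> B \<subseteq> pairs n" using AB by (auto simp: pairs_def)
          show "d c p = d c q \<and> (p \<in> A \<times> B \<longleftrightarrow> q \<in> A \<times> B)" if "d c' p = d c' q" for p q
            using that c'eq[of "fst p" "fst q"] c'eq[of "snd p" "snd q"] by (auto simp: d_def mem_Times_iff)
          show "\<epsilon> * card (pairs n) < \<bar>\<Sum>p\<in>A \<times> B. u p - cell_avg (pairs n) (d c) u (d c p)\<bar>"
            using AB(3) by (simp add: sum.cartesian_product block_avg_def d_def u_def case_prod_unfold)
        qed (use \<epsilon> in auto)
        then have "Suc m * (\<epsilon>\<^sup>2 * n\<^sup>2) \<le> energy (pairs n) (d c') u"
          using c(2) False by (simp add: distrib_right)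
        moreover have "c' i < 4 ^ Suc m" for i
          using c(1)[of i] by (simp add: c'_def)
        ultimately show ?thesis by blast
      qed
    qed
    then obtain c where c: "\<forall>i. c i < 4^k"
      "block_regular n c U \<epsilon> \<or> k * (\<epsilon>\<^sup>2 * n\<^sup>2) \<le> energy (pairs n) (d c) u" by blast
    have "energy (pairs n) (d c) u \<le> card (pairs n)"
      by (rule energy_le_card) (use U in \<open>auto simp: u_def\<close>)
    also have "\<dots> < k * (\<epsilon>\<^sup>2 * n\<^sup>2)"
      using k \<epsilon> n by (simp add: field_simps)
    finally show ?thesis using c by auto
  qed
  then show ?thesis by (intro that[of "4^k"]) auto
qed

lemma block_regular_cut_norm:
  assumes "n > 0" "block_regular n c U \<epsilon>"
  shows "cut_norm (\<lambda>x y. step n U x y - step n (\<lambda>i j. block_avg n c U (c i) (c j)) x y) \<le> \<epsilon>"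
proof -
  have "cut_norm (step n (\<lambda>i j. U i j - block_avg n c U (c i) (c j))) \<le> \<epsilon> * n\<^sup>2 / n\<^sup>2"
    by (rule cut_norm_step_le) (use assms in \<open>auto simp: block_regular_def\<close>)
  then show ?thesis using assms(1) by (simp add: step_def[abs_def])
qed

subsection \<open>Total boundedness\<close>

text \<open>After sorting, each block is an interval of indices, so few cells of a coarse grid meet
  more than one block.\<close>

lemma sorting_permutation:
  fixes c :: "nat \<Rightarrow> nat"
  obtains \<sigma> where "\<sigma> permutes {1..n}"
    "\<And>i j. 1 \<le> i \<Longrightarrow> i \<le> j \<Longrightarrow> j \<le> n \<Longrightarrow> c (\<sigma> i) \<le> c (\<sigma> j)"
proof -
  define xs where "xs = sort_key c [1..<Suc n]"
  have len: "length xs = n" and dist: "distinct xs" and set: "set xs = {1..n}"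
    by (auto simp: xs_def)
  have srt: "sorted (map c xs)" by (simp add: xs_def)
  define \<sigma> where "\<sigma> i = (if i \<in> {1..n} then xs ! (i - 1) else i)" for i
  have "bij_betw (\<lambda>i. xs ! (i - 1)) {1..n} {1..n}"
  proof -
    have "bij_betw (\<lambda>i. i - 1) {1..n} {..<n}"
      by (rule bij_betw_byWitness[where f' = Suc]) auto
    moreover have "bij_betw ((!) xs) {..<n} {1..n}"
      using bij_betw_nth[OF dist, of "{..<n}" "{1..n}"] len set by simp
    ultimately show ?thesis using bij_betw_trans by (fastforce simp: o_def)
  qed
  then have "bij_betw \<sigma> {1..n} {1..n}" by (rule bij_betw_cong[THEN iffD1, rotated]) (auto simp: \<sigma>_def)
  then have "\<sigma> permutes {1..n}" by (rule bij_imp_permutes) (auto simp: \<sigma>_def)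
  moreover have "c (\<sigma> i) \<le> c (\<sigma> j)" if "1 \<le> i" "i \<le> j" "j \<le> n" for i j
    using sorted_nth_mono[OF srt, of "i - 1" "j - 1"] that len by (auto simp: \<sigma>_def)
  ultimately show ?thesis using that by blast
qed

lemma cell_index_mult:
  assumes "M > 0" "L > 0" "0 < cell_index M x"
  shows "(cell_index M x - 1) * L + 1 \<le> cell_index (M * L) x" "cell_index (M * L) x \<le> cell_index M x * L"
proof -
  define m where "m = cell_index M x"
  have m: "real m - 1 < real M * x" "real M * x \<le> real m"
    using cell_index_eq_iff[OF assms(1), of m x] assms(3) by (auto simp: m_def)
  have u: "real (M * L) * x \<le> real (m * L)"
    using mult_right_mono[OF m(2), of "real L"] by (simp add: mult_ac)
  have l: "real ((m - 1) * L) < real (M * L) * x"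
    using mult_strict_right_mono[OF m(1), of "real L"] assms by (simp add: mult_ac m_def of_nat_diff)
  show "cell_index (M * L) x \<le> m * L"
    using u by (simp add: cell_index_def ceiling_le_iff nat_le_iff del: of_nat_mult) 
  have "int ((m - 1) * L) < \<lceil>real (M * L) * x\<rceil>"
    using l by (simp add: less_ceiling_iff del: of_nat_mult)
  then have "(m - 1) * L < cell_index (M * L) x" unfolding cell_index_def by linarith
  then show "(m - 1) * L + 1 \<le> cell_index (M * L) x" by simp
qed

lemma cut_dist_le_L1norm:
  assumes "U \<in> graphons" "W \<in> graphons" shows "cut_dist U W \<le> L1norm (\<lambda>x y. U x y - W x y)"
  using cut_dist_le_cut_norm[OF assms] cut_norm_le_L1norm[OF kernel_diff[OF assms[THEN graphon_kernel]]]
  by simp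

text \<open>With sorted blocks, a coarse cell lies in a single block unless its first and last fine
  cells are in different ones. Such bad cells end in distinct blocks, so there are at most
  \<open>p\<close> of them, and they touch at most a fraction \<open>2 * p / M\<close> of the
  square.\<close>

lemma coarsen_sorted_blocks:
  fixes c :: "nat \<Rightarrow> nat" and \<beta> :: "nat \<Rightarrow> nat \<Rightarrow> real"
  assumes M: "M > 0" "L > 0" and c: "\<And>i. c i < p"
    and mono: "\<And>i j. 1 \<le> i \<Longrightarrow> i \<le> j \<Longrightarrow> j \<le> M * L \<Longrightarrow> c i \<le> c j"
    and \<beta>: "\<And>u v. \<beta> u v \<in> {0..1}"
  shows "L1norm (\<lambda>x y. step (M * L) (\<lambda>i j. \<beta> (c i) (c j)) x y - step M (\<lambda>i j. \<beta> (c (i * L)) (c (j * L))) x y)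
    \<le> 2 * real p / M"
proof -
  define bad where "bad = {m \<in> {1..M}. c ((m - 1) * L + 1) \<noteq> c (m * L)}"
  have "inj_on (\<lambda>m. c (m * L)) bad"
  proof (rule linorder_inj_onI')
    fix m m' assume mm: "m \<in> bad" "m' \<in> bad" "m < m'"
    have le: "m * L \<le> (m' - 1) * L" using mm(3) by (intro mult_le_mono1) simp
    have le': "(m' - 1) * L + L = m' * L" using mm(2) by (simp add: bad_def mult_eq_if)
    have leM: "m' * L \<le> M * L" using mm(2) by (intro mult_le_mono1) (simp add: bad_def)
    have "1 \<le> m * L" using mm(1) M(2) by (simp add: bad_def)
    then have "c (m * L) \<le> c ((m' - 1) * L + 1)"
      using le le' leM M(2) by (intro mono) linarith+
    moreover have "c ((m' - 1) * L + 1) \<le> c (m' * L)"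
      using le' leM M(2) by (intro mono) linarith+
    ultimately show "c (m * L) \<noteq> c (m' * L)"
      using mm(2) by (auto simp: bad_def)
  qed
  then have "card bad = card ((\<lambda>m. c (m * L)) ` bad)" by (simp add: card_image)
  also have "\<dots> \<le> card {..<p}" by (intro card_mono) (use c in auto)
  finally have card_bad: "card bad \<le> p" by simp
  \<comment> \<open>Index 0 is marked too, because \<open>cell_index_mult\<close> says nothing about
    it; the sums over \<open>1..M\<close> below do not see it.\<close>
  define B where "B i = (if i \<in> bad \<or> i = 0 then 1 else 0 :: real)" for i
  have good: "c (cell_index (M * L) x) = c (cell_index M x * L)"
    if x: "x \<in> {0..1}" and B0: "B (cell_index M x) = 0" for x
  proof -
    define m where "m = cell_index M x"
    have m: "0 < m" "m \<le> M" "m \<notin> bad"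
      using B0 cell_index_le[OF x, of M] by (auto simp: m_def B_def split: if_splits)
    have i: "(m - 1) * L + 1 \<le> cell_index (M * L) x" "cell_index (M * L) x \<le> m * L"
      using cell_index_mult[OF M, of x] m(1) by (auto simp: m_def)
    have mL: "m * L \<le> M * L" using m(2) by (rule mult_le_mono1)
    have "c ((m - 1) * L + 1) \<le> c (cell_index (M * L) x)"
      using i mL by (intro mono) linarith+
    moreover have "c (cell_index (M * L) x) \<le> c (m * L)"
      using i mL by (intro mono) linarith+
    moreover have "c ((m - 1) * L + 1) = c (m * L)" using m by (auto simp: bad_def)
    ultimately show ?thesis by (simp add: m_def)
  qed
  let ?D = "\<lambda>x y. step (M * L) (\<lambda>i j. \<beta> (c i) (c j)) x y - step M (\<lambda>i j. \<beta> (c (i * L)) (c (j * L))) x y"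
  have pt: "\<bar>?D x y\<bar> \<le> step M (\<lambda>i j. B i + B j) x y" if "x \<in> {0..1}" "y \<in> {0..1}" for x y
  proof (cases "B (cell_index M x) = 0 \<and> B (cell_index M y) = 0")
    case True
    then show ?thesis using good[OF that(1)] good[OF that(2)] by (simp add: step_def)
  next
    case False
    have "\<bar>?D x y\<bar> \<le> 1"
      using \<beta>[of "c (cell_index (M * L) x)" "c (cell_index (M * L) y)"]
        \<beta>[of "c (cell_index M x * L)" "c (cell_index M y * L)"] by (auto simp: step_def abs_if)
    also have "1 \<le> step M (\<lambda>i j. B i + B j) x y" using False by (auto simp: step_def B_def split: if_splits)
    finally show ?thesis .
  qed
  have "L1norm ?D \<le> (LINT q | unit_square. step M (\<lambda>i j. B i + B j) (fst q) (snd q))"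
    unfolding L1norm_def
    by (rule integral_mono[OF integrable_abs[OF kernel_integrable[OF kernel_diff[OF step_kernel step_kernel]]]
          kernel_integrable[OF step_kernel]]) (use pt in auto)
  also have "\<dots> = (\<Sum>i=1..M. \<Sum>j=1..M. B i + B j) / M\<^sup>2" by (rule step_integral[OF M(1)])
  also have "\<dots> = 2 * real (card bad) / M"
  proof -
    have "(\<Sum>i=1..M. B i) = (\<Sum>i\<in>bad. 1)"
      by (rule sum.mono_neutral_cong_right) (auto simp: B_def bad_def)
    then have "(\<Sum>i=1..M. B i) = real (card bad)" by simp
    moreover have "(\<Sum>i=1..M. \<Sum>j=1..M. B i + B j) = 2 * real M * (\<Sum>i=1..M. B i)"
      by (simp add: sum.distrib sum_distrib_left mult.assoc)
    ultimately show ?thesis using M by (simp add: power2_eq_square)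
  qed
  also have "\<dots> \<le> 2 * real p / M" using card_bad by (intro divide_right_mono) auto
  finally show ?thesis .
qed

text \<open>Five replacements, each costing at most \<open>e / 5\<close>: by a fine step function,
  by its block averages, by sorted blocks (at no cost), by a grid of \<open>M\<close> cells, and by
  values that are multiples of \<open>1 / K\<close>. Since \<open>M\<close> and \<open>K\<close>
  depend on \<open>e\<close> alone, finitely many graphons remain.\<close>

lemma graphons_finite_net:
  fixes e :: real
  assumes e: "e > 0"
  obtains N where "finite N" "N \<subseteq> graphons" "\<And>W. W \<in> graphons \<Longrightarrow> \<exists>V\<in>N. cut_dist W V < e"
proof -
  define \<epsilon> where "\<epsilon> = e / 5"
  have \<epsilon>: "\<epsilon> > 0" using e by (simp add: \<epsilon>_def)
  obtain p :: nat where p: "p > 0" "\<And>n U. n > 0 \<Longrightarrow> (\<And>i j. U i j \<in> {0..1}) \<Longrightarrow>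
    \<exists>c. (\<forall>i. c i < p) \<and> block_regular n c U \<epsilon>"
    using weak_regularity[OF \<epsilon>] by blast
  obtain M :: nat where M: "2 * real p / \<epsilon> < M" using reals_Archimedean2 by blast
  have M0: "M > 0" using M \<epsilon> p(1) by (cases "M = 0") (auto simp: divide_less_0_iff)
  have M1: "2 * real p / M < \<epsilon>" using M M0 \<epsilon> by (simp add: field_simps)
  obtain K :: nat where K: "1 / \<epsilon> < K" using reals_Archimedean2 by blast
  have K0: "K > 0" using K \<epsilon> by (cases "K = 0") (auto simp: divide_less_0_iff)
  have K1: "1 / K < \<epsilon>" using K K0 \<epsilon> by (simp add: field_simps)
  \<comment> \<open>The value 0 off the grid is there because \<open>step_graphon\<close> asks for
    symmetry and range at all indices.\<close>
  define R where "R t i j = (if i \<le> M \<and> j \<le> M then real (t (i, j)) / K else 0)" for t :: "nat \<times> nat \<Rightarrow> nat" and i j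
  \<comment> \<open>A table \<open>t\<close> need not be symmetric; the intersection keeps those
    that give graphons.\<close>
  define N where "N = {step M (R t) | t. t \<in> ({..M} \<times> {..M}) \<rightarrow>\<^sub>E {..K}} \<inter> graphons"
  have "finite (({..M} \<times> {..M}) \<rightarrow>\<^sub>E {..K})" by (intro finite_PiE) auto
  then have "finite N" unfolding N_def by simp
  moreover have "\<exists>V\<in>N. cut_dist W V < e" if W: "W \<in> graphons" for W
  proof -
    obtain n a where n: "n > 0" "M dvd n" and a: "\<And>i j. a i j = a j i" "\<And>i j. a i j \<in> {0..1}"
      and l1: "L1norm (\<lambda>x y. W x y - step n a x y) < \<epsilon>"
      using step_approximation[OF W \<epsilon> M0] by blast
    obtain L where L: "n = M * L" using n(2) by blast
    have L0: "L > 0" using n(1) L by simp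
    obtain c where c: "\<And>i. c i < p" "block_regular n c a \<epsilon>" using p(2)[of n a, OF n(1) a(2)] by blast
    define \<beta> where "\<beta> = block_avg n c a"
    have \<beta>: "\<beta> u v \<in> {0..1}" "\<beta> u v = \<beta> v u" for u v
      using block_avg_bounds[of a n c u v] block_avg_sym[of a n c u v] a by (auto simp: \<beta>_def)
    obtain \<sigma> where \<sigma>: "\<sigma> permutes {1..n}"
      "\<And>i j. 1 \<le> i \<Longrightarrow> i \<le> j \<Longrightarrow> j \<le> n \<Longrightarrow> c (\<sigma> i) \<le> c (\<sigma> j)"
      using sorting_permutation[of n c] by blast
    define r where "r i j = \<beta> (c (\<sigma> (i * L))) (c (\<sigma> (j * L)))" for i j
    define t where "t = restrict (\<lambda>q. nat \<lfloor>K * r (fst q) (snd q)\<rfloor>) ({..M} \<times> {..M})"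
    have r: "r i j \<in> {0..1}" "r i j = r j i" for i j using \<beta> by (auto simp: r_def)
    have tK: "nat \<lfloor>K * r i j\<rfloor> \<le> K" for i j
    proof -
      have "real K * r i j \<le> real K * 1" using r(1)[of i j] by (intro mult_left_mono) auto
      then have "\<lfloor>real K * r i j\<rfloor> \<le> int K" by (simp add: floor_le_iff)
      then show ?thesis by (simp add: nat_le_iff)
    qed
    have Rt: "R t i j = (if i \<le> M \<and> j \<le> M then real (nat \<lfloor>K * r i j\<rfloor>) / K else 0)" for i j
      by (simp add: R_def t_def)
    define A1 A2 A3 A4 A5 where "A1 = step n a" and "A2 = step n (\<lambda>i j. \<beta> (c i) (c j))"
      and "A3 = step n (\<lambda>i j. \<beta> (c (\<sigma> i)) (c (\<sigma> j)))" and "A4 = step M r" and "A5 = step M (R t)"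
    have g: "A1 \<in> graphons" "A2 \<in> graphons" "A3 \<in> graphons" "A4 \<in> graphons" "A5 \<in> graphons"
      unfolding A1_def A2_def A3_def A4_def A5_def
    proof (safe intro!: step_graphon)
      show "R t i j = R t j i" for i j using r(2)[of i j] by (auto simp: Rt)
      show "R t i j \<in> {0..1}" for i j using tK[of i j] K0 by (auto simp: Rt)
    qed (use a \<beta> r in auto)
    have 1: "cut_dist W A1 < \<epsilon>"
      using cut_dist_le_L1norm[OF W g(1)] l1 by (simp add: A1_def)
    have 2: "cut_dist A1 A2 \<le> \<epsilon>"
      using cut_dist_le_cut_norm[OF g(1,2)] block_regular_cut_norm[OF n(1) c(2)] by (simp add: A1_def A2_def \<beta>_def)
    have "cut_dist A3 A2 = 0"
      unfolding A3_def A2_def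
      by (rule cut_dist_permute_step[OF n(1) \<sigma>(1), where a = "\<lambda>i j. \<beta> (c i) (c j)"]) (use \<beta> in auto)
    then have 3: "cut_dist A2 A3 = 0" using cut_dist_commute[OF g(2,3)] by simp
    have "L1norm (\<lambda>x y. A3 x y - A4 x y) \<le> 2 * real p / M"
      unfolding A3_def A4_def r_def L
      by (rule coarsen_sorted_blocks[OF M0 L0, where c = "\<lambda>i. c (\<sigma> i)"]) (use c(1) \<sigma>(2) \<beta> L in auto)
    then have 4: "cut_dist A3 A4 < \<epsilon>" using cut_dist_le_L1norm[OF g(3,4)] M1 by simp
    have "L1norm (\<lambda>x y. A4 x y - A5 x y) \<le> (LINT q | unit_square. 1 / K)"
      unfolding L1norm_def
    proof (rule integral_mono)
      show "integrable unit_square (\<lambda>q. \<bar>A4 (fst q) (snd q) - A5 (fst q) (snd q)\<bar>)"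
        by (intro integrable_abs kernel_integrable kernel_diff graphon_kernel g)
      fix q assume "q \<in> space unit_square"
      then have q: "cell_index M (fst q) \<le> M" "cell_index M (snd q) \<le> M" by (auto intro: cell_index_le)
      let ?r = "r (cell_index M (fst q)) (cell_index M (snd q))"
      have "\<bar>K * ?r - real (nat \<lfloor>K * ?r\<rfloor>)\<bar> \<le> 1"
        using r(1)[of "cell_index M (fst q)" "cell_index M (snd q)"] by (simp add: of_nat_nat) linarith
      then have "\<bar>K * ?r - real (nat \<lfloor>K * ?r\<rfloor>)\<bar> / K \<le> 1 / K" by (intro divide_right_mono) auto
      moreover have "?r - real (nat \<lfloor>K * ?r\<rfloor>) / K = (K * ?r - real (nat \<lfloor>K * ?r\<rfloor>)) / K"
        using K0 by (simp add: diff_divide_distrib)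
      ultimately show "\<bar>A4 (fst q) (snd q) - A5 (fst q) (snd q)\<bar> \<le> 1 / K"
        using q by (simp add: A4_def A5_def step_def Rt abs_divide)
    qed (rule unit_square.P.integrable_const)
    then have 5: "cut_dist A4 A5 < \<epsilon>"
      using cut_dist_le_L1norm[OF g(4,5)] K1 unit_square.P.prob_space by simp
    have "cut_dist W A5 \<le> cut_dist W A1 + (cut_dist A1 A2 + (cut_dist A2 A3 + (cut_dist A3 A4 + cut_dist A4 A5)))"
      using cut_dist_triangle[OF W g(1) g(5)] cut_dist_triangle[OF g(1) g(2) g(5)]
        cut_dist_triangle[OF g(2) g(3) g(5)] cut_dist_triangle[OF g(3) g(4) g(5)] by linarith
    then have "cut_dist W A5 < e" using 1 2 3 4 5 e unfolding \<epsilon>_def by linarith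
    moreover have "t \<in> ({..M} \<times> {..M}) \<rightarrow>\<^sub>E {..K}" using tK by (auto simp: t_def)
    then have "A5 \<in> N" using g(5) by (auto simp: N_def A5_def)
    ultimately show ?thesis by blast
  qed
  ultimately show ?thesis using that[of N] by (auto simp: N_def)
qed

section \<open>Sequential compactness of the space of graph limits\<close>

lemma graph_limits_subsequence:
  fixes \<Gamma> :: "nat \<Rightarrow> limit"
  assumes "\<And>k. \<Gamma> k \<in> graph_limits"
  obtains r \<Lambda> where "strict_mono r" "\<Lambda> \<in> graph_limits" "(\<lambda>k. delta_cut (\<Gamma> (r k)) \<Lambda>) \<longlonglongrightarrow> 0"
proof -
  have "graph_limits.mtotally_bounded graph_limits"
    unfolding graph_limits.mtotally_bounded_def
  proof (intro allI impI)
    fix e :: real assume "e > 0"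
    then obtain N where N: "finite N" "N \<subseteq> graphons" "\<And>W. W \<in> graphons \<Longrightarrow> \<exists>V\<in>N. cut_dist W V < e"
      using graphons_finite_net by blast
    show "\<exists>K. finite K \<and> K \<subseteq> graph_limits \<and> graph_limits \<subseteq> (\<Union>x\<in>K. graph_limits.mball x e)"
    proof (intro exI conjI)
      show "finite (limit_of ` N)" using N(1) by simp
      show "limit_of ` N \<subseteq> graph_limits" using N(2) limit_of_in by blast
      show "graph_limits \<subseteq> (\<Union>x\<in>limit_of ` N. graph_limits.mball x e)"
      proof
        fix \<Lambda> assume L: "\<Lambda> \<in> graph_limits"
        obtain V where V: "V \<in> N" "cut_dist (rep \<Lambda>) V < e" using N(3)[OF rep_graphon[OF L]] by blast
        then have Vg: "V \<in> graphons" using N(2) by blast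
        have "delta_cut \<Lambda> (limit_of V) < e"
          using cut_dist_rep_limit_of_right[OF rep_graphon[OF L] Vg] V(2) by (simp add: delta_cut_def)
        then have "limit_dist \<Lambda> (limit_of V) < e" using L limit_of_in[OF Vg] by (simp add: limit_dist_def)
        then have "limit_dist (limit_of V) \<Lambda> < e" by (simp add: graph_limits.commute)
        then show "\<Lambda> \<in> (\<Union>x\<in>limit_of ` N. graph_limits.mball x e)"
          using L V(1) limit_of_in[OF Vg] by auto
      qed
    qed
  qed
  then obtain r where r: "strict_mono r" "graph_limits.MCauchy (\<Gamma> \<circ> r)"
    unfolding graph_limits.mtotally_bounded_sequentially using assms by blast
  have "\<forall>k. \<exists>N. \<forall>n n'. N \<le> n \<longrightarrow> N \<le> n' \<longrightarrow> limit_dist (\<Gamma> (r n)) (\<Gamma> (r n')) < (1/2)^k"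
    using r(2) by (simp add: graph_limits.MCauchy_def)
  from choice[OF this] obtain N where
    N: "\<And>k n n'. N k \<le> n \<Longrightarrow> N k \<le> n' \<Longrightarrow> limit_dist (\<Gamma> (r n)) (\<Gamma> (r n')) < (1/2)^k" by blast
  \<comment> \<open>Thins the Cauchy sequence so that consecutive distances fall below
    \<open>(1/2)^k\<close>, as \<open>cut_dist_complete\<close> demands.\<close>
  define s where "s = rec_nat (N 0) (\<lambda>k m. Suc (max m (N (Suc k))))"
  have s: "strict_mono s" unfolding s_def by (rule strict_mono_Suc_iff[THEN iffD2]) (simp add: less_Suc_eq_le)
  have sN: "N k \<le> s k" for k by (cases k) (auto simp: s_def)
  have "N k \<le> s (Suc k)" for k using sN[of k] strict_mono_less[OF s, of k "Suc k"] by simp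
  then have fast: "limit_dist (\<Gamma> (r (s k))) (\<Gamma> (r (s (Suc k)))) < (1/2)^k" for k
    using N[of k "s k" "s (Suc k)"] sN[of k] by blast
  define V where "V k = rep (\<Gamma> (r (s k)))" for k
  have V: "V k \<in> graphons" for k using rep_graphon[OF assms] by (simp add: V_def)
  have "cut_dist (V k) (V (Suc k)) < (1/2)^k" for k
    using fast[of k] assms by (simp add: V_def limit_dist_def delta_cut_def)
  then obtain W where W: "W \<in> graphons" "(\<lambda>k. cut_dist (V k) W) \<longlonglongrightarrow> 0"
    using cut_dist_complete[of V, OF V] by blast
  have "(\<lambda>k. delta_cut (\<Gamma> ((r \<circ> s) k)) (limit_of W)) \<longlonglongrightarrow> 0"
    using W(2) cut_dist_rep_limit_of_right[OF V W(1)] by (simp add: delta_cut_def V_def)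
  then show ?thesis
    using that[of "r \<circ> s" "limit_of W"] strict_mono_o[OF r(1) s] limit_of_in[OF W(1)] by blast
qed

subsection \<open>Homomorphism densities\<close>

interpretation unit_product: product_prob_space "\<lambda>_ :: nat. unit_measure" UNIV
  by (rule product_prob_spaceI) (rule prob_space_unit_measure)

abbreviation unit_cube :: "nat set \<Rightarrow> (nat \<Rightarrow> real) measure" where
  "unit_cube I \<equiv> Pi\<^sub>M I (\<lambda>_. unit_measure)"

lemma prob_space_unit_cube: "prob_space (unit_cube I)"
  by (rule prob_space_PiM) (rule prob_space_unit_measure)

text \<open>The integral is linear in \<open>a\<close>: it is that of \<open>a x * g x\<close>,
  where \<open>g x\<close> integrates \<open>K x\<close> over the second variable. Among functions
  with values in [0,1] the indicator of \<open>{x. 0 < g x}\<close> makes it largest.\<close>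

lemma cut_norm_replace_indicator:
  assumes K: "bounded_kernel K" and a: "a \<in> borel_measurable unit_measure" "\<And>x. x \<in> {0..1} \<Longrightarrow> a x \<in> {0..1}"
  obtains S where "S \<in> sets unit_measure"
    "(LINT p | unit_square. a (fst p) * K (fst p) (snd p)) \<le> (LINT p | unit_square. indicator S (fst p) * K (fst p) (snd p))"
proof -
  have k: "bounded_kernel (\<lambda>x y. b x * K x y)"
    if "b \<in> borel_measurable unit_measure" "\<And>x. x \<in> {0..1} \<Longrightarrow> b x \<in> {0..1}" for b :: "real \<Rightarrow> real"
  proof -
    obtain B where B: "\<forall>x\<in>{0..1}. \<forall>y\<in>{0..1}. \<bar>K x y\<bar> \<le> B" using K unfolding bounded_kernel_def by blast
    show ?thesis
    proof (rule kernelI[where B = B])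
      show "(\<lambda>p. b (fst p) * K (fst p) (snd p)) \<in> borel_measurable unit_square"
        by (intro borel_measurable_times kernel_measurable K measurable_compose[OF measurable_fst that(1)])
      fix x y :: real assume "x \<in> {0..1}" "y \<in> {0..1}"
      then show "\<bar>b x * K x y\<bar> \<le> B"
        using that(2)[of x] B mult_mono[of "b x" 1 "\<bar>K x y\<bar>" B] by (auto simp: abs_mult)
    qed
  qed
  define g where "g x = (LINT y | unit_measure. K x y)" for x
  have gm: "g \<in> borel_measurable unit_measure"
    unfolding g_def
    by (rule unit_measure.borel_measurable_lebesgue_integral) (use K in \<open>simp add: bounded_kernel_def\<close>)
  define S where "S = {x \<in> {0..1}. 0 < g x}"
  have S: "S \<in> sets unit_measure"
    using measurable_sets[OF gm, of "{0<..}"] by (simp add: S_def vimage_def Int_def conj_commute)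
  have eq: "(LINT p | unit_square. b (fst p) * K (fst p) (snd p)) = (LINT x | unit_measure. b x * g x)"
    if "b \<in> borel_measurable unit_measure" "\<And>x. x \<in> {0..1} \<Longrightarrow> b x \<in> {0..1}" for b
    using unit_square.integral_fst'[OF kernel_integrable[OF k[OF that]]] by (simp add: g_def)
  have int: "integrable unit_measure (\<lambda>x. b x * g x)"
    if "b \<in> borel_measurable unit_measure" "\<And>x. x \<in> {0..1} \<Longrightarrow> b x \<in> {0..1}" for b
    using unit_square.integrable_fst'[OF kernel_integrable[OF k[OF that]]] by (simp add: g_def)
  have iS: "(indicator S :: real \<Rightarrow> real) \<in> borel_measurable unit_measure" using S by simp
  have i01: "(indicator S x :: real) \<in> {0..1}" for x by (simp add: indicator_def)
  have "(LINT x | unit_measure. a x * g x) \<le> (LINT x | unit_measure. indicator S x * g x)"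
  proof (rule integral_mono[OF int[OF a] int[OF iS i01]])
    fix x assume "x \<in> space unit_measure"
    then show "a x * g x \<le> indicator S x * g x"
      using a(2)[of x] mult_right_mono[of "a x" 1 "g x"] by (auto simp: S_def indicator_def mult_nonneg_nonpos)
  qed
  then show ?thesis using that[OF S] eq[OF a] eq[OF iS i01] by simp
qed

lemma kernel_mult_snd:
  assumes K: "bounded_kernel K" and b: "b \<in> borel_measurable unit_measure" "\<And>x. x \<in> {0..1} \<Longrightarrow> b x \<in> {0..1}"
  shows "bounded_kernel (\<lambda>x y. K x y * b y)"
proof -
  obtain B where B: "\<forall>x\<in>{0..1}. \<forall>y\<in>{0..1}. \<bar>K x y\<bar> \<le> B" using K unfolding bounded_kernel_def by blast
  show ?thesis
  proof (rule kernelI[where B = B])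
    show "(\<lambda>p. K (fst p) (snd p) * b (snd p)) \<in> borel_measurable unit_square"
      by (intro borel_measurable_times kernel_measurable K measurable_compose[OF measurable_snd b(1)])
    fix x y :: real assume xy: "x \<in> {0..1}" "y \<in> {0..1}"
    then have "\<bar>K x y\<bar> \<le> B" using B by blast
    then show "\<bar>K x y * b y\<bar> \<le> B"
      using b(2)[OF xy(2)] mult_mono[of "\<bar>K x y\<bar>" B "b y" 1] by (auto simp: abs_mult)
  qed
qed

text \<open>Functions with values in [0,1] may replace the sets in the cut norm: first
  \<open>a\<close> and then, after transposing, \<open>b\<close> is exchanged for an indicator
  without decreasing the integral.\<close>

lemma cut_norm_functions:
  assumes K: "bounded_kernel K"
    and a: "a \<in> borel_measurable unit_measure" "\<And>x. x \<in> {0..1} \<Longrightarrow> a x \<in> {0..1}"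
    and b: "b \<in> borel_measurable unit_measure" "\<And>x. x \<in> {0..1} \<Longrightarrow> b x \<in> {0..1}"
  shows "\<bar>LINT p | unit_square. K (fst p) (snd p) * (a (fst p) * b (snd p))\<bar> \<le> cut_norm K"
proof -
  have le: "(LINT p | unit_square. K (fst p) (snd p) * (a (fst p) * b (snd p))) \<le> cut_norm K"
    if K: "bounded_kernel K" for K
  proof -
    obtain S where S: "S \<in> sets unit_measure"
      "(LINT p | unit_square. a (fst p) * (K (fst p) (snd p) * b (snd p)))
        \<le> (LINT p | unit_square. indicator S (fst p) * (K (fst p) (snd p) * b (snd p)))"
      using cut_norm_replace_indicator[OF kernel_mult_snd[OF K b] a] by blast
    have iS: "(indicator S :: real \<Rightarrow> real) \<in> borel_measurable unit_measure" using S by simp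
    have k2: "bounded_kernel (\<lambda>y x. K x y * indicator S x)"
      by (rule kernel_mult_snd[OF kernel_transpose[OF K] iS]) (auto simp: indicator_def)
    obtain T where T: "T \<in> sets unit_measure"
      "(LINT p | unit_square. b (fst p) * (K (snd p) (fst p) * indicator S (snd p)))
        \<le> (LINT p | unit_square. indicator T (fst p) * (K (snd p) (fst p) * indicator S (snd p)))"
      using cut_norm_replace_indicator[OF k2 b] by blast
    have swap: "(LINT p | unit_square. c (fst p) * (K (snd p) (fst p) * indicator S (snd p)))
       = (LINT p | unit_square. indicator S (fst p) * (K (fst p) (snd p) * c (snd p)))"
      if "c \<in> borel_measurable unit_measure" for c :: "real \<Rightarrow> real"
    proof -
      have "(\<lambda>p. indicator S (fst p) * (K (fst p) (snd p) * c (snd p))) \<in> borel_measurable unit_square"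
        by (intro borel_measurable_times kernel_measurable K measurable_compose[OF measurable_snd that]
            measurable_compose[OF measurable_fst iS])
      from unit_square.integral_product_swap[OF this] show ?thesis
        by (simp add: case_prod_unfold mult_ac)
    qed
    have iT: "(indicator T :: real \<Rightarrow> real) \<in> borel_measurable unit_measure" using T by simp
    have "(LINT p | unit_square. K (fst p) (snd p) * (a (fst p) * b (snd p)))
       = (LINT p | unit_square. a (fst p) * (K (fst p) (snd p) * b (snd p)))"
      by (simp add: mult_ac)
    also note S(2)
    also note swap[OF b(1), symmetric]
    also note T(2)
    also note swap[OF iT]
    also have "(LINT p | unit_square. indicator S (fst p) * (K (fst p) (snd p) * indicator T (snd p)))
        = (LINT p : S \<times> T | unit_square. K (fst p) (snd p))"
      unfolding set_lebesgue_integral_def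
      by (rule Bochner_Integration.integral_cong) (auto simp: indicator_def)
    also have "\<dots> \<le> cut_norm K" using cut_norm_upper[OF K S(1) T(1)] by simp
    finally show ?thesis .
  qed
  have "bounded_kernel (\<lambda>x y. - K x y)" using kernel_cmult[OF K, of "-1"] by simp
  from le[OF this] le[OF K] show ?thesis by (simp add: cut_norm_minus[OF K])
qed

section \<open>The counting lemma\<close>

definition graph_edges :: "nat \<Rightarrow> nat set set \<Rightarrow> bool" where
  "graph_edges m E \<longleftrightarrow> E \<subseteq> {e. e \<subseteq> {1..m} \<and> card e = 2}"

lemma graph_edge:
  assumes "graph_edges m E" "e \<in> E"
  shows "Min e \<in> {1..m}" "Max e \<in> {1..m}" "Min e \<noteq> Max e" "e = {Min e, Max e}"
proof -
  have e: "e \<subseteq> {1..m}" "card e = 2" using assms by (auto simp: graph_edges_def)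
  then obtain x y where xy: "e = {x, y}" "x \<noteq> y" by (auto simp: card_2_iff)
  then have "Min e = min x y" "Max e = max x y" by auto
  then show "Min e \<in> {1..m}" "Max e \<in> {1..m}" "Min e \<noteq> Max e" "e = {Min e, Max e}"
    using e xy by (auto simp: min_def max_def)
qed

lemma finite_graph_edges: "graph_edges m E \<Longrightarrow> finite E"
  unfolding graph_edges_def by (rule finite_subset[of _ "Pow {1..m}"]) auto

lemma is_graph_edges: "is_graph F \<longleftrightarrow> graph_edges (fst F) (snd F)"
  by (simp add: is_graph_def graph_edges_def)

text \<open>Every edge has a kernel of its own, so that kernels can be exchanged one edge at a
  time.\<close>

definition edge_product :: "nat set set \<Rightarrow> (nat set \<Rightarrow> real \<Rightarrow> real \<Rightarrow> real) \<Rightarrow> (nat \<Rightarrow> real) \<Rightarrow> real" where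
  "edge_product E V x = (\<Prod>e\<in>E. V e (x (Min e)) (x (Max e)))"

lemma edge_factor_measurable:
  assumes "i \<in> I" "j \<in> I" "bounded_kernel K"
  shows "(\<lambda>x. K (x i) (x j)) \<in> borel_measurable (unit_cube I)"
proof -
  have "(\<lambda>x. (x i, x j)) \<in> unit_cube I \<rightarrow>\<^sub>M unit_square"
    by (intro measurable_Pair measurable_component_singleton assms)
  from measurable_compose[OF this kernel_measurable[OF assms(3)]] show ?thesis by simp
qed

lemma edge_product_measurable:
  assumes "graph_edges m E" "\<And>e. e \<in> E \<Longrightarrow> bounded_kernel (V e)"
  shows "edge_product E V \<in> borel_measurable (unit_cube {1..m})"
  unfolding edge_product_def[abs_def]
  by (intro borel_measurable_prod edge_factor_measurable assms graph_edge[OF assms(1)])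

lemma edge_product_bounds:
  assumes "\<And>e. e \<in> E \<Longrightarrow> V e \<in> graphons" "\<And>e. e \<in> E \<Longrightarrow> x (Min e) \<in> {0..1} \<and> x (Max e) \<in> {0..1}"
  shows "edge_product E V x \<in> {0..1}"
  unfolding edge_product_def using assms graphon_bounds by (auto intro!: prod_nonneg prod_le_1)

text \<open>Once all other coordinates are fixed, the product over the edges other than \<open>{i, j}\<close> splits
  into a function of \<open>x\<^sub>i\<close> times a function of \<open>x\<^sub>j\<close>.\<close>

lemma edge_product_change_one:
  assumes E: "graph_edges m E" and e0: "e0 \<in> E"
    and V: "\<And>e. e \<in> E \<Longrightarrow> V e \<in> graphons" and U: "U \<in> graphons"
  shows "\<bar>(LINT x | unit_cube {1..m}. edge_product E V x) - (LINT x | unit_cube {1..m}. edge_product E (V(e0 := U)) x)\<bar>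
     \<le> cut_norm (\<lambda>x y. V e0 x y - U x y)"
proof -
  define D where "D x y = V e0 x y - U x y" for x y
  have Dk: "bounded_kernel D" unfolding D_def by (intro kernel_diff graphon_kernel V e0 U)
  define R where "R = edge_product (E - {e0}) V"
  define i j where "i = Min e0" and "j = Max e0"
  have ij: "i \<in> {1..m}" "j \<in> {1..m}" "i \<noteq> j" "e0 = {i, j}"
    using graph_edge[OF E e0] by (auto simp: i_def j_def)
  have finE: "finite E" using finite_graph_edges[OF E] .
  define J where "J = {1..m} - {i, j}"
  have I: "{1..m} = insert j (insert i J)" "finite J" "i \<notin> J" "j \<notin> insert i J"
    using ij by (auto simp: J_def)
  have E': "graph_edges m (E - {e0})" using E by (auto simp: graph_edges_def)
  have comp: "x k \<in> {0..1}" if "x \<in> space (unit_cube I)" "k \<in> I" for x k I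
    using that by (auto simp: space_PiM)
  have bnd: "edge_product E' V' x \<in> {0..1}"
    if "graph_edges m E'" "\<And>e. e \<in> E' \<Longrightarrow> V' e \<in> graphons" "x \<in> space (unit_cube {1..m})" for E' V' x
    by (rule edge_product_bounds) (use that comp[OF that(3)] graph_edge[OF that(1)] in auto)
  have int: "integrable (unit_cube {1..m}) (edge_product E' V')"
    if "graph_edges m E'" "\<And>e. e \<in> E' \<Longrightarrow> V' e \<in> graphons" for E' V'
  proof (rule finite_measure.integrable_const_bound[where B = 1])
    show "finite_measure (unit_cube {1..m})" using prob_space_unit_cube prob_space_def by blast
    show "AE x in unit_cube {1..m}. norm (edge_product E' V' x) \<le> 1"
      using bnd[OF that] by (intro AE_I2) (fastforce simp: abs_le_iff)
    show "edge_product E' V' \<in> borel_measurable (unit_cube {1..m})"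
      using edge_product_measurable[OF that(1)] that(2) graphon_kernel by blast
  qed
  have V': "(V(e0 := U)) e \<in> graphons" if "e \<in> E" for e using V U that by auto
  define f where "f x = D (x i) (x j) * R x" for x
  have f_eq: "edge_product E V x - edge_product E (V(e0 := U)) x = f x" for x
  proof -
    have "edge_product E V' x = V' e0 (x i) (x j) * edge_product (E - {e0}) V' x" for V'
      unfolding edge_product_def i_def j_def using finE e0 by (rule prod.remove)
    moreover have "edge_product (E - {e0}) (V(e0 := U)) x = R x"
      unfolding edge_product_def R_def by (rule prod.cong) auto
    ultimately show ?thesis by (simp add: f_def D_def R_def algebra_simps)
  qed
  have f_int: "integrable (unit_cube {1..m}) f"
    using Bochner_Integration.integrable_diff[OF int[of E V, OF E V] int[of E "V(e0 := U)", OF E V']]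
    by (simp only: f_eq)
  have "(LINT x | unit_cube {1..m}. edge_product E V x) - (LINT x | unit_cube {1..m}. edge_product E (V(e0 := U)) x)
     = (LINT x | unit_cube {1..m}. f x)"
    using Bochner_Integration.integral_diff[OF int[of E V, OF E V] int[of E "V(e0 := U)", OF E V']]
    by (simp only: f_eq)
  \<comment> \<open>Fubini makes the coordinates of the two ends of \<open>e0\<close> the innermost
    variables.\<close>
  also have "\<dots> = (LINT x | unit_cube (insert i J). LINT t | unit_measure. f (x(j := t)))"
    unfolding I(1) by (rule unit_product.product_integral_insert) (use I f_int in auto)
  also have "\<dots> = (LINT z | unit_cube J. LINT s | unit_measure. LINT t | unit_measure. f ((z(i := s))(j := t)))"
  proof (rule unit_product.product_integral_insert[OF I(2,3)])
    have "integrable (unit_cube (insert i J) \<Otimes>\<^sub>M unit_measure) (\<lambda>p. f ((fst p)(j := snd p)))"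
    proof (rule finite_measure.integrable_const_bound[where B = 1])
      show "finite_measure (unit_cube (insert i J) \<Otimes>\<^sub>M unit_measure)"
        using prob_space_pair[OF prob_space_unit_cube prob_space_unit_measure] prob_space_def by blast
      have m: "(\<lambda>p. (fst p)(j := snd p)) \<in> unit_cube (insert i J) \<Otimes>\<^sub>M unit_measure \<rightarrow>\<^sub>M unit_cube {1..m}"
        using measurable_add_dim[of j "insert i J" "\<lambda>_. unit_measure"] unfolding I(1) case_prod_unfold .
      from measurable_compose[OF m borel_measurable_integrable[OF f_int]]
      show "(\<lambda>p. f ((fst p)(j := snd p))) \<in> borel_measurable (unit_cube (insert i J) \<Otimes>\<^sub>M unit_measure)" .
      show "AE p in unit_cube (insert i J) \<Otimes>\<^sub>M unit_measure. norm (f ((fst p)(j := snd p))) \<le> 1"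
      proof (rule AE_I2)
        fix p assume p: "p \<in> space (unit_cube (insert i J) \<Otimes>\<^sub>M unit_measure)"
        have x: "(fst p)(j := snd p) \<in> space (unit_cube {1..m})" using measurable_space[OF m p] .
        show "norm (f ((fst p)(j := snd p))) \<le> 1"
          using bnd[of E V, OF E V x] bnd[of E "V(e0 := U)", OF E V' x] unfolding f_eq[symmetric] by (auto simp: abs_if)
      qed
    qed
    then show "integrable (unit_cube (insert i J)) (\<lambda>x. LINT t | unit_measure. f (x(j := t)))"
      by (rule pair_sigma_finite.integrable_fst'[OF pair_sigma_finite.intro[OF
            prob_space_imp_sigma_finite[OF prob_space_unit_cube] prob_space_imp_sigma_finite[OF prob_space_unit_measure]],
            of _ "\<lambda>p. f ((fst p)(j := snd p))", simplified fst_conv snd_conv])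
  qed
  finally have eq: "(LINT x | unit_cube {1..m}. edge_product E V x) - (LINT x | unit_cube {1..m}. edge_product E (V(e0 := U)) x)
    = (LINT z | unit_cube J. LINT s | unit_measure. LINT t | unit_measure. f ((z(i := s))(j := t)))" .
  have inner: "\<bar>LINT s | unit_measure. LINT t | unit_measure. f ((z(i := s))(j := t))\<bar> \<le> cut_norm D"
    if z: "z \<in> space (unit_cube J)" for z
  proof -
    let ?y = "\<lambda>s t. (z(i := s))(j := t)"
    have y: "?y s t \<in> space (unit_cube {1..m})" if "s \<in> {0..1}" "t \<in> {0..1}" for s t
      using z that unfolding I(1) by (auto simp: space_PiM PiE_def Pi_def extensional_def)
    \<comment> \<open>Edges through \<open>j\<close> other than \<open>e0\<close> avoid
      \<open>i\<close>. With \<open>z\<close> fixed, the product over \<open>A\<close> thus depends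
      only on \<open>s\<close> and the product over \<open>B\<close> only on
      \<open>t\<close>.\<close>
    define A where "A = {e \<in> E - {e0}. j \<notin> e}"
    define B where "B = {e \<in> E - {e0}. j \<in> e}"
    have AB: "E - {e0} = A \<union> B" "A \<inter> B = {}" "finite A" "finite B"
      using finE by (auto simp: A_def B_def)
    have gA: "graph_edges m A" and gB: "graph_edges m B"
      using E by (auto simp: graph_edges_def A_def B_def)
    have iB: "i \<notin> e" if "e \<in> B" for e
    proof
      assume "i \<in> e"
      moreover have "j \<in> e" "card e = 2" "e \<noteq> {i, j}" using that E ij(4) by (auto simp: B_def graph_edges_def)
      ultimately show False using ij(3) card_2_iff[of e] by auto
    qed
    \<comment> \<open>The coordinate that does not influence the factor is set to 0.\<close>
    define a where "a s = edge_product A V (?y s 0)" for s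
    define b where "b t = edge_product B V (?y 0 t)" for t
    have a_eq: "edge_product A V (?y s t) = a s" for s t
      unfolding a_def edge_product_def
    proof (rule prod.cong[OF refl])
      fix e assume e: "e \<in> A"
      have "Min e \<in> e" "Max e \<in> e" using graph_edge(4)[OF gA e] by (metis insertI1, metis insertI1 insert_commute)
      then have "Min e \<noteq> j" "Max e \<noteq> j" using e by (auto simp: A_def)
      then show "V e (?y s t (Min e)) (?y s t (Max e)) = V e (?y s 0 (Min e)) (?y s 0 (Max e))" by simp
    qed
    have b_eq: "edge_product B V (?y s t) = b t" for s t
      unfolding b_def edge_product_def
    proof (rule prod.cong[OF refl])
      fix e assume e: "e \<in> B"
      have "Min e \<in> e" "Max e \<in> e" using graph_edge(4)[OF gB e] by (metis insertI1, metis insertI1 insert_commute)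
      then have "Min e \<noteq> i" "Max e \<noteq> i" using iB[OF e] by auto
      then show "V e (?y s t (Min e)) (?y s t (Max e)) = V e (?y 0 t (Min e)) (?y 0 t (Max e))" by simp
    qed
    have R: "R (?y s t) = a s * b t" for s t
      unfolding R_def AB(1) using AB a_eq[of s t] b_eq[of s t]
      by (simp add: edge_product_def prod.union_disjoint)
    have fv: "f (?y s t) = D s t * (a s * b t)" for s t
      using R ij(3) by (simp add: f_def)
    have VA: "V e \<in> graphons" if "e \<in> A \<union> B" for e using V that AB(1) by blast
    have my: "(\<lambda>s. ?y (\<alpha> s) (\<beta> s)) \<in> unit_measure \<rightarrow>\<^sub>M unit_cube {1..m}"
      if ab: "\<alpha> \<in> unit_measure \<rightarrow>\<^sub>M unit_measure" "\<beta> \<in> unit_measure \<rightarrow>\<^sub>M unit_measure" for \<alpha> \<beta>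
    proof (rule measurable_PiM_single')
      fix k assume k: "k \<in> {1..m}"
      show "(\<lambda>s. ?y (\<alpha> s) (\<beta> s) k) \<in> unit_measure \<rightarrow>\<^sub>M unit_measure"
      proof -
        consider "k = j" | "k = i" | "k \<noteq> j" "k \<noteq> i" by blast
        then show ?thesis
        proof cases
          case 1
          have "(\<lambda>s. ?y (\<alpha> s) (\<beta> s) k) = \<beta>" unfolding 1 by (rule ext) (rule fun_upd_same)
          then show ?thesis using ab(2) by simp
        next
          case 2
          have "(\<lambda>s. ?y (\<alpha> s) (\<beta> s) k) = \<alpha>"
            unfolding 2 by (rule ext, subst fun_upd_other[OF ij(3)]) (rule fun_upd_same)
          then show ?thesis using ab(1) by simp
        next
          case 3
          then have "k \<in> J" using k by (auto simp: J_def)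
          then have "z k \<in> space unit_measure" using z by (auto simp: space_PiM)
          then show ?thesis using 3 by (simp add: measurable_const)
        qed
      qed
    next
      show "(\<lambda>s. ?y (\<alpha> s) (\<beta> s)) \<in> space unit_measure \<rightarrow> {1..m} \<rightarrow>\<^sub>E space unit_measure"
      proof
        fix s assume s: "s \<in> space unit_measure"
        show "?y (\<alpha> s) (\<beta> s) \<in> {1..m} \<rightarrow>\<^sub>E space unit_measure"
          using y[of "\<alpha> s" "\<beta> s"] measurable_space[OF ab(1) s] measurable_space[OF ab(2) s]
          by (simp only: space_PiM space_unit_measure)
      qed
    qed
    have c0: "(\<lambda>_. 0) \<in> unit_measure \<rightarrow>\<^sub>M unit_measure" by (rule measurable_const) simp
    note my = my[OF measurable_ident[unfolded id_def] c0] my[OF c0 measurable_ident[unfolded id_def]]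
    have am: "a \<in> borel_measurable unit_measure" and bm: "b \<in> borel_measurable unit_measure"
      unfolding a_def b_def
      by (rule measurable_compose[OF my(1) edge_product_measurable[OF gA]], simp add: VA graphon_kernel,
          rule measurable_compose[OF my(2) edge_product_measurable[OF gB]], simp add: VA graphon_kernel)
    have a01: "a s \<in> {0..1}" and b01: "b s \<in> {0..1}" if "s \<in> {0..1}" for s
      using bnd[OF gA VA y[OF that, of 0]] bnd[OF gB VA y[OF _ that, of 0]] by (auto simp: a_def b_def)
    have cn: "\<bar>LINT p | unit_square. D (fst p) (snd p) * (a (fst p) * b (snd p))\<bar> \<le> cut_norm D"
      by (rule cut_norm_functions[OF Dk am a01 bm b01])
    have k1: "bounded_kernel (\<lambda>x y. D x y * b y)" by (rule kernel_mult_snd[OF Dk bm b01])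
    have "bounded_kernel (\<lambda>x y. D x y * (a x * b y))"
      using kernel_transpose[OF kernel_mult_snd[OF kernel_transpose[OF k1] am a01]] by (simp add: mult_ac)
    from unit_square.integral_fst'[OF kernel_integrable[OF this]] cn show ?thesis by (simp add: fv)
  qed
  interpret J: prob_space "unit_cube J" by (rule prob_space_unit_cube)
  have D0: "0 \<le> cut_norm D" using cut_norm_nonneg[OF Dk] .
  have "\<bar>LINT z | unit_cube J. LINT s | unit_measure. LINT t | unit_measure. f ((z(i := s))(j := t))\<bar> \<le> cut_norm D"
  proof (cases "integrable (unit_cube J) (\<lambda>z. LINT s | unit_measure. LINT t | unit_measure. f ((z(i := s))(j := t)))")
    case True
    have "\<bar>LINT z | unit_cube J. LINT s | unit_measure. LINT t | unit_measure. f ((z(i := s))(j := t))\<bar>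
       \<le> (LINT z | unit_cube J. \<bar>LINT s | unit_measure. LINT t | unit_measure. f ((z(i := s))(j := t))\<bar>)"
      by (rule integral_abs_bound)
    also have "\<dots> \<le> cut_norm D"
      by (rule J.integral_le_const) (use inner True in \<open>auto intro!: AE_I2\<close>)
    finally show ?thesis .
  next
    \<comment> \<open>A function that is not integrable has integral 0 by convention.\<close>
    case False
    then show ?thesis using D0 by (simp add: not_integrable_integral_eq)
  qed
  then show ?thesis unfolding eq D_def .
qed

lemma graphon_density_edge_product:
  "graphon_density F W = (LINT x | unit_cube {1..fst F}. edge_product (snd F) (\<lambda>_. W) x)"
  by (simp add: graphon_density_def edge_product_def)

text \<open>A telescoping sum over the edges: \<open>D\<close> consists of the edges whose kernel is
  already \<open>W\<close>, and each exchange costs at most one cut norm.\<close>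

lemma graphon_density_cut_norm:
  assumes F: "is_graph F" and U: "U \<in> graphons" and W: "W \<in> graphons"
  shows "\<bar>graphon_density F U - graphon_density F W\<bar> \<le> card (snd F) * cut_norm (\<lambda>x y. U x y - W x y)"
proof -
  let ?I = "\<lambda>V. LINT x | unit_cube {1..fst F}. edge_product (snd F) V x"
  have E: "graph_edges (fst F) (snd F)" using F by (simp add: is_graph_edges)
  have "\<bar>?I (\<lambda>_. U) - ?I (\<lambda>e. if e \<in> D then W else U)\<bar> \<le> card D * cut_norm (\<lambda>x y. U x y - W x y)"
    if "finite D" "D \<subseteq> snd F" for D
    using that
  proof (induction D rule: finite_induct)
    case empty then show ?case by simp
  next
    case (insert e D)
    have eq: "(\<lambda>e. if e \<in> D then W else U)(e := W) = (\<lambda>e'. if e' \<in> insert e D then W else U)" by auto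
    have "\<bar>?I (\<lambda>e. if e \<in> D then W else U) - ?I (\<lambda>e'. if e' \<in> insert e D then W else U)\<bar>
        \<le> cut_norm (\<lambda>x y. U x y - W x y)"
      using edge_product_change_one[OF E, of e "\<lambda>e. if e \<in> D then W else U" W] insert U W
      unfolding eq by simp
    moreover have "\<bar>?I (\<lambda>_. U) - ?I (\<lambda>e. if e \<in> D then W else U)\<bar> \<le> card D * cut_norm (\<lambda>x y. U x y - W x y)"
      using insert by simp
    ultimately show ?case using insert(1,2) by (simp add: distrib_right)
  qed
  from this[OF finite_graph_edges[OF E] order_refl] 
  have "\<bar>?I (\<lambda>_. U) - ?I (\<lambda>e. if e \<in> snd F then W else U)\<bar> \<le> card (snd F) * cut_norm (\<lambda>x y. U x y - W x y)" .
  moreover have "?I (\<lambda>e. if e \<in> snd F then W else U) = ?I (\<lambda>_. W)"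
    unfolding edge_product_def by (intro Bochner_Integration.integral_cong prod.cong) auto
  ultimately show ?thesis by (simp add: graphon_density_edge_product)
qed

text \<open>Applying \<open>f\<close> in every coordinate preserves the product measure on the
  cube.\<close>

lemma graphon_density_comp:
  assumes F: "is_graph F" and W: "W \<in> graphons" and f: "f \<in> measure_preserving_bij"
  shows "graphon_density F (\<lambda>x y. W (f x) (f y)) = graphon_density F W"
proof -
  have E: "graph_edges (fst F) (snd F)" using F by (simp add: is_graph_edges)
  let ?P = "unit_cube {1..fst F}" and ?g = "edge_product (snd F) (\<lambda>_. W)"
  have d: "distr ?P ?P (compose {1..fst F} f) = ?P"
    using distr_PiM_finite_prob_space'[of "{1..fst F}" "\<lambda>_. unit_measure" "\<lambda>_. unit_measure" f]
      prob_space_unit_measure mpb_measurable[OF f] f by (simp add: measure_preserving_bij_def)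
  have m: "compose {1..fst F} f \<in> ?P \<rightarrow>\<^sub>M ?P"
    unfolding compose_def
    by (rule measurable_restrict)
       (rule measurable_compose[OF _ mpb_measurable[OF f]], rule measurable_component_singleton)
  have "(LINT x | ?P. ?g x) = (LINT x | distr ?P ?P (compose {1..fst F} f). ?g x)" by (simp only: d)
  also have "\<dots> = (LINT x | ?P. ?g (compose {1..fst F} f x))"
    by (rule integral_distr[OF m]) (use edge_product_measurable[OF E] graphon_kernel[OF W] in simp)
  also have "\<dots> = (LINT x | ?P. edge_product (snd F) (\<lambda>_. \<lambda>x y. W (f x) (f y)) x)"
    unfolding edge_product_def
    by (intro Bochner_Integration.integral_cong refl prod.cong)
       (use graph_edge(1,2)[OF E] in \<open>simp add: compose_def\<close>)
  finally show ?thesis by (simp add: graphon_density_edge_product)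
qed

lemma graphon_density_cut_dist:
  assumes F: "is_graph F" and U: "U \<in> graphons" and W: "W \<in> graphons"
  shows "\<bar>graphon_density F U - graphon_density F W\<bar> \<le> card (snd F) * cut_dist U W"
proof (rule field_le_epsilon)
  fix e :: real assume e: "0 < e"
  \<comment> \<open>The added 1 avoids a division by zero when \<open>F\<close> has no
    edges.\<close>
  define d where "d = e / (card (snd F) + 1)"
  have d: "d > 0" "card (snd F) * d \<le> e" using e by (auto simp: d_def field_simps)
  obtain f where f: "f \<in> measure_preserving_bij" "cut_norm (\<lambda>x y. U x y - W (f x) (f y)) < cut_dist U W + d"
    using cut_dist_lessD[OF U W, of "cut_dist U W + d"] d by (auto simp del: atLeastAtMost_iff)
  have "\<bar>graphon_density F U - graphon_density F W\<bar> \<le> card (snd F) * cut_norm (\<lambda>x y. U x y - W (f x) (f y))"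
    using graphon_density_cut_norm[OF F U graphon_comp[OF f(1) W]] graphon_density_comp[OF F W f(1)] by simp
  also have "\<dots> \<le> card (snd F) * (cut_dist U W + d)"
    using f(2) by (intro mult_left_mono) auto
  also have "\<dots> \<le> card (snd F) * cut_dist U W + e" using d(2) by (simp add: distrib_left)
  finally show "\<bar>graphon_density F U - graphon_density F W\<bar> \<le> card (snd F) * cut_dist U W + e" .
qed

section \<open>Finite graphs as step graphons and their densities\<close>

definition adjacency :: "graph \<Rightarrow> nat \<Rightarrow> nat \<Rightarrow> real" where
  "adjacency G i j = (if {i, j} \<in> snd G then 1 else 0)"

lemma graph_graphon_step: "graph_graphon G = step (fst G) (adjacency G)"
  by (intro ext) (simp add: graph_graphon_def step_def adjacency_def cell_index_def)

lemma adjacency_sym: "adjacency G i j = adjacency G j i"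
  by (simp add: adjacency_def insert_commute)

lemma graph_graphon_graphon: "graph_graphon G \<in> graphons"
  unfolding graph_graphon_step
  by (rule step_graphon) (auto simp: adjacency_def insert_commute)

text \<open>Fixing the cell of every coordinate cuts the cube into boxes. The edge product is 1 on
  the boxes that belong to homomorphisms and 0 elsewhere, and such a box has volume
  \<open>(1 / n) ^ fst F\<close> unless it involves the null cell 0.\<close>

lemma graphon_density_graph:
  assumes F: "is_graph F" and G: "fst G > 0"
  shows "graphon_density F (graph_graphon G) = hom_density F G"
proof -
  define n I E where "n = fst G" and "I = {1..fst F}" and "E = snd F"
  have n: "n > 0" using G by (simp add: n_def)
  have E: "graph_edges (fst F) E" using F by (simp add: is_graph_edges E_def)
  have fI: "finite I" by (simp add: I_def)
  interpret C: finite_product_prob_space "\<lambda>_. unit_measure" I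
    by unfold_locales (rule fI)
  \<comment> \<open>Maps with the value 0 are included since a coordinate may be 0. Their boxes are
    null sets, which permits the passage to \<open>\<Psi>\<close> in the end.\<close>
  define \<Phi> where "\<Phi> = {\<psi> \<in> I \<rightarrow>\<^sub>E {..n}. \<forall>e\<in>E. \<psi> ` e \<in> snd G}"
  define \<Psi> where "\<Psi> = {\<psi> \<in> I \<rightarrow>\<^sub>E {1..n}. \<forall>e\<in>E. \<psi> ` e \<in> snd G}"
  have fin: "finite \<Phi>" unfolding \<Phi>_def by (rule finite_subset[OF _ finite_PiE[OF fI, of "\<lambda>_. {..n}"]]) auto
  let ?B = "\<lambda>\<psi>. PiE I (\<lambda>i. cell n (\<psi> i))"
  have B: "?B \<psi> \<in> sets (unit_cube I)" for \<psi> by (rule sets_PiM_I_finite[OF fI]) simp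
  have pw: "edge_product E (\<lambda>_. graph_graphon G) x = (\<Sum>\<psi>\<in>\<Phi>. indicator (?B \<psi>) x)"
    if x: "x \<in> space (unit_cube I)" for x
  proof -
    define \<phi> where "\<phi> = restrict (\<lambda>i. cell_index n (x i)) I"
    have x01: "x i \<in> {0..1}" if "i \<in> I" for i using x that by (auto simp: space_PiM)
    have \<phi>: "\<phi> \<in> I \<rightarrow>\<^sub>E {..n}" using x01 cell_index_le by (auto simp: \<phi>_def)
    have ind: "x \<in> ?B \<psi> \<longleftrightarrow> \<psi> = \<phi>" if "\<psi> \<in> \<Phi>" for \<psi>
    proof
      assume "x \<in> ?B \<psi>"
      then have "\<psi> i = \<phi> i" if "i \<in> I" for i
        using PiE_mem[OF \<open>x \<in> ?B \<psi>\<close> that] that by (simp add: \<phi>_def cell_def)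
      moreover have "\<psi> \<in> I \<rightarrow>\<^sub>E {..n}" using that by (simp add: \<Phi>_def)
      ultimately show "\<psi> = \<phi>" using \<phi> by (intro PiE_ext) auto
    next
      assume "\<psi> = \<phi>"
      then show "x \<in> ?B \<psi>" using x x01 by (auto simp: \<phi>_def cell_def space_PiM PiE_def)
    qed
    have e: "graph_graphon G (x (Min e)) (x (Max e)) = (if \<phi> ` e \<in> snd G then 1 else 0)" if "e \<in> E" for e
    proof -
      note ge = graph_edge[OF E that]
      have "\<phi> ` e = {cell_index n (x (Min e)), cell_index n (x (Max e))}"
        by (subst ge(4)) (use ge(1,2) in \<open>simp add: \<phi>_def I_def\<close>)
      then show ?thesis by (simp add: graph_graphon_step step_def adjacency_def n_def)
    qed
    have "edge_product E (\<lambda>_. graph_graphon G) x = (\<Prod>e\<in>E. if \<phi> ` e \<in> snd G then 1 else 0)"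
      unfolding edge_product_def by (rule prod.cong) (use e in auto)
    also have "\<dots> = (if \<phi> \<in> \<Phi> then 1 else 0)"
    proof (cases "\<forall>e\<in>E. \<phi> ` e \<in> snd G")
      case True then show ?thesis using \<phi> by (simp add: \<Phi>_def)
    next
      case False
      then show ?thesis using finite_graph_edges[OF E] by (auto simp: \<Phi>_def intro!: prod_zero)
    qed
    also have "\<dots> = (\<Sum>\<psi>\<in>\<Phi>. if \<psi> = \<phi> then 1 else 0)" using fin by simp
    also have "\<dots> = (\<Sum>\<psi>\<in>\<Phi>. indicator (?B \<psi>) x)"
      by (rule sum.cong) (use ind in \<open>auto simp: indicator_def\<close>)
    finally show ?thesis .
  qed
  have pr: "measure (unit_cube I) (?B \<psi>) = (\<Prod>i\<in>I. measure unit_measure (cell n (\<psi> i)))" for \<psi>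
    by (rule C.prob_times) simp
  have "graphon_density F (graph_graphon G) = (LINT x | unit_cube I. edge_product E (\<lambda>_. graph_graphon G) x)"
    by (simp only: graphon_density_edge_product I_def E_def)
  also have "\<dots> = (LINT x | unit_cube I. (\<Sum>\<psi>\<in>\<Phi>. indicator (?B \<psi>) x))"
    by (rule Bochner_Integration.integral_cong) (use pw in auto)
  also have "\<dots> = (\<Sum>\<psi>\<in>\<Phi>. measure (unit_cube I) (?B \<psi>))"
  proof -
    have "integrable (unit_cube I) (indicat_real (?B \<psi>))" for \<psi>
      by (rule integrable_real_indicator[OF B]) (simp add: C.emeasure_eq_measure)
    then have "(LINT x | unit_cube I. (\<Sum>\<psi>\<in>\<Phi>. indicator (?B \<psi>) x)) = (\<Sum>\<psi>\<in>\<Phi>. LINT x | unit_cube I. indicat_real (?B \<psi>) x)"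
      by (rule Bochner_Integration.integral_sum)
    also have "\<dots> = (\<Sum>\<psi>\<in>\<Phi>. measure (unit_cube I) (?B \<psi>))"
      using sets.sets_into_space[OF B] by (intro sum.cong refl) (simp add: Int_absorb2)
    finally show ?thesis .
  qed
  also have "\<dots> = (\<Sum>\<psi>\<in>\<Psi>. (1 / n) ^ fst F)"
  proof (rule sum.mono_neutral_cong_right[OF fin])
    show "\<Psi> \<subseteq> \<Phi>" unfolding \<Psi>_def \<Phi>_def by fastforce
    show "\<forall>\<psi>\<in>\<Phi> - \<Psi>. measure (unit_cube I) (?B \<psi>) = 0"
    proof
      fix \<psi> assume \<psi>: "\<psi> \<in> \<Phi> - \<Psi>"
      then obtain i where i: "i \<in> I" "\<psi> i = 0"
        by (fastforce simp: \<Phi>_def \<Psi>_def PiE_iff)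
      then have "measure unit_measure (cell n (\<psi> i)) = 0" using measure_Int_cell_0[OF n, of UNIV] by simp
      then show "measure (unit_cube I) (?B \<psi>) = 0" unfolding pr using i fI by (auto intro!: prod_zero bexI[of _ i])
    qed
    show "measure (unit_cube I) (?B \<psi>) = (1 / n) ^ fst F" if "\<psi> \<in> \<Psi>" for \<psi>
    proof -
      have "(\<Prod>i\<in>I. measure unit_measure (cell n (\<psi> i))) = (\<Prod>i\<in>I. 1 / n)"
        by (rule prod.cong) (use that in \<open>auto simp: \<Psi>_def intro!: measure_cell n\<close>)
      then show ?thesis unfolding pr by (simp add: I_def)
    qed
  qed
  also have "\<dots> = hom_density F G"
    by (simp add: hom_density_def \<Psi>_def I_def E_def n_def power_one_over)
  finally show ?thesis .
qed

subsection \<open>Counting graphs with a given block structure\<close>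

definition all_edges :: "nat \<Rightarrow> nat set set" where
  "all_edges n = {e. e \<subseteq> {1..n} \<and> card e = 2}"

lemma finite_all_edges [simp]: "finite (all_edges n)"
  unfolding all_edges_def by (rule finite_subset[of _ "Pow {1..n}"]) auto

text \<open>An edge is two ordered pairs. Weights are products over edges, whereas averages and
  entropies are sums over ordered pairs.\<close>

lemma all_edges_sum:
  fixes f :: "nat \<Rightarrow> nat \<Rightarrow> real"
  assumes sym: "\<And>i j. f i j = f j i"
  shows "2 * (\<Sum>e\<in>all_edges n. f (Min e) (Max e)) = (\<Sum>q | q \<in> pairs n \<and> fst q \<noteq> snd q. f (fst q) (snd q))"
proof -
  let ?L = "{q \<in> pairs n. fst q < snd q}" and ?R = "{q \<in> pairs n. snd q < fst q}"
  have bij: "bij_betw (\<lambda>q. {fst q, snd q}) ?L (all_edges n)"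
  proof (rule bij_betw_byWitness[where f' = "\<lambda>e. (Min e, Max e)"])
    show "\<forall>q\<in>?L. (Min {fst q, snd q}, Max {fst q, snd q}) = q" by auto
    have g: "graph_edges n (all_edges n)" by (simp add: graph_edges_def all_edges_def)
    show "\<forall>e\<in>all_edges n. {fst (Min e, Max e), snd (Min e, Max e)} = e"
      using graph_edge(4)[OF g] by auto
    show "(\<lambda>q. {fst q, snd q}) ` ?L \<subseteq> all_edges n" by (auto simp: pairs_def all_edges_def)
    show "(\<lambda>e. (Min e, Max e)) ` all_edges n \<subseteq> ?L"
    proof
      fix q assume "q \<in> (\<lambda>e. (Min e, Max e)) ` all_edges n"
      then obtain e where e: "e \<in> all_edges n" "q = (Min e, Max e)" by auto
      have "finite e" using e(1) by (auto simp: all_edges_def intro: finite_subset)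
      moreover have "e \<noteq> {}" using e(1) by (auto simp: all_edges_def)
      ultimately have "Min e \<le> Max e" by simp
      then show "q \<in> ?L" using graph_edge(1-3)[OF g e(1)] e(2) by (auto simp: pairs_def)
    qed
  qed
  have L: "(\<Sum>e\<in>all_edges n. f (Min e) (Max e)) = (\<Sum>q\<in>?L. f (fst q) (snd q))"
    by (subst sum.reindex_bij_betw[OF bij, symmetric]) (rule sum.cong, auto)
  have R: "(\<Sum>q\<in>?R. f (fst q) (snd q)) = (\<Sum>q\<in>?L. f (fst q) (snd q))"
    by (rule sum.reindex_bij_witness[of _ prod.swap prod.swap]) (use sym in \<open>auto simp: pairs_def\<close>)
  have "{q \<in> pairs n. fst q \<noteq> snd q} = ?L \<union> ?R" by auto
  then have "(\<Sum>q | q \<in> pairs n \<and> fst q \<noteq> snd q. f (fst q) (snd q))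
      = (\<Sum>q\<in>?L. f (fst q) (snd q)) + (\<Sum>q\<in>?R. f (fst q) (snd q))"
    by (simp only:) (rule sum.union_disjoint, auto)
  then show ?thesis using L R by simp
qed

text \<open>The probability of \<open>E\<close> when the edges are chosen independently with probabilities \<open>u\<close>.\<close>

definition edge_weight :: "nat \<Rightarrow> (nat \<Rightarrow> nat \<Rightarrow> real) \<Rightarrow> nat set set \<Rightarrow> real" where
  "edge_weight n u E = (\<Prod>e\<in>all_edges n. if e \<in> E then u (Min e) (Max e) else 1 - u (Min e) (Max e))"

text \<open>Expand the product of \<open>u + (1 - u)\<close> over all edges.\<close>

lemma sum_edge_weight: "(\<Sum>E\<in>Pow (all_edges n). edge_weight n u E) = 1"
proof -
  let ?f = "\<lambda>e. u (Min e) (Max e)" and ?g = "\<lambda>e. 1 - u (Min e) (Max e)"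
  have "edge_weight n u E = prod ?f E * prod ?g (all_edges n - E)" if "E \<in> Pow (all_edges n)" for E
  proof -
    have "all_edges n \<inter> {e. e \<in> E} = E" "all_edges n \<inter> - {e. e \<in> E} = all_edges n - E" using that by auto
    then show ?thesis unfolding edge_weight_def by (subst prod.If_cases) auto
  qed
  then have "(\<Sum>E\<in>Pow (all_edges n). edge_weight n u E) = (\<Prod>e\<in>all_edges n. ?f e + ?g e)"
    unfolding prod_add[OF finite_all_edges] by (intro sum.cong) auto
  then show ?thesis by simp
qed

lemma edge_weight_nonneg: "(\<And>i j. u i j \<in> {0..1}) \<Longrightarrow> 0 \<le> edge_weight n u E"
  unfolding edge_weight_def by (rule prod_nonneg) auto

text \<open>Ensures that no factor in the weight of an edge set vanishes when \<open>u\<close>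
  consists of its own block averages, so that the logarithm of the product is the sum of the
  logarithms.\<close>

lemma cell_avg_member_pos:
  assumes "finite P" "q \<in> P" "\<And>p. p \<in> P \<Longrightarrow> 0 \<le> U p" "0 < U q"
  shows "0 < cell_avg P d U (d q)"
proof -
  have "0 < (\<Sum>p | p \<in> P \<and> d p = d q. U p)"
    by (rule sum_pos2[of _ q]) (use assms in auto)
  moreover have "0 < card {p \<in> P. d p = d q}" using assms by (auto simp: card_gt_0_iff)
  ultimately show ?thesis by (simp add: cell_avg_def)
qed

lemma cell_avg_one_minus:
  assumes "finite P" "q \<in> P"
  shows "cell_avg P d (\<lambda>p. 1 - U p) (d q) = 1 - cell_avg P d U (d q)"
proof -
  have "0 < card {p \<in> P. d p = d q}" using assms by (auto simp: card_gt_0_iff)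
  then show ?thesis by (simp add: cell_avg_def sum_subtractf diff_divide_distrib)
qed

text \<open>\<open>u\<close> consists of the block averages of \<open>E\<close>, and logarithms of
  \<open>u\<close> are constant on blocks. So in the logarithm of the weight the adjacency matrix
  may be replaced by \<open>u\<close>, which leaves minus the entropy. Passing from edges to all
  ordered pairs adds diagonal terms, and these are nonpositive.\<close>

lemma edge_weight_ge:
  assumes n: "n > 0" and E: "E \<subseteq> all_edges n"
    and u: "\<And>i j. u i j = block_avg n c (adjacency (n, E)) (c i) (c j)"
  shows "2 powr (- ((real n)\<^sup>2 * graphon_entropy (step n u)) / 2) \<le> edge_weight n u E"
proof -
  let ?A = "adjacency (n, E)"
  let ?d = "\<lambda>q. (c (fst q), c (snd q))"
  let ?U = "\<lambda>q. ?A (fst q) (snd q)"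
  have A: "?A i j \<in> {0..1}" "?A i j = ?A j i" for i j
    using adjacency_sym[of "(n, E)" i j] by (auto simp: adjacency_def)
  have u01: "u i j \<in> {0..1}" for i j unfolding u using block_avg_bounds[of ?A] A by blast
  have usym: "u i j = u j i" for i j unfolding u using block_avg_sym[of ?A] A by blast
  have ucell: "u (fst q) (snd q) = cell_avg (pairs n) ?d ?U (?d q)" for q
    by (simp add: u block_avg_def)
  define L where "L i j = ?A i j * log 2 (u i j) + (1 - ?A i j) * log 2 (1 - u i j)" for i j
  have Lsym: "L i j = L j i" for i j using A(2)[of i j] usym[of i j] by (simp add: L_def)
  let ?w = "\<lambda>e. if e \<in> E then u (Min e) (Max e) else 1 - u (Min e) (Max e)"
  have g: "graph_edges n (all_edges n)" by (simp add: graph_edges_def all_edges_def)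
  have w: "0 < ?w e" "log 2 (?w e) = L (Min e) (Max e)" if e: "e \<in> all_edges n" for e
  proof -
    note ge = graph_edge[OF g e]
    have q: "(Min e, Max e) \<in> pairs n" using ge by (simp add: pairs_def)
    have Ae: "?A (Min e) (Max e) = (if e \<in> E then 1 else 0)" using ge(4) by (simp add: adjacency_def)
    show "log 2 (?w e) = L (Min e) (Max e)" by (simp add: L_def Ae)
    show "0 < ?w e"
    proof (cases "e \<in> E")
      case True
      then show ?thesis
        using cell_avg_member_pos[of "pairs n" "(Min e, Max e)" ?U ?d] q Ae A(1) ucell[of "(Min e, Max e)"] by simp
    next
      case False
      then show ?thesis
        using cell_avg_member_pos[of "pairs n" "(Min e, Max e)" "\<lambda>q. 1 - ?U q" ?d] q Ae A(1)
          cell_avg_one_minus[of "pairs n" "(Min e, Max e)" ?d ?U] ucell[of "(Min e, Max e)"] by simp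
    qed
  qed
  have diag: "L i i \<le> 0" for i
  proof -
    have "{i} \<notin> E" using E by (auto simp: all_edges_def)
    then have "?A i i = 0" by (simp add: adjacency_def)
    then have "L i i = log 2 (1 - u i i)" by (simp add: L_def)
    moreover have "log 2 (1 - u i i) \<le> 0"
    proof (cases "u i i = 1")
      \<comment> \<open>The logarithm of 0 is 0 by convention.\<close>
      case True then show ?thesis by (simp add: log_def)
    next
      case False
      then have "0 < 1 - u i i" "1 - u i i \<le> 1" using u01[of i i] by auto
      then show ?thesis by simp
    qed
    ultimately show ?thesis by simp
  qed
  have "(\<Sum>q\<in>pairs n. L (fst q) (snd q)) = (\<Sum>q\<in>pairs n. ?U q * log 2 (u (fst q) (snd q)))
      + (\<Sum>q\<in>pairs n. (1 - ?U q) * log 2 (1 - u (fst q) (snd q)))"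
    by (simp add: L_def sum.distrib)
  also have "(\<Sum>q\<in>pairs n. ?U q * log 2 (u (fst q) (snd q)))
      = (\<Sum>q\<in>pairs n. cell_avg (pairs n) ?d ?U (?d q) * log 2 (u (fst q) (snd q)))"
    by (rule sum_cell_avg[symmetric]) (auto simp: u)
  also have "(\<Sum>q\<in>pairs n. (1 - ?U q) * log 2 (1 - u (fst q) (snd q)))
      = (\<Sum>q\<in>pairs n. cell_avg (pairs n) ?d (\<lambda>q. 1 - ?U q) (?d q) * log 2 (1 - u (fst q) (snd q)))"
    by (rule sum_cell_avg[symmetric]) (auto simp: u)
  also have "\<dots> = (\<Sum>q\<in>pairs n. (1 - cell_avg (pairs n) ?d ?U (?d q)) * log 2 (1 - u (fst q) (snd q)))"
    by (rule sum.cong[OF refl]) (simp add: cell_avg_one_minus[of "pairs n" _ ?d ?U])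
  finally have "(\<Sum>q\<in>pairs n. L (fst q) (snd q)) = (\<Sum>q\<in>pairs n. - binary_entropy (u (fst q) (snd q)))"
    unfolding ucell[symmetric]
    by (simp add: sum.distrib[symmetric] binary_entropy_def algebra_simps)
  also have "\<dots> = - ((real n)\<^sup>2 * graphon_entropy (step n u))"
    using n by (simp add: graphon_entropy_step sum_negf pairs_def sum.cartesian_product case_prod_unfold)
  finally have total: "(\<Sum>q\<in>pairs n. L (fst q) (snd q)) = - ((real n)\<^sup>2 * graphon_entropy (step n u))" .
  have "{q \<in> pairs n. fst q \<noteq> snd q} \<union> {q \<in> pairs n. fst q = snd q} = pairs n" by auto
  then have "(\<Sum>q\<in>pairs n. L (fst q) (snd q)) = (\<Sum>q | q \<in> pairs n \<and> fst q \<noteq> snd q. L (fst q) (snd q))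
      + (\<Sum>q | q \<in> pairs n \<and> fst q = snd q. L (fst q) (snd q))"
    using sum.union_disjoint[of "{q \<in> pairs n. fst q \<noteq> snd q}" "{q \<in> pairs n. fst q = snd q}" "\<lambda>q. L (fst q) (snd q)"]
    by fastforce
  moreover have "(\<Sum>q | q \<in> pairs n \<and> fst q = snd q. L (fst q) (snd q)) \<le> 0"
    by (rule sum_nonpos) (use diag in auto)
  ultimately have "- ((real n)\<^sup>2 * graphon_entropy (step n u)) \<le> 2 * (\<Sum>e\<in>all_edges n. L (Min e) (Max e))"
    using all_edges_sum[of L n, OF Lsym] total by simp
  also have "(\<Sum>e\<in>all_edges n. L (Min e) (Max e)) = (\<Sum>e\<in>all_edges n. log 2 (?w e))"
    by (rule sum.cong) (use w in auto)
  also have "\<dots> = log 2 (\<Prod>e\<in>all_edges n. ?w e)"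
  proof -
    have "?w e \<noteq> 0" if "e \<in> all_edges n" for e using w(1)[OF that] by (rule less_imp_neq[symmetric])
    then show ?thesis unfolding log_def by (subst ln_prod) (simp_all only: finite_all_edges sum_divide_distrib not_False_eq_True)
  qed
  finally have "- ((real n)\<^sup>2 * graphon_entropy (step n u)) / 2 \<le> log 2 (edge_weight n u E)"
    by (simp add: edge_weight_def)
  moreover have "0 < edge_weight n u E"
    unfolding edge_weight_def by (rule prod_pos) (use w(1) in blast)
  ultimately show ?thesis by (simp add: le_log_iff)
qed

text \<open>All members of \<open>B\<close> have the same averages \<open>u\<close>, so in one and
  the same random graph each has at least the probability given by \<open>edge_weight_ge\<close>;
  these probabilities add up to at most 1.\<close>

lemma card_block_structure_le:
  assumes n: "n > 0" and B: "B \<subseteq> Pow (all_edges n)"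
    and u: "\<And>E i j. E \<in> B \<Longrightarrow> u i j = block_avg n c (adjacency (n, E)) (c i) (c j)"
  shows "card B \<le> 2 powr ((real n)\<^sup>2 * graphon_entropy (step n u) / 2)"
proof (cases "B = {}")
  case False
  then obtain E0 where "E0 \<in> B" by blast
  then have u01: "u i j \<in> {0..1}" for i j
    using block_avg_bounds[of "adjacency (n, E0)" n c] u[of E0] by (auto simp: adjacency_def)
  let ?x = "2 powr (- ((real n)\<^sup>2 * graphon_entropy (step n u)) / 2)"
  have "card B * ?x = (\<Sum>E\<in>B. ?x)" by simp
  also have "\<dots> \<le> (\<Sum>E\<in>B. edge_weight n u E)"
  proof (rule sum_mono)
    fix E assume "E \<in> B"
    then show "?x \<le> edge_weight n u E" using B u by (intro edge_weight_ge[OF n, of E u c]) auto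
  qed
  also have "\<dots> \<le> (\<Sum>E\<in>Pow (all_edges n). edge_weight n u E)"
    by (rule sum_mono2) (use B edge_weight_nonneg[of u, OF u01] in auto)
  also have "\<dots> = 1" by (rule sum_edge_weight)
  finally show ?thesis by (simp add: powr_minus field_simps)
qed simp

text \<open>For a given partition these integers determine the block averages, and each has at most
  \<open>n\<^sup>2 + 1\<close> possible values. Ordered pairs are counted, so an edge inside a block
  counts twice.\<close>

definition block_count :: "nat \<Rightarrow> (nat \<Rightarrow> nat) \<Rightarrow> nat set set \<Rightarrow> nat \<times> nat \<Rightarrow> nat" where
  "block_count n c E v = card {q \<in> pairs n. (c (fst q), c (snd q)) = v \<and> {fst q, snd q} \<in> E}"

lemma block_avg_count:
  "block_avg n c (adjacency (n, E)) u v = block_count n c E (u, v) / card {q \<in> pairs n. (c (fst q), c (snd q)) = (u, v)}"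
proof -
  have "(\<Sum>q | q \<in> pairs n \<and> (c (fst q), c (snd q)) = (u, v). adjacency (n, E) (fst q) (snd q))
     = (\<Sum>q | q \<in> pairs n \<and> (c (fst q), c (snd q)) = (u, v) \<and> {fst q, snd q} \<in> E. 1)"
    by (rule sum.mono_neutral_cong_right) (auto simp: adjacency_def)
  then show ?thesis by (simp add: block_avg_def cell_avg_def block_count_def)
qed

text \<open>\<open>E\<close> is chosen with the largest entropy, which bounds all fibres of
  \<open>key\<close> at once; the first factor is the number of keys.\<close>

lemma exists_large_entropy:
  assumes n: "n > 0" and B: "B \<subseteq> Pow (all_edges n)" "B \<noteq> {}"
    and c: "\<And>E i. E \<in> B \<Longrightarrow> c E i < (p :: nat)"
  obtains E where "E \<in> B"
    "card B \<le> real (p ^ n * (n\<^sup>2 + 1) ^ p\<^sup>2) *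
       2 powr ((real n)\<^sup>2 * graphon_entropy (step n (\<lambda>i j. block_avg n (c E) (adjacency (n, E)) (c E i) (c E j))) / 2)"
proof -
  define h where "h E = graphon_entropy (step n (\<lambda>i j. block_avg n (c E) (adjacency (n, E)) (c E i) (c E j)))" for E
  have fB: "finite B" using B(1) by (rule finite_subset) simp
  define s where "s = Max (h ` B)"
  have hs: "h E \<le> s" if "E \<in> B" for E using that fB by (simp add: s_def)
  have "s \<in> h ` B" unfolding s_def using fB B(2) by (intro Max_in) auto
  then obtain E0 where E0: "E0 \<in> B" "h E0 = s" by blast
  define I where "I = {1..n}"
  \<comment> \<open>Equal keys mean the same partition of \<open>{1..n}\<close> and the same block
    averages. Restricting both functions leaves finitely many keys.\<close>
  define key where "key E = (restrict (c E) I, restrict (block_count n (c E) E) ({..<p} \<times> {..<p}))" for E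
  define Keys where "Keys = (I \<rightarrow>\<^sub>E {..<p}) \<times> (({..<p} \<times> {..<p}) \<rightarrow>\<^sub>E {..n\<^sup>2})"
  have "card (I \<rightarrow>\<^sub>E {..<p}) = p ^ n" by (simp add: card_PiE I_def)
  moreover have "card (({..<p} \<times> {..<p}) \<rightarrow>\<^sub>E {..n\<^sup>2}) = (n\<^sup>2 + 1) ^ p\<^sup>2"
    by (simp add: card_PiE power2_eq_square)
  ultimately have cK: "card Keys = p ^ n * (n\<^sup>2 + 1) ^ p\<^sup>2" by (simp add: Keys_def card_cartesian_product)
  have fK: "finite Keys" unfolding Keys_def by (intro finite_cartesian_product finite_PiE) (auto simp: I_def)
  have key: "key E \<in> Keys" if "E \<in> B" for E
  proof -
    have "block_count n (c E) E v \<le> card (pairs n)" for v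
      unfolding block_count_def by (rule card_mono) auto
    then show ?thesis using c[OF that] by (auto simp: key_def Keys_def)
  qed
  have fiber: "card {E \<in> B. key E = k} \<le> 2 powr ((real n)\<^sup>2 * s / 2)" for k
  proof (cases "\<exists>E\<in>B. key E = k")
    case False
    then have "{E \<in> B. key E = k} = {}" by blast
    then show ?thesis by (simp only: card.empty) simp
  next
    case True
    then obtain E1 where E1: "E1 \<in> B" "key E1 = k" by blast
    define v where "v i j = block_avg n (c E1) (adjacency (n, E1)) (c E1 i) (c E1 j)" for i j
    have "card {E \<in> B. key E = k} \<le> 2 powr ((real n)\<^sup>2 * graphon_entropy (step n v) / 2)"
    proof (rule card_block_structure_le[OF n, where c = "c E1"])
      show "{E \<in> B. key E = k} \<subseteq> Pow (all_edges n)" using B by auto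
      fix E i j assume "E \<in> {E \<in> B. key E = k}"
      then have E: "E \<in> B" "key E = key E1" using E1 by auto
      have ceq: "c E i = c E1 i" if "i \<in> I" for i
        using E(2) that by (auto simp: key_def dest!: fun_cong[of _ _ i])
      have q: "{q \<in> pairs n. (c E (fst q), c E (snd q)) = w \<and> P q}
          = {q \<in> pairs n. (c E1 (fst q), c E1 (snd q)) = w \<and> P q}" for w P
        using ceq by (auto simp: pairs_def I_def)
      have "block_count n (c E) E w = block_count n (c E1) E1 w" if "w \<in> {..<p} \<times> {..<p}" for w
        using E(2) that by (auto simp: key_def dest!: fun_cong[of _ _ w])
      then have "block_count n (c E1) E w = block_count n (c E1) E1 w" if "w \<in> {..<p} \<times> {..<p}" for w
        using that unfolding block_count_def q .
      then show "v i j = block_avg n (c E1) (adjacency (n, E)) (c E1 i) (c E1 j)"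
        using c[OF E1(1)] by (simp add: v_def block_avg_count)
    qed
    also have "\<dots> \<le> 2 powr ((real n)\<^sup>2 * s / 2)"
      using hs[OF E1(1)] unfolding h_def v_def[symmetric]
      by (intro powr_mono divide_right_mono mult_left_mono) simp_all
    finally show ?thesis .
  qed
  have "(\<Union>k\<in>Keys. {E \<in> B. key E = k}) = B" using key by auto
  from card_UN_le[OF fK, of "\<lambda>k. {E \<in> B. key E = k}", unfolded this]
  have "real (card B) \<le> (\<Sum>k\<in>Keys. real (card {E \<in> B. key E = k}))"
    unfolding of_nat_sum[symmetric] of_nat_le_iff .
  also have "\<dots> \<le> (\<Sum>k\<in>Keys. 2 powr ((real n)\<^sup>2 * s / 2))" by (rule sum_mono) (rule fiber)
  also have "\<dots> = real (p ^ n * (n\<^sup>2 + 1) ^ p\<^sup>2) * 2 powr ((real n)\<^sup>2 * h E0 / 2)" by (simp add: cK E0)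
  finally show ?thesis using that[OF E0(1)] by (simp add: h_def)
qed

text \<open>The first two terms are the logarithm of the number of keys. Since \<open>p\<close>
  depends on the accuracy alone and not on \<open>n\<close>, they are of lower order than
  \<open>n\<^sup>2\<close>.\<close>

lemma entropy_counting:
  fixes \<epsilon> :: real
  assumes "\<epsilon> > 0"
  obtains p :: nat where "p > 0"
    "\<And>(n :: nat) B. n > 0 \<Longrightarrow> B \<noteq> {} \<Longrightarrow> (\<And>G. G \<in> B \<Longrightarrow> is_graph G \<and> fst G = n) \<Longrightarrow>
      \<exists>G\<in>B. \<exists>V\<in>graphons. cut_dist (graph_graphon G) V \<le> \<epsilon> \<and>
        log 2 (card B) \<le> n * log 2 p + p\<^sup>2 * log 2 (n\<^sup>2 + 1) + (real n)\<^sup>2 * graphon_entropy V / 2"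
proof -
  obtain p :: nat where p: "p > 0" "\<And>n U. n > 0 \<Longrightarrow> (\<And>i j. U i j \<in> {0..1}) \<Longrightarrow>
    \<exists>c. (\<forall>i. c i < p) \<and> block_regular n c U \<epsilon>"
    using weak_regularity[OF assms] by blast
  have "\<exists>G\<in>B. \<exists>V\<in>graphons. cut_dist (graph_graphon G) V \<le> \<epsilon> \<and>
        log 2 (card B) \<le> n * log 2 p + p\<^sup>2 * log 2 (n\<^sup>2 + 1) + (real n)\<^sup>2 * graphon_entropy V / 2"
    if n: "n > 0" and ne: "B \<noteq> {}" and B: "\<And>G. G \<in> B \<Longrightarrow> is_graph G \<and> fst G = n"
    for n :: nat and B :: "graph set"
  proof -
    have A01: "adjacency G i j \<in> {0..1}" for G i j by (simp add: adjacency_def)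
    have "\<forall>E. \<exists>c. (\<forall>i. c i < p) \<and> block_regular n c (adjacency (n, E)) \<epsilon>"
      using p(2)[of n "adjacency (n, E)" for E, OF n A01] by blast
    from choice[OF this] obtain c where c: "\<And>E i. c E i < p" "\<And>E. block_regular n (c E) (adjacency (n, E)) \<epsilon>"
      by blast
    have inj: "inj_on snd B" using B by (auto simp: inj_on_def prod_eq_iff)
    have sub: "snd ` B \<subseteq> Pow (all_edges n)"
      unfolding all_edges_def using B unfolding is_graph_def by blast
    obtain E where E: "E \<in> snd ` B" and
      le: "card (snd ` B) \<le> real (p ^ n * (n\<^sup>2 + 1) ^ p\<^sup>2) *
       2 powr ((real n)\<^sup>2 * graphon_entropy (step n (\<lambda>i j. block_avg n (c E) (adjacency (n, E)) (c E i) (c E j))) / 2)"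
      using exists_large_entropy[OF n sub, of c p] c(1) ne by blast
    define V where "V = step n (\<lambda>i j. block_avg n (c E) (adjacency (n, E)) (c E i) (c E j))"
    have Vg: "V \<in> graphons"
      unfolding V_def
    proof (rule step_graphon)
      show "block_avg n (c E) (adjacency (n, E)) (c E i) (c E j) = block_avg n (c E) (adjacency (n, E)) (c E j) (c E i)" for i j
        by (rule block_avg_sym) (rule adjacency_sym)
      show "block_avg n (c E) (adjacency (n, E)) (c E i) (c E j) \<in> {0..1}" for i j
        by (rule block_avg_bounds) (rule A01)
    qed
    obtain G where G: "G \<in> B" "snd G = E" using E by blast
    then have GE: "G = (n, E)" using B[OF G(1)] by (auto simp: prod_eq_iff)
    have "cut_dist (graph_graphon G) V \<le> cut_norm (\<lambda>x y. graph_graphon G x y - V x y)"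
      by (rule cut_dist_le_cut_norm[OF graph_graphon_graphon Vg])
    also have "\<dots> \<le> \<epsilon>"
      using block_regular_cut_norm[OF n c(2)] unfolding graph_graphon_step GE V_def by simp
    finally have 1: "cut_dist (graph_graphon G) V \<le> \<epsilon>" .
    have cB: "card (snd ` B) = card B" by (rule card_image[OF inj])
    have "finite (snd ` B)" using sub by (rule finite_subset) simp
    then have pos: "0 < real (card B)" using ne finite_imageD[OF _ inj] by (simp add: card_gt_0_iff)
    have "log 2 (card B) \<le> log 2 (real (p ^ n * (n\<^sup>2 + 1) ^ p\<^sup>2) * 2 powr ((real n)\<^sup>2 * graphon_entropy V / 2))"
      using le pos p(1) unfolding cB V_def[symmetric] by (subst log_le_cancel_iff) auto
    also have "\<dots> = log 2 (real p ^ n) + log 2 (real (n\<^sup>2 + 1) ^ p\<^sup>2) + (real n)\<^sup>2 * graphon_entropy V / 2"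
    proof -
      have "0 < real p ^ n" "0 < real (n\<^sup>2 + 1) ^ p\<^sup>2"
        by (rule zero_less_power, use p(1) in simp, rule zero_less_power, simp only: of_nat_0_less_iff add_gr_0 zero_less_one simp_thms)
      then show ?thesis
        unfolding of_nat_mult of_nat_power[of p n] of_nat_power[of "n\<^sup>2 + 1" "p\<^sup>2"]
        by (simp add: log_mult del: of_nat_add of_nat_power)
    qed
    also have "\<dots> = n * log 2 p + p\<^sup>2 * log 2 (n\<^sup>2 + 1) + (real n)\<^sup>2 * graphon_entropy V / 2"
      using p(1) by (simp add: log_nat_power)
    finally show ?thesis using G(1) Vg 1 by blast
  qed
  then show ?thesis using that[OF p(1)] by blast
qed

subsection \<open>Limits of large sets of graphs\<close>

lemma graph_point_limit_of: "graph_point G = limit_of (graph_graphon G)"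
  by (simp add: graph_point_def limit_of_def)

lemma graph_point_in: "graph_point G \<in> graph_limits"
  unfolding graph_point_limit_of by (rule limit_of_in[OF graph_graphon_graphon])

lemma delta_cut_graph_point:
  "\<Lambda> \<in> graph_limits \<Longrightarrow> delta_cut (graph_point G) \<Lambda> = cut_dist (graph_graphon G) (rep \<Lambda>)"
  using cut_dist_rep_limit_of_right[OF rep_graphon graph_graphon_graphon, of \<Lambda> G]
    cut_dist_commute[OF rep_graphon[OF graph_point_in] rep_graphon, of \<Lambda> G]
    cut_dist_commute[OF graph_graphon_graphon rep_graphon, of \<Lambda> G]
  by (simp add: delta_cut_def graph_point_limit_of)

lemma class_limitsI:
  assumes \<Lambda>: "\<Lambda> \<in> graph_limits" and G: "\<And>k. G k \<in> Q" and inf: "filterlim (\<lambda>k. fst (G k)) at_top sequentially"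
    and lim: "(\<lambda>k. cut_dist (graph_graphon (G k)) (rep \<Lambda>)) \<longlonglongrightarrow> 0"
  shows "\<Lambda> \<in> class_limits Q"
proof -
  have "(\<lambda>k. hom_density F (G k)) \<longlonglongrightarrow> graphon_density F (rep \<Lambda>)" if F: "is_graph F" for F
  proof (rule LIM_zero_cancel, rule Lim_null_comparison)
    show "(\<lambda>k. card (snd F) * cut_dist (graph_graphon (G k)) (rep \<Lambda>)) \<longlonglongrightarrow> 0"
      using tendsto_mult_right_zero[OF lim] .
    \<comment> \<open>\<open>graphon_density_graph\<close> requires at least one vertex.\<close>
    have "\<forall>\<^sub>F k in sequentially. 1 \<le> fst (G k)" using inf by (simp add: filterlim_at_top)
    then show "\<forall>\<^sub>F k in sequentially. norm (hom_density F (G k) - graphon_density F (rep \<Lambda>))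
        \<le> card (snd F) * cut_dist (graph_graphon (G k)) (rep \<Lambda>)"
    proof eventually_elim
      case (elim k)
      then show ?case
        using graphon_density_cut_dist[OF F graph_graphon_graphon rep_graphon[OF \<Lambda>], of "G k"]
          graphon_density_graph[OF F, of "G k"] by simp
    qed
  qed
  then show ?thesis using \<Lambda> G inf by (auto simp: class_limits_def converges_to_def)
qed

text \<open>A diagonal sequence works: densities are continuous for the cut metric, and at stage \<open>k\<close> only
  the finitely many \<open>F\<close> with at most \<open>k\<close> vertices are tested.\<close>

lemma class_limits_closed:
  assumes \<Gamma>: "\<And>k. \<Gamma> k \<in> class_limits Q" and \<Lambda>: "\<Lambda> \<in> graph_limits"
    and lim: "(\<lambda>k. delta_cut (\<Gamma> k) \<Lambda>) \<longlonglongrightarrow> 0"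
  shows "\<Lambda> \<in> class_limits Q"
proof -
  have \<Gamma>g: "\<Gamma> k \<in> graph_limits" for k using \<Gamma> by (auto simp: class_limits_def)
  have "\<forall>k. \<exists>G. G \<in> Q \<and> k \<le> fst G \<and> (\<forall>F. is_graph F \<and> fst F \<le> k \<longrightarrow>
      \<bar>hom_density F G - graphon_density F (rep (\<Gamma> k))\<bar> < inverse (real (Suc k)))"
  proof
    fix k
    obtain G where G: "\<And>j. G j \<in> Q" "filterlim (\<lambda>j. fst (G j)) at_top sequentially" "converges_to G (\<Gamma> k)"
      using \<Gamma>[of k] by (auto simp: class_limits_def)
    define \<F> where "\<F> = {F. is_graph F \<and> fst F \<le> k}"
    have "\<F> \<subseteq> {..k} \<times> Pow (Pow {1..k})"
      by (force simp: \<F>_def is_graph_def)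
    then have "finite \<F>" by (rule finite_subset) simp
    moreover have "\<forall>\<^sub>F j in sequentially. \<bar>hom_density F (G j) - graphon_density F (rep (\<Gamma> k))\<bar> < inverse (real (Suc k))"
      if "F \<in> \<F>" for F
    proof -
      have "(\<lambda>j. hom_density F (G j)) \<longlonglongrightarrow> graphon_density F (rep (\<Gamma> k))"
        using G(3) that unfolding converges_to_def \<F>_def by blast
      from tendstoD[OF this, of "inverse (real (Suc k))"] show ?thesis by (simp add: dist_real_def)
    qed
    ultimately have "\<forall>\<^sub>F j in sequentially. \<forall>F\<in>\<F>. \<bar>hom_density F (G j) - graphon_density F (rep (\<Gamma> k))\<bar> < inverse (real (Suc k))"
      by (simp add: eventually_ball_finite)
    moreover have "\<forall>\<^sub>F j in sequentially. k \<le> fst (G j)" using G(2) by (simp add: filterlim_at_top)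
    ultimately have "\<forall>\<^sub>F j in sequentially. k \<le> fst (G j) \<and>
       (\<forall>F\<in>\<F>. \<bar>hom_density F (G j) - graphon_density F (rep (\<Gamma> k))\<bar> < inverse (real (Suc k)))"
      by eventually_elim simp
    then obtain j where "k \<le> fst (G j)"
       "\<forall>F\<in>\<F>. \<bar>hom_density F (G j) - graphon_density F (rep (\<Gamma> k))\<bar> < inverse (real (Suc k))"
      using eventually_happens'[OF sequentially_bot] by blast
    then show "\<exists>G. G \<in> Q \<and> k \<le> fst G \<and> (\<forall>F. is_graph F \<and> fst F \<le> k \<longrightarrow>
      \<bar>hom_density F G - graphon_density F (rep (\<Gamma> k))\<bar> < inverse (real (Suc k)))"
      using G(1)[of j] unfolding \<F>_def by blast
  qed
  from choice[OF this] obtain G where G: "\<And>k. G k \<in> Q" "\<And>k. k \<le> fst (G k)"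
    "\<And>k F. is_graph F \<Longrightarrow> fst F \<le> k \<Longrightarrow>
      \<bar>hom_density F (G k) - graphon_density F (rep (\<Gamma> k))\<bar> < inverse (real (Suc k))" by blast
  have "filterlim (\<lambda>k. fst (G k)) at_top sequentially"
    by (rule filterlim_at_top_mono[OF filterlim_ident]) (simp add: G(2))
  moreover have "(\<lambda>k. hom_density F (G k)) \<longlonglongrightarrow> graphon_density F (rep \<Lambda>)" if F: "is_graph F" for F
  proof (rule LIM_zero_cancel, rule Lim_null_comparison)
    have "(\<lambda>k. inverse (real (Suc k)) + card (snd F) * delta_cut (\<Gamma> k) \<Lambda>) \<longlonglongrightarrow> 0 + real (card (snd F)) * 0"
      by (intro tendsto_add LIMSEQ_inverse_real_of_nat tendsto_mult tendsto_const lim)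
    then show "(\<lambda>k. inverse (real (Suc k)) + card (snd F) * delta_cut (\<Gamma> k) \<Lambda>) \<longlonglongrightarrow> 0" by simp
    show "\<forall>\<^sub>F k in sequentially. norm (hom_density F (G k) - graphon_density F (rep \<Lambda>))
        \<le> inverse (real (Suc k)) + card (snd F) * delta_cut (\<Gamma> k) \<Lambda>"
      using eventually_ge_at_top[of "fst F"]
    proof eventually_elim
      case (elim k)
      then show ?case
        using graphon_density_cut_dist[OF F rep_graphon[OF \<Gamma>g] rep_graphon[OF \<Lambda>], of k] G(3)[OF F, of k]
        by (simp add: delta_cut_def)
    qed
  qed
  ultimately show ?thesis using \<Lambda> G(1) by (auto simp: class_limits_def converges_to_def)
qed

lemma Ent_upper_semicontinuous:
  assumes "\<And>k. \<Gamma> k \<in> graph_limits" "\<Lambda> \<in> graph_limits" "(\<lambda>k. delta_cut (\<Gamma> k) \<Lambda>) \<longlonglongrightarrow> 0"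
    and "s \<longlonglongrightarrow> s0" "\<And>k. s k \<le> Ent (\<Gamma> k)"
  shows "s0 \<le> Ent \<Lambda>"
proof -
  have "s0 \<le> graphon_entropy (rep \<Lambda>)"
    by (rule entropy_upper_semicontinuous[where V = "\<lambda>k. rep (\<Gamma> k)" and s = s])
       (use assms in \<open>auto simp: delta_cut_def Ent_eq rep_graphon\<close>)
  then show ?thesis using Ent_eq[OF assms(2)] by simp
qed

lemma Ent_le_1: "\<Gamma> \<in> graph_limits \<Longrightarrow> Ent \<Gamma> \<le> 1"
  using graphon_entropy_le_1[OF rep_graphon] Ent_eq by simp

text \<open>A maximising sequence has a convergent subsequence whose limit stays in the class and
  loses no entropy. Attainment is also what gives the \<open>GREATEST\<close> in
  \<open>max_Ent\<close> its intended value.\<close>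

lemma max_Ent_attained:
  assumes "class_limits Q \<noteq> {}"
  shows "\<exists>\<Lambda>\<in>class_limits Q. Ent \<Lambda> = max_Ent Q \<and> (\<forall>\<Gamma>\<in>class_limits Q. Ent \<Gamma> \<le> Ent \<Lambda>)"
proof -
  define S where "S = Sup (Ent ` class_limits Q)"
  have sub: "class_limits Q \<subseteq> graph_limits" by (auto simp: class_limits_def)
  have bdd: "bdd_above (Ent ` class_limits Q)" using Ent_le_1 sub by (auto intro!: bdd_aboveI[where M = 1])
  have le: "Ent \<Gamma> \<le> S" if "\<Gamma> \<in> class_limits Q" for \<Gamma>
    unfolding S_def using that bdd by (intro cSup_upper) auto
  have "\<forall>k. \<exists>\<Gamma>. \<Gamma> \<in> class_limits Q \<and> S - inverse (real (Suc k)) \<le> Ent \<Gamma>"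
  proof
    fix k :: nat
    have "S - inverse (real (Suc k)) < Sup (Ent ` class_limits Q)" by (simp add: S_def)
    then show "\<exists>\<Gamma>. \<Gamma> \<in> class_limits Q \<and> S - inverse (real (Suc k)) \<le> Ent \<Gamma>"
      using less_cSupD[of "Ent ` class_limits Q"] assms by (blast intro: less_imp_le)
  qed
  from choice[OF this] obtain \<Gamma> where \<Gamma>: "\<And>k. \<Gamma> k \<in> class_limits Q"
    "\<And>k. S - inverse (real (Suc k)) \<le> Ent (\<Gamma> k)" by blast
  have \<Gamma>g: "\<Gamma> k \<in> graph_limits" for k using \<Gamma>(1) sub by blast
  obtain r \<Lambda> where r: "strict_mono r" "\<Lambda> \<in> graph_limits" "(\<lambda>k. delta_cut (\<Gamma> (r k)) \<Lambda>) \<longlonglongrightarrow> 0"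
    using graph_limits_subsequence[of \<Gamma>, OF \<Gamma>g] by blast
  have \<Lambda>: "\<Lambda> \<in> class_limits Q" by (rule class_limits_closed[OF \<Gamma>(1) r(2,3)])
  have "(\<lambda>k. S - inverse (real (Suc k))) \<longlonglongrightarrow> S - 0"
    by (intro tendsto_diff tendsto_const LIMSEQ_inverse_real_of_nat)
  then have "S \<le> Ent \<Lambda>"
    using LIMSEQ_subseq_LIMSEQ[OF _ r(1)] \<Gamma>(2)
    by (intro Ent_upper_semicontinuous[OF \<Gamma>g r(2,3), of "\<lambda>k. S - inverse (real (Suc (r k)))"]) (auto simp: o_def)
  then have all: "\<forall>\<Gamma>\<in>class_limits Q. Ent \<Gamma> \<le> Ent \<Lambda>" using le by force
  moreover have "max_Ent Q = Ent \<Lambda>"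
    unfolding max_Ent_def by (rule Greatest_equality) (use \<Lambda> all in auto)
  ultimately show ?thesis using \<Lambda> by auto
qed

text \<open>The lower-order terms of \<open>entropy_counting\<close> divided by
  \<open>n\<^sup>2 / 2\<close>, plus a slack of \<open>1 / n\<close>.\<close>

lemma counting_error_tendsto:
  assumes "p > 0"
  shows "(\<lambda>n. 1 / real n + 2 * log 2 (real p) / real n + 2 * real (p\<^sup>2) * log 2 ((real n)\<^sup>2 + 1) / (real n)\<^sup>2) \<longlonglongrightarrow> 0"
  by real_asymp

text \<open>The growth rate of \<open>B k\<close> reappears, up to a vanishing error, as the entropy
  of the block averages of some graph in \<open>B k\<close>. Graph and averages are cut-close, so
  they share a limit: the graphs put it into the class, the averages give it the entropy.\<close>

lemma limit_of_large_sets: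
  fixes B :: "nat \<Rightarrow> graph set" and \<nu> :: "nat \<Rightarrow> nat"
  assumes inf: "filterlim \<nu> at_top sequentially"
    and B: "\<And>k. B k \<noteq> {}" "\<And>k. B k \<subseteq> labeled Q (\<nu> k)" and Q: "graph_class Q"
    and s: "s \<longlonglongrightarrow> s0" "\<And>k. s k * real (\<nu> k choose 2) \<le> log 2 (card (B k))"
  obtains \<kappa> G \<Lambda> where "\<And>j. G j \<in> B (\<kappa> j)" "\<Lambda> \<in> class_limits Q" "s0 \<le> Ent \<Lambda>"
    "(\<lambda>j. delta_cut (graph_point (G j)) \<Lambda>) \<longlonglongrightarrow> 0"
proof -
  have BG: "is_graph G \<and> fst G = \<nu> k" if "G \<in> B k" for G k
    using B(2)[of k] that Q by (auto simp: labeled_def graph_class_def)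
  define \<epsilon> where "\<epsilon> j = inverse (real (Suc j))" for j
  have \<epsilon>0: "\<epsilon> \<longlonglongrightarrow> 0" unfolding \<epsilon>_def[abs_def] by (rule LIMSEQ_inverse_real_of_nat)
  \<comment> \<open>Index, graph and averaged graphon are packed into a triple, so that
    \<open>choice\<close> yields a single function.\<close>
  have "\<forall>j. \<exists>kGV. j \<le> fst kGV \<and> fst (snd kGV) \<in> B (fst kGV) \<and> j \<le> \<nu> (fst kGV) \<and> snd (snd kGV) \<in> graphons
      \<and> cut_dist (graph_graphon (fst (snd kGV))) (snd (snd kGV)) \<le> \<epsilon> j
      \<and> s0 - \<epsilon> j \<le> graphon_entropy (snd (snd kGV))"
  proof
    fix j
    have ej: "\<epsilon> j > 0" by (simp add: \<epsilon>_def)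
    obtain p :: nat where p: "p > 0"
      "\<And>(n :: nat) B. n > 0 \<Longrightarrow> B \<noteq> {} \<Longrightarrow> (\<And>G. G \<in> B \<Longrightarrow> is_graph G \<and> fst G = n) \<Longrightarrow>
        \<exists>G\<in>B. \<exists>V\<in>graphons. cut_dist (graph_graphon G) V \<le> \<epsilon> j \<and>
          log 2 (card B) \<le> n * log 2 p + p\<^sup>2 * log 2 (n\<^sup>2 + 1) + (real n)\<^sup>2 * graphon_entropy V / 2"
      using entropy_counting[OF ej] by blast
    let ?err = "\<lambda>n. 1 / real n + 2 * log 2 (real p) / real n + 2 * real (p\<^sup>2) * log 2 ((real n)\<^sup>2 + 1) / (real n)\<^sup>2"
    \<comment> \<open>Here \<open>j\<close> and with it \<open>p\<close> are fixed, so
      \<open>k\<close> can still be taken large enough for the error to become negligible. The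
      factor \<open>1 - 1/n\<close> comes from comparing \<open>n choose 2\<close> with
      \<open>n\<^sup>2 / 2\<close>.\<close>
    have "(\<lambda>k. s k * (1 - 1 / real (\<nu> k)) - ?err (\<nu> k)) \<longlonglongrightarrow> s0 * (1 - 0) - 0"
      by (intro tendsto_diff tendsto_mult s(1) tendsto_const
          filterlim_compose[OF counting_error_tendsto[OF p(1)] inf]
          filterlim_compose[OF lim_1_over_n inf])
    then have "\<forall>\<^sub>F k in sequentially. s0 - \<epsilon> j < s k * (1 - 1 / real (\<nu> k)) - ?err (\<nu> k)"
      using order_tendstoD(1)[of _ s0 sequentially "s0 - \<epsilon> j"] ej by simp
    moreover have "\<forall>\<^sub>F k in sequentially. max 1 j \<le> \<nu> k" using inf unfolding filterlim_at_top by blast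
    moreover have "\<forall>\<^sub>F k in sequentially. j \<le> k" by (rule eventually_ge_at_top)
    ultimately have "\<forall>\<^sub>F k in sequentially. s0 - \<epsilon> j < s k * (1 - 1 / real (\<nu> k)) - ?err (\<nu> k) \<and> max 1 j \<le> \<nu> k \<and> j \<le> k"
      by eventually_elim simp
    then obtain k where k: "s0 - \<epsilon> j < s k * (1 - 1 / real (\<nu> k)) - ?err (\<nu> k)" "max 1 j \<le> \<nu> k" "j \<le> k"
      using eventually_happens'[OF sequentially_bot] by blast
    define n where "n = \<nu> k"
    have n: "n > 0" "real n > 0" using k(2) by (auto simp: n_def)
    obtain G V where GV: "G \<in> B k" "V \<in> graphons" "cut_dist (graph_graphon G) V \<le> \<epsilon> j"
      "log 2 (card (B k)) \<le> n * log 2 p + p\<^sup>2 * log 2 (n\<^sup>2 + 1) + (real n)\<^sup>2 * graphon_entropy V / 2"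
      using p(2)[OF n(1) B(1), of k] BG unfolding n_def by blast
    have ch: "real (n choose 2) = (real n)\<^sup>2 * (1 - 1 / real n) / 2"
      using n by (simp add: choose_two real_of_nat_div power2_eq_square field_simps of_nat_diff)
    have "s k * ((real n)\<^sup>2 * (1 - 1 / real n) / 2)
        \<le> n * log 2 p + p\<^sup>2 * log 2 (n\<^sup>2 + 1) + (real n)\<^sup>2 * graphon_entropy V / 2"
      using order_trans[OF s(2)[of k] GV(4)] unfolding n_def[symmetric] ch .
    then have "s k * ((real n)\<^sup>2 * (1 - 1 / real n) / 2) * (2 / (real n)\<^sup>2)
        \<le> (n * log 2 p + p\<^sup>2 * log 2 (n\<^sup>2 + 1) + (real n)\<^sup>2 * graphon_entropy V / 2) * (2 / (real n)\<^sup>2)"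
      by (intro mult_right_mono) auto
    moreover have "s k * ((real n)\<^sup>2 * (1 - 1 / real n) / 2) * (2 / (real n)\<^sup>2) = s k * (1 - 1 / real n)"
      using n by simp
    moreover have "(n * log 2 p + p\<^sup>2 * log 2 (n\<^sup>2 + 1) + (real n)\<^sup>2 * graphon_entropy V / 2) * (2 / (real n)\<^sup>2)
       = 2 * log 2 (real p) / real n + 2 * real (p\<^sup>2) * log 2 ((real n)\<^sup>2 + 1) / (real n)\<^sup>2 + graphon_entropy V"
      using n by (simp add: power2_eq_square field_simps)
    moreover have "0 \<le> 1 / real n" by simp
    ultimately have "s k * (1 - 1 / real n) - ?err n \<le> graphon_entropy V" by linarith
    then have "s0 - \<epsilon> j \<le> graphon_entropy V" using k(1) by (simp add: n_def)
    then show "\<exists>kGV. j \<le> fst kGV \<and> fst (snd kGV) \<in> B (fst kGV) \<and> j \<le> \<nu> (fst kGV) \<and> snd (snd kGV) \<in> graphons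
      \<and> cut_dist (graph_graphon (fst (snd kGV))) (snd (snd kGV)) \<le> \<epsilon> j
      \<and> s0 - \<epsilon> j \<le> graphon_entropy (snd (snd kGV))"
      using GV k by (intro exI[of _ "(k, G, V)"]) auto
  qed
  from choice[OF this] obtain f where f:
    "\<And>j. fst (snd (f j)) \<in> B (fst (f j))" "\<And>j. j \<le> \<nu> (fst (f j))" "\<And>j. snd (snd (f j)) \<in> graphons"
    "\<And>j. cut_dist (graph_graphon (fst (snd (f j)))) (snd (snd (f j))) \<le> \<epsilon> j"
    "\<And>j. s0 - \<epsilon> j \<le> graphon_entropy (snd (snd (f j)))" by blast
  define \<kappa> G V where "\<kappa> j = fst (f j)" and "G j = fst (snd (f j))" and "V j = snd (snd (f j))" for j
  have V: "V j \<in> graphons" for j using f(3) by (simp add: V_def)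
  have GV: "cut_dist (graph_graphon (G j)) (V j) \<le> \<epsilon> j" for j using f(4) by (simp add: G_def V_def)
  have GB: "G j \<in> B (\<kappa> j)" for j using f(1) by (simp add: G_def \<kappa>_def)
  obtain r \<Lambda> where r: "strict_mono r" "\<Lambda> \<in> graph_limits" "(\<lambda>j. delta_cut (limit_of (V (r j))) \<Lambda>) \<longlonglongrightarrow> 0"
    using graph_limits_subsequence[of "\<lambda>j. limit_of (V j)", OF limit_of_in[OF V]] by blast
  have er: "(\<lambda>j. \<epsilon> (r j)) \<longlonglongrightarrow> 0" using LIMSEQ_subseq_LIMSEQ[OF \<epsilon>0 r(1)] by (simp add: o_def)
  have "(\<lambda>j. s0 - \<epsilon> (r j)) \<longlonglongrightarrow> s0 - 0" by (intro tendsto_diff tendsto_const er)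
  then have ent: "s0 \<le> Ent \<Lambda>"
    using f(5) by (intro Ent_upper_semicontinuous[OF limit_of_in[OF V] r(2,3), of "\<lambda>j. s0 - \<epsilon> (r j)"])
      (auto simp: Ent_limit_of V[unfolded V_def] V_def)
  have cd: "cut_dist (V j) (rep \<Lambda>) = delta_cut (limit_of (V j)) \<Lambda>" for j
    using cut_dist_rep_limit_of_right[OF rep_graphon[OF r(2)] V[of j]]
      cut_dist_commute[OF rep_graphon[OF r(2)] V[of j]]
      cut_dist_commute[OF rep_graphon[OF r(2)] rep_graphon[OF limit_of_in[OF V[of j]]]]
    by (simp add: delta_cut_def)
  have lim: "(\<lambda>j. cut_dist (graph_graphon (G (r j))) (rep \<Lambda>)) \<longlonglongrightarrow> 0"
  proof (rule tendsto_sandwich[OF _ _ tendsto_const])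
    show "\<forall>\<^sub>F j in sequentially. 0 \<le> cut_dist (graph_graphon (G (r j))) (rep \<Lambda>)"
      using cut_dist_nonneg[OF graph_graphon_graphon rep_graphon[OF r(2)]] by simp
    have "cut_dist (graph_graphon (G (r j))) (rep \<Lambda>) \<le> \<epsilon> (r j) + delta_cut (limit_of (V (r j))) \<Lambda>" for j
      using cut_dist_triangle[OF graph_graphon_graphon V rep_graphon[OF r(2)], of "G (r j)" "r j"] GV[of "r j"] cd[of "r j"]
      by simp
    then show "\<forall>\<^sub>F j in sequentially. cut_dist (graph_graphon (G (r j))) (rep \<Lambda>) \<le> \<epsilon> (r j) + delta_cut (limit_of (V (r j))) \<Lambda>"
      by simp
    show "(\<lambda>j. \<epsilon> (r j) + delta_cut (limit_of (V (r j))) \<Lambda>) \<longlonglongrightarrow> 0"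
      using tendsto_add[OF er r(3)] by simp
  qed
  have fstG: "j \<le> fst (G (r j))" for j
    using BG[OF GB[of "r j"]] f(2)[of "r j"] strict_mono_imp_increasing[OF r(1), of j] by (simp add: \<kappa>_def)
  have "\<Lambda> \<in> class_limits Q"
  proof (rule class_limitsI[OF r(2) _ _ lim])
    show "G (r j) \<in> Q" for j using GB[of "r j"] B(2)[of "\<kappa> (r j)"] by (auto simp: labeled_def)
    show "filterlim (\<lambda>j. fst (G (r j))) at_top sequentially"
      by (rule filterlim_at_top_mono[OF filterlim_ident]) (simp add: fstG)
  qed
  then show ?thesis
    using that[of "\<lambda>j. G (r j)" "\<lambda>j. \<kappa> (r j)" \<Lambda>] GB ent lim delta_cut_graph_point[OF r(2)] by simp
qed

subsection \<open>Isomorphism classes\<close>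

lemma equiv_iso_rel: "equiv {G. is_graph G} iso_rel"
proof (rule equivI)
  show "iso_rel \<subseteq> {G. is_graph G} \<times> {G. is_graph G}" by (auto simp: iso_rel_def)
  show "refl_on {G. is_graph G} iso_rel"
    by (auto simp: refl_on_def iso_rel_def isomorphic_def intro!: exI[of _ id])
  show "sym iso_rel"
  proof (rule symI)
    fix G H assume "(G, H) \<in> iso_rel"
    then obtain f where f: "is_graph G" "is_graph H" "bij_betw f {1..fst G} {1..fst H}"
      "snd H = (\<lambda>e. f ` e) ` snd G" by (auto simp: iso_rel_def isomorphic_def)
    let ?g = "inv_into {1..fst G} f"
    have "?g ` f ` e = e" if "e \<in> snd G" for e
      using that f(1) bij_betw_imp_inj_on[OF f(3)] by (intro inv_into_image_cancel) (auto simp: is_graph_def)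
    then have "snd G = (\<lambda>e. ?g ` e) ` snd H" unfolding f(4) by (force simp: image_image)
    then show "(H, G) \<in> iso_rel"
      using f(1,2) bij_betw_inv_into[OF f(3)] by (auto simp: iso_rel_def isomorphic_def)
  qed
  show "trans iso_rel"
  proof (rule transI)
    fix G H K assume "(G, H) \<in> iso_rel" "(H, K) \<in> iso_rel"
    then obtain f g where f: "is_graph G" "is_graph K" "bij_betw f {1..fst G} {1..fst H}"
      "snd H = (\<lambda>e. f ` e) ` snd G" "bij_betw g {1..fst H} {1..fst K}" "snd K = (\<lambda>e. g ` e) ` snd H"
      by (auto simp: iso_rel_def isomorphic_def)
    have "snd K = (\<lambda>e. (g \<circ> f) ` e) ` snd G" by (simp add: f(4,6) image_image image_comp)
    then show "(G, K) \<in> iso_rel"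
      using f(1,2) bij_betw_trans[OF f(3,5)] by (auto simp: iso_rel_def isomorphic_def)
  qed
qed

lemma finite_labeled:
  assumes "graph_class Q" shows "finite (labeled Q n)"
proof (rule finite_subset)
  show "labeled Q n \<subseteq> {n} \<times> Pow (all_edges n)"
  proof
    fix G assume "G \<in> labeled Q n"
    then have "is_graph G" "fst G = n" using assms by (auto simp: labeled_def graph_class_def)
    then show "G \<in> {n} \<times> Pow (all_edges n)"
      by (cases G) (auto simp: is_graph_def all_edges_def)
  qed
qed simp

text \<open>Makes the choice of representatives an injection of the isomorphism classes into
  \<open>labeled Q n\<close>.\<close>

lemma unlabeled_rep:
  assumes Q: "graph_class Q" and C: "C \<in> unlabeled Q n"
  shows "(SOME G. G \<in> C) \<in> C" "(SOME G. G \<in> C) \<in> labeled Q n" "C = iso_rel `` {SOME G. G \<in> C}"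
proof -
  obtain x where x: "x \<in> labeled Q n" "C = iso_rel `` {x}" using C by (auto simp: unlabeled_def elim: quotientE)
  have xg: "is_graph x" using x(1) Q by (auto simp: labeled_def graph_class_def)
  have "x \<in> C" using equiv_class_self[OF equiv_iso_rel, of x] xg x(2) by simp
  then show C': "(SOME G. G \<in> C) \<in> C" by (rule someI)
  then have iso: "(x, SOME G. G \<in> C) \<in> iso_rel" using x(2) by blast
  then obtain f where "bij_betw f {1..fst x} {1..fst (SOME G. G \<in> C)}"
    by (auto simp: iso_rel_def isomorphic_def)
  then have "fst x = fst (SOME G. G \<in> C)" using bij_betw_same_card by fastforce
  moreover have "(SOME G. G \<in> C) \<in> Q" using iso x(1) Q unfolding graph_class_def labeled_def by blast
  ultimately show "(SOME G. G \<in> C) \<in> labeled Q n" using x(1) by (simp add: labeled_def)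
  show "C = iso_rel `` {SOME G. G \<in> C}" using equiv_class_eq[OF equiv_iso_rel iso] x(2) by (rule trans[rotated])
qed

lemma finite_unlabeled: "graph_class Q \<Longrightarrow> finite (unlabeled Q n)"
  unfolding unlabeled_def quotient_def by (intro finite_UN_I finite_labeled) auto

lemma card_unlabeled_le: 
  assumes "graph_class Q" shows "card (unlabeled Q n) \<le> card (labeled Q n)"
proof -
  have "unlabeled Q n = (\<lambda>x. iso_rel `` {x}) ` labeled Q n" by (auto simp: unlabeled_def quotient_def)
  then show ?thesis using card_image_le[OF finite_labeled[OF assms]] by simp
qed

subsection \<open>Concentration near the maximal limits\<close>

lemma near_maxI:
  assumes "\<Lambda> \<in> max_class_limits Q" "delta_cut (graph_point G) \<Lambda> < \<delta>"
  shows "graph_point G \<in> near_max Q \<delta>"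
proof -
  have "delta_cut_set (graph_point G) (max_class_limits Q) \<le> ereal (delta_cut (graph_point G) \<Lambda>)"
    unfolding delta_cut_set_def by (rule INF_lower[OF assms(1)])
  also have "\<dots> < ereal \<delta>" using assms(2) by simp
  finally show ?thesis using graph_point_in by (simp add: near_max_def)
qed

text \<open>The trivial lower bound 0 for the logarithm of the number of graphs already lets
  compactness produce a limit.\<close>

lemma class_limits_nonempty:
  assumes Q: "graph_class Q" and ne: "\<forall>\<^sub>F n in sequentially. unlabeled Q n \<noteq> {}"
  shows "class_limits Q \<noteq> {}"
proof -
  obtain N where N: "\<And>n. n \<ge> N \<Longrightarrow> unlabeled Q n \<noteq> {}" using ne by (auto simp: eventually_sequentially)
  have L: "labeled Q n \<noteq> {}" if "n \<ge> N" for n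
    using N[OF that] by (auto simp: unlabeled_def)
  have "filterlim (\<lambda>k. k + N) at_top sequentially" by (rule filterlim_add_const_nat_at_top)
  moreover have "0 * real (k + N choose 2) \<le> log 2 (card (labeled Q (k + N)))" for k
    using L[of "k + N"] finite_labeled[OF Q, of "k + N"] by (simp add: card_gt_0_iff Suc_le_eq)
  moreover have "labeled Q (k + N) \<noteq> {}" for k using L by simp
  ultimately show ?thesis
    using limit_of_large_sets[of "\<lambda>k. k + N" "\<lambda>k. labeled Q (k + N)" Q "\<lambda>_. 0" 0, OF _ _ order_refl Q tendsto_const]
    by blast
qed

text \<open>Otherwise, along a subsequence, \<open>B n\<close> would have at least \<open>c\<close>
  times as many elements as there are unlabeled graphs, hence the same growth rate
  \<open>max_Ent Q\<close>. Graphs from these sets then approach a limit of maximal entropy, which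
  puts some of them into \<open>near_max\<close>.\<close>

lemma large_sets_meet_near_max:
  fixes B :: "nat \<Rightarrow> graph set" and \<delta> c :: real
  assumes Q: "graph_class Q" and ne: "\<forall>\<^sub>F n in sequentially. unlabeled Q n \<noteq> {}"
    and lim: "(\<lambda>n. log 2 (real (card (unlabeled Q n))) / real (n choose 2)) \<longlonglongrightarrow> max_Ent Q"
    and B: "\<And>n. B n \<subseteq> labeled Q n" "\<And>n G. G \<in> B n \<Longrightarrow> graph_point G \<notin> near_max Q \<delta>" and \<delta>: "\<delta> > 0" and c: "c > 0"
  shows "\<forall>\<^sub>F n in sequentially. card (B n) < c * card (unlabeled Q n)"
proof (rule ccontr)
  assume "\<not> ?thesis"
  then have "\<exists>\<^sub>F n in sequentially. c * card (unlabeled Q n) \<le> card (B n)"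
    by (simp add: frequently_def not_le)
  moreover have "\<forall>\<^sub>F n in sequentially. unlabeled Q n \<noteq> {} \<and> 2 \<le> n"
    using ne eventually_ge_at_top[of 2] by eventually_elim simp
  ultimately have "\<exists>\<^sub>F n in sequentially. c * card (unlabeled Q n) \<le> card (B n) \<and> unlabeled Q n \<noteq> {} \<and> 2 \<le> n"
    by (rule frequently_eventually_frequently)
  then have "infinite {n. c * card (unlabeled Q n) \<le> card (B n) \<and> unlabeled Q n \<noteq> {} \<and> 2 \<le> n}"
    by (simp add: cofinite_eq_sequentially[symmetric] frequently_cofinite)
  then obtain \<nu> :: "nat \<Rightarrow> nat" where \<nu>: "strict_mono \<nu>"
    "\<And>k. c * card (unlabeled Q (\<nu> k)) \<le> card (B (\<nu> k)) \<and> unlabeled Q (\<nu> k) \<noteq> {} \<and> 2 \<le> \<nu> k"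
    using infinite_enumerate[of "{n. c * card (unlabeled Q n) \<le> card (B n) \<and> unlabeled Q n \<noteq> {} \<and> 2 \<le> n}"] by blast
  have upos: "0 < real (card (unlabeled Q (\<nu> k)))" for k
    using \<nu>(2)[of k] finite_unlabeled[OF Q] by (simp add: card_gt_0_iff)
  have pos: "0 < real (card (B (\<nu> k)))" for k
    using \<nu>(2)[of k] mult_pos_pos[OF c upos[of k]] by linarith
  have inf: "filterlim \<nu> at_top sequentially" using \<nu>(1) by (rule filterlim_subseq)
  \<comment> \<open>The constant factor \<open>c\<close> contributes a term that vanishes after
    division by \<open>n choose 2\<close>.\<close>
  define s where "s k = log 2 c / real (\<nu> k choose 2)
      + log 2 (real (card (unlabeled Q (\<nu> k)))) / real (\<nu> k choose 2)" for k
  have "(\<lambda>n. log 2 c / real (n choose 2)) \<longlonglongrightarrow> 0"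
  proof (rule tendsto_divide_0[OF tendsto_const])
    have "\<forall>\<^sub>F n in sequentially. n \<le> real (n choose 2)"
      using eventually_ge_at_top[of 3]
    proof eventually_elim
      case (elim n)
      have "n * 2 \<le> n * (n - 1)" using elim by (intro mult_le_mono) auto
      from div_le_mono[OF this, of 2] have "n \<le> n choose 2" by (simp add: choose_two)
      then show ?case by simp
    qed
    from filterlim_at_top_mono[OF filterlim_real_sequentially this]
    show "filterlim (\<lambda>n. real (n choose 2)) at_infinity sequentially"
      by (rule filterlim_at_top_imp_at_infinity)
  qed
  from tendsto_add[OF filterlim_compose[OF this inf] filterlim_compose[OF lim inf]]
  have sl: "s \<longlonglongrightarrow> max_Ent Q" by (simp add: s_def[abs_def])
  have sle: "s k * real (\<nu> k choose 2) \<le> log 2 (card (B (\<nu> k)))" for k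
  proof -
    have "0 < \<nu> k choose 2" using \<nu>(2)[of k] by simp
    then have "s k * real (\<nu> k choose 2) = log 2 c + log 2 (card (unlabeled Q (\<nu> k)))"
      by (simp add: s_def distrib_right)
    also have "\<dots> = log 2 (c * card (unlabeled Q (\<nu> k)))"
      using c upos[of k] by (simp add: log_mult)
    also have "\<dots> \<le> log 2 (card (B (\<nu> k)))"
      using \<nu>(2)[of k] c upos[of k] pos[of k] by (subst log_le_cancel_iff) auto
    finally show ?thesis .
  qed
  have Bne: "B (\<nu> k) \<noteq> {}" for k
  proof
    assume "B (\<nu> k) = {}"
    then have "card (B (\<nu> k)) = 0" by (simp only: card.empty)
    then show False using pos[of k] by simp
  qed
  obtain \<kappa> G \<Lambda> where G: "\<And>j. G j \<in> B (\<nu> (\<kappa> j))" "\<Lambda> \<in> class_limits Q" "max_Ent Q \<le> Ent \<Lambda>"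
    "(\<lambda>j. delta_cut (graph_point (G j)) \<Lambda>) \<longlonglongrightarrow> 0"
    by (rule limit_of_large_sets[of \<nu> "\<lambda>k. B (\<nu> k)" Q s "max_Ent Q", OF inf Bne B(1) Q sl sle]) blast
  obtain \<Lambda>0 where "\<Lambda>0 \<in> class_limits Q" "Ent \<Lambda>0 = max_Ent Q" "\<forall>\<Gamma>\<in>class_limits Q. Ent \<Gamma> \<le> Ent \<Lambda>0"
    using max_Ent_attained[OF class_limits_nonempty[OF Q ne]] by blast
  then have "\<Lambda> \<in> max_class_limits Q" using G(2,3) by (force simp: max_class_limits_def)
  moreover obtain j where "delta_cut (graph_point (G j)) \<Lambda> < \<delta>"
    using order_tendstoD(2)[OF G(4) \<delta>] eventually_happens'[OF sequentially_bot] by blast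
  ultimately have "graph_point (G j) \<in> near_max Q \<delta>" by (rule near_maxI)
  then show False using B(2) G(1) by blast
qed

lemma prob_tendsto_1:
  fixes S :: "nat \<Rightarrow> 'a set"
  assumes fin: "\<And>n. finite (S n)" and ne: "\<forall>\<^sub>F n in sequentially. S n \<noteq> {}"
    and bad: "\<And>c :: real. c > 0 \<Longrightarrow> \<forall>\<^sub>F n in sequentially. card {x \<in> S n. x \<notin> A} \<le> c * card (S n)"
  shows "(\<lambda>n. measure_pmf.prob (pmf_of_set (S n)) A) \<longlonglongrightarrow> 1"
proof (rule tendstoI)
  fix e :: real assume e: "e > 0"
  show "\<forall>\<^sub>F n in sequentially. dist (measure_pmf.prob (pmf_of_set (S n)) A) 1 < e"
    using ne bad[OF half_gt_zero[OF e]]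
  proof eventually_elim
    case (elim n)
    have "{x \<in> S n. x \<notin> A} = S n \<inter> - A" by auto
    then have "measure_pmf.prob (pmf_of_set (S n)) (- A) = card {x \<in> S n. x \<notin> A} / card (S n)"
      using measure_pmf_of_set[OF elim(1) fin, of "- A"] by simp
    moreover have "0 < real (card (S n))" using elim(1) fin by (simp add: card_gt_0_iff)
    ultimately have "measure_pmf.prob (pmf_of_set (S n)) (- A) \<le> e / 2"
      using elim(2) by (simp add: divide_le_eq)
    moreover have "measure_pmf.prob (pmf_of_set (S n)) (- A) = 1 - measure_pmf.prob (pmf_of_set (S n)) A"
      using measure_pmf.prob_compl[of A "pmf_of_set (S n)"] by (simp add: Compl_eq_Diff_UNIV)
    ultimately show ?case using e measure_pmf.prob_le_1[of "pmf_of_set (S n)" A] by (simp add: dist_real_def)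
  qed
qed

theorem theorem6p1:
  fixes Q :: "graph set"
  assumes "graph_class Q"
    and "\<forall>\<^sub>F n in sequentially. unlabeled Q n \<noteq> {}"
    and "(\<lambda>n. log 2 (real (card (unlabeled Q n))) / real (n choose 2)) \<longlonglongrightarrow> max_Ent Q"
  shows "(\<forall>\<delta>>0. (\<lambda>n. measure_pmf.prob (pmf_of_set (unlabeled Q n))
                        {C. unlabeled_point C \<in> near_max Q \<delta>}) \<longlonglongrightarrow> 1) \<and>
         (\<forall>\<delta>>0. (\<lambda>n. measure_pmf.prob (pmf_of_set (labeled Q n))
                        {G. graph_point G \<in> near_max Q \<delta>}) \<longlonglongrightarrow> 1)"
proof (intro conjI allI impI)
  fix \<delta> :: real assume \<delta>: "\<delta> > 0"
  show "(\<lambda>n. measure_pmf.prob (pmf_of_set (unlabeled Q n)) {C. unlabeled_point C \<in> near_max Q \<delta>}) \<longlonglongrightarrow> 1"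
  proof (rule prob_tendsto_1[OF finite_unlabeled[OF assms(1)] assms(2)])
    fix c :: real assume c: "c > 0"
    let ?bad = "\<lambda>n. {C \<in> unlabeled Q n. C \<notin> {C. unlabeled_point C \<in> near_max Q \<delta>}}"
    \<comment> \<open>Bad classes are counted through their representatives, since the estimate is
      about sets of labeled graphs.\<close>
    let ?rep = "\<lambda>C :: graph set. SOME G. G \<in> C"
    have "\<forall>\<^sub>F n in sequentially. card (?rep ` ?bad n) < c * card (unlabeled Q n)"
      by (rule large_sets_meet_near_max[OF assms _ _ \<delta> c])
         (use unlabeled_rep(2)[OF assms(1)] in \<open>auto simp: unlabeled_point_def\<close>)
    moreover have "card (?rep ` ?bad n) = card (?bad n)" for n
    proof (rule card_image, rule inj_onI)
      fix C C' assume "C \<in> ?bad n" "C' \<in> ?bad n" and eq: "?rep C = ?rep C'"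
      then have "C = iso_rel `` {?rep C}" "C' = iso_rel `` {?rep C'}"
        using unlabeled_rep(3)[OF assms(1)] by blast+
      then show "C = C'" using eq by simp
    qed
    ultimately show "\<forall>\<^sub>F n in sequentially. card (?bad n) \<le> c * card (unlabeled Q n)"
      by (auto elim: eventually_mono)
  qed
next
  fix \<delta> :: real assume \<delta>: "\<delta> > 0"
  show "(\<lambda>n. measure_pmf.prob (pmf_of_set (labeled Q n)) {G. graph_point G \<in> near_max Q \<delta>}) \<longlonglongrightarrow> 1"
  proof (rule prob_tendsto_1[OF finite_labeled[OF assms(1)]])
    show "\<forall>\<^sub>F n in sequentially. labeled Q n \<noteq> {}"
      using assms(2) by eventually_elim (auto simp: unlabeled_def)
    fix c :: real assume c: "c > 0"
    let ?bad = "\<lambda>n. {G \<in> labeled Q n. G \<notin> {G. graph_point G \<in> near_max Q \<delta>}}"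
    have "\<forall>\<^sub>F n in sequentially. card (?bad n) < c * card (unlabeled Q n)"
      by (rule large_sets_meet_near_max[OF assms _ _ \<delta> c]) auto
    \<comment> \<open>The estimate is relative to the smaller number of unlabeled graphs, so it
      holds all the more relative to the labeled ones.\<close>
    moreover have "c * card (unlabeled Q n) \<le> c * card (labeled Q n)" for n
      using card_unlabeled_le[OF assms(1), of n] c by simp
    ultimately show "\<forall>\<^sub>F n in sequentially. card (?bad n) \<le> c * card (labeled Q n)"
      by (auto elim!: eventually_mono intro: order_trans less_imp_le)
  qed
qed

end
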